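(* Let $n\le m$ and let $X$ be a local isometric immersion of a flat $n$-dimensional submanifold in $\mathbb R^{m+n}$ with flat and non-degenerate normal bundle. Fix a local parallel normal frame $e_{n+1},\dots,e_{n+m}$. Then: (i) There exist line of curvature coordinates $(x_1,\dots,x_n)$, a smooth $\mathcal M_{m\times n}$-valued map $A_1=(a_{ij})$ and a smooth map $b=(b_1,\dots,b_n)$ such that $A_1^tA_1=I$ and the first and second fundamental forms of $X$ are given by $$I=\sum_{i=1}^n b_i^2\,dx_i^2,\qquad II=\sum_{i=1}^n\sum_{j=1}^m b_ia_{ji}\,dx_i^2\,e_{n+j}.\qquad(1)$$ (ii) Let $f_{ij}=(b_i)_{x_j}/b_j$ for $i\ne j$, $f_{ii}=0$, and $F=(f_{ij})$. Then $(A_1,F)$ is a solution of the $G_{m,n}$-system I. Moreover, if $e_i:=\frac1{b_i}X_{x_i}$ and $g:=(e_{n+1},\dots,e_{n+m},e_1,\dots,e_n)$, then $$g^{-1}dg=\sum_{i=1}^n\begin{pmatrix}0&-A_1C_i\\ C_iA_1^t&-F^tC_i+C_iF\end{pmatrix}dx_i,$$ which is the Lax connection $\theta^I_\lambda$ of the $G_{m,n}$-system I at $\lambda=1$. (iii) Conversely, if $(A_1,F)$ is a solution of the $G_{m,n}$-system I and $b_1,\dots,b_n$ satisfy $$(b_i)_{x_j}=f_{ij}b_j,\qquad 1\le i\ne j\le n,$$ then there exists a local isometric immersion of $\mathbb R^n$ in $\mathbb R^{n+m}$ such that the two fundamental forms are given by (1), where $A_1=(a_{ij})$ and $F=(f_{ij})$.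 (iv) $X$ lies in a hypersphere of radius $1$ if and only if $b=vA_1$ for some constant unit vector $v\in\mathcal M_{1\times m}$.
   Context: $\mathcal M_{p\times q}$ is the space of real $p\times q$ matrices, $\mathcal M^0_{m\times n}=\{A_1\in\mathcal M_{m\times n}:A_1^tA_1=I\}$, $gl_*(n)$ the space of real $n\times n$ matrices with zero diagonal, $C_i$ the $n\times n$ matrix whose only non-zero entry is a $1$ at $(i,i)$. The $G_{m,n}$-system I is the PDE for $(A_1,F)=((a_{ij}),(f_{ij})):\mathbb R^n\to\mathcal M^0_{m\times n}\times gl_*(n)$: $(a_{ij})_{x_k}=f_{jk}a_{ik}$ if $k\ne j$; $(f_{ij})_{x_j}+(f_{ji})_{x_i}+\sum_kf_{ik}f_{jk}=0$ if $i\ne j$; $(f_{ij})_{x_k}=f_{ik}f_{kj}$ if $i,j,k$ are distinct. Its Lax connection is $\theta^I_\lambda=\sum_i\begin{pmatrix}0&-A_1C_i\lambda\\ C_iA_1^t\lambda&-F^tC_i+C_iF\end{pmatrix}dx_i$ (the system is equivalent to its flatness for all $\lambda\in\mathbb C$). Conventions: with $\omega_i=\langle dX,e_i\rangle$ and $\omega_{i\alpha}=\langle e_i,de_\alpha\rangle$ for an orthonormal tangent frame $e_i$ and normal frame $e_\alpha$, $I=\sum_i\omega_i^2$ and $II=\sum_{i,\alpha}\omega_{i\alpha}\omega_ie_\alpha$. The normal bundle is non-degenerate if at each point the space of shape operators $\{A_v:v\text{ normal}\}$ has dimension $n$, where $\langle A_v(v_1),v_2\rangle=\langle II(v_1,v_2),v\rangle$.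 Line of curvature coordinates with respect to an orthonormal parallel normal frame $\{e_\alpha\}$ are coordinates in which $I=\sum_ia_i^2dx_i^2$ and $II=\sum_{i,j}b_{ji}dx_i^2e_{n+j}$ for some smooth functions. *)

theory Defs
  imports "HOL-Analysis.Analysis"
begin

section \<open>Smooth maps on open sets\<close>

primrec Ck_on :: "nat \<Rightarrow> 'a::euclidean_space set \<Rightarrow> ('a \<Rightarrow> 'b::real_normed_vector) \<Rightarrow> bool" where
  "Ck_on 0 S f \<longleftrightarrow> continuous_on S f"
| "Ck_on (Suc k) S f \<longleftrightarrow> (\<forall>x\<in>S. f differentiable (at x)) \<and>
     (\<forall>v. Ck_on k S (\<lambda>x. frechet_derivative f (at x) v))"

text \<open>Only meant for open \<open>S\<close>.\<close>

definition smooth_on :: "'a::euclidean_space set \<Rightarrow> ('a \<Rightarrow> 'b::real_normed_vector) \<Rightarrow> bool" where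
  "smooth_on S f \<longleftrightarrow> (\<forall>k. Ck_on k S f)"

definition partial :: "(real^'n::finite \<Rightarrow> 'b::real_normed_vector) \<Rightarrow> 'n \<Rightarrow> real^'n \<Rightarrow> 'b" where
  "partial f k x = frechet_derivative f (at x) (axis k 1)"

definition diffeo :: "(real^'n::finite \<Rightarrow> real^'n) \<Rightarrow> (real^'n) set \<Rightarrow> (real^'n) set \<Rightarrow> bool" where
  "diffeo \<phi> W V \<longleftrightarrow> open W \<and> open V \<and> smooth_on W \<phi> \<and> \<phi> ` W = V \<and>
     (\<exists>\<psi>. smooth_on V \<psi> \<and> (\<forall>x\<in>W. \<psi> (\<phi> x) = x))"


section \<open>Immersions and the induced metric\<close>

text \<open>The ambient space of dimension $m+n$ is \<open>real^('m + 'n)\<close>; a (local) submanifold is a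
  parametrized immersion of an open subset of \<open>real^'n\<close>.\<close>

definition immersion_on ::
  "(real^'n::finite) set \<Rightarrow> (real^'n \<Rightarrow> real^('m::finite + 'n)) \<Rightarrow> bool" where
  "immersion_on U X \<longleftrightarrow> open U \<and> smooth_on U X \<and> (\<forall>x\<in>U. inj (frechet_derivative X (at x)))"

definition first_ff ::
  "(real^'n::finite \<Rightarrow> real^('m::finite + 'n)) \<Rightarrow> real^'n \<Rightarrow> real^'n \<Rightarrow> real^'n \<Rightarrow> real" where
  "first_ff X x u w = frechet_derivative X (at x) u \<bullet> frechet_derivative X (at x) w"

definition metric_matrix ::
  "(real^'n::finite \<Rightarrow> real^('m::finite + 'n)) \<Rightarrow> real^'n \<Rightarrow> real^'n^'n" where
  "metric_matrix X x = (\<chi> i j. first_ff X x (axis i 1) (axis j 1))"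

text \<open>\<open>christoffel G i j l\<close> is $\Gamma^l_{ij}$ and \<open>riemann G i j k l\<close> is the $l$-th component of
  $R(\partial_i,\partial_j)\partial_k$, for the metric with coefficient matrix \<open>G\<close>.\<close>

definition christoffel ::
  "(real^'n::finite \<Rightarrow> real^'n^'n) \<Rightarrow> 'n \<Rightarrow> 'n \<Rightarrow> 'n \<Rightarrow> real^'n \<Rightarrow> real" where
  "christoffel G i j l x = (1/2) * (\<Sum>p\<in>UNIV. matrix_inv (G x) $ l $ p *
     (partial (\<lambda>y. G y $ j $ p) i x + partial (\<lambda>y. G y $ i $ p) j x
      - partial (\<lambda>y. G y $ i $ j) p x))"

definition riemann ::
  "(real^'n::finite \<Rightarrow> real^'n^'n) \<Rightarrow> 'n \<Rightarrow> 'n \<Rightarrow> 'n \<Rightarrow> 'n \<Rightarrow> real^'n \<Rightarrow> real" where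
  "riemann G i j k l x =
     partial (christoffel G j k l) i x - partial (christoffel G i k l) j x
     + (\<Sum>p\<in>UNIV. christoffel G j k p x * christoffel G i p l x
                  - christoffel G i k p x * christoffel G j p l x)"

definition flat_induced_metric ::
  "(real^'n::finite) set \<Rightarrow> (real^'n \<Rightarrow> real^('m::finite + 'n)) \<Rightarrow> bool" where
  "flat_induced_metric U X \<longleftrightarrow> (\<forall>x\<in>U. \<forall>i j k l. riemann (metric_matrix X) i j k l x = 0)"

text \<open>Up to a change of coordinates \<open>X\<close> is an isometric immersion of an open piece of
  Euclidean space.\<close>

definition isometric_from_euclidean ::
  "(real^'n::finite) set \<Rightarrow> (real^'n \<Rightarrow> real^('m::finite + 'n)) \<Rightarrow> bool" where
  "isometric_from_euclidean U X \<longleftrightarrow>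
     (\<exists>W \<psi>. diffeo \<psi> W U \<and> (\<forall>y\<in>W. \<forall>u w. first_ff (X \<circ> \<psi>) y u w = u \<bullet> w))"


section \<open>The normal bundle\<close>

definition normal_space ::
  "(real^'n::finite \<Rightarrow> real^('m::finite + 'n)) \<Rightarrow> real^'n \<Rightarrow> (real^('m + 'n)) set" where
  "normal_space X x = {v. \<forall>u. frechet_derivative X (at x) u \<bullet> v = 0}"

definition normal_part ::
  "(real^'n::finite \<Rightarrow> real^('m::finite + 'n)) \<Rightarrow> real^'n \<Rightarrow> real^('m + 'n) \<Rightarrow> real^('m + 'n)" where
  "normal_part X x v =
     (THE w. w \<in> normal_space X x \<and> v - w \<in> range (frechet_derivative X (at x)))"

definition normal_deriv ::
  "(real^'n::finite \<Rightarrow> real^('m::finite + 'n)) \<Rightarrow> 'n \<Rightarrow> (real^'n \<Rightarrow> real^('m + 'n))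
     \<Rightarrow> real^'n \<Rightarrow> real^('m + 'n)" where
  "normal_deriv X k \<xi> x = normal_part X x (partial \<xi> k x)"

text \<open>Vanishing of the curvature of the normal connection; the coordinate fields commute.\<close>

definition flat_normal_bundle ::
  "(real^'n::finite) set \<Rightarrow> (real^'n \<Rightarrow> real^('m::finite + 'n)) \<Rightarrow> bool" where
  "flat_normal_bundle U X \<longleftrightarrow>
     (\<forall>\<xi>. smooth_on U \<xi> \<and> (\<forall>x\<in>U. \<xi> x \<in> normal_space X x) \<longrightarrow>
        (\<forall>x\<in>U. \<forall>i j. normal_deriv X i (normal_deriv X j \<xi>) x
                      = normal_deriv X j (normal_deriv X i \<xi>) x))"

definition parallel_normal_frame ::
  "(real^'n::finite) set \<Rightarrow> (real^'n \<Rightarrow> real^('m::finite + 'n))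
     \<Rightarrow> ('m \<Rightarrow> real^'n \<Rightarrow> real^('m + 'n)) \<Rightarrow> bool" where
  "parallel_normal_frame U X e \<longleftrightarrow>
     (\<forall>j. smooth_on U (e j)) \<and>
     (\<forall>x\<in>U. (\<forall>j. e j x \<in> normal_space X x) \<and>
             (\<forall>j l. e j x \<bullet> e l x = (if j = l then 1 else 0)) \<and>
             (\<forall>j k. normal_deriv X k (e j) x = 0))"

text \<open>$II=\sum_{i,\alpha}\omega_{i\alpha}\omega_i e_\alpha$ with $\omega_i=\langle dX,e_i\rangle$ and
  $\omega_{i\alpha}=\langle e_i,de_\alpha\rangle$: summing over an orthonormal tangent frame $e_i$ gives
  $\langle II(u,w),e_\alpha\rangle=\langle dX(u),de_\alpha(w)\rangle$. With this sign convention $II$ is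
  minus the normal part of the second derivative of $X$.\<close>

definition second_ff ::
  "(real^'n::finite \<Rightarrow> real^('m::finite + 'n)) \<Rightarrow> ('m \<Rightarrow> real^'n \<Rightarrow> real^('m + 'n))
     \<Rightarrow> real^'n \<Rightarrow> real^'n \<Rightarrow> real^'n \<Rightarrow> real^('m + 'n)" where
  "second_ff X e x u w =
     (\<Sum>j\<in>UNIV. (frechet_derivative X (at x) u \<bullet> frechet_derivative (e j) (at x) w) *\<^sub>R e j x)"

text \<open>Shape operators $A_v$, as matrices with respect to the coordinate tangent basis.\<close>

definition shape_operators ::
  "(real^'n::finite \<Rightarrow> real^('m::finite + 'n)) \<Rightarrow> ('m \<Rightarrow> real^'n \<Rightarrow> real^('m + 'n))
     \<Rightarrow> real^'n \<Rightarrow> (real^'n^'n) set" where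
  "shape_operators X e x =
     {S. \<exists>v\<in>normal_space X x. \<forall>u w. first_ff X x (S *v u) w = second_ff X e x u w \<bullet> v}"

definition nondegenerate_normal_bundle ::
  "(real^'n::finite) set \<Rightarrow> (real^'n \<Rightarrow> real^('m::finite + 'n))
     \<Rightarrow> ('m \<Rightarrow> real^'n \<Rightarrow> real^('m + 'n)) \<Rightarrow> bool" where
  "nondegenerate_normal_bundle U X e \<longleftrightarrow> (\<forall>x\<in>U. dim (shape_operators X e x) = CARD('n))"


section \<open>Line of curvature coordinates\<close>

definition line_of_curvature_coords ::
  "(real^'n::finite) set \<Rightarrow> (real^'n \<Rightarrow> real^('m::finite + 'n))
     \<Rightarrow> ('m \<Rightarrow> real^'n \<Rightarrow> real^('m + 'n)) \<Rightarrow> bool" where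
  "line_of_curvature_coords W Y e \<longleftrightarrow>
     (\<exists>(a :: real^'n \<Rightarrow> real^'n) (h :: real^'n \<Rightarrow> real^'n^'m).
        smooth_on W a \<and> smooth_on W h \<and>
        (\<forall>x\<in>W. \<forall>u w.
           first_ff Y x u w = (\<Sum>i\<in>UNIV. (a x $ i)\<^sup>2 * u $ i * w $ i) \<and>
           second_ff Y e x u w =
             (\<Sum>i\<in>UNIV. \<Sum>j\<in>UNIV. (h x $ j $ i * u $ i * w $ i) *\<^sub>R e j x)))"

text \<open>$I=\sum_i b_i^2dx_i^2$ and $II=\sum_{i,j}b_ia_{ji}dx_i^2e_{n+j}$.\<close>

definition fundamental_forms ::
  "(real^'n::finite) set \<Rightarrow> (real^'n \<Rightarrow> real^('m::finite + 'n))
     \<Rightarrow> ('m \<Rightarrow> real^'n \<Rightarrow> real^('m + 'n)) \<Rightarrow> (real^'n \<Rightarrow> real^'n^'m) \<Rightarrow> (real^'n \<Rightarrow> real^'n) \<Rightarrow> bool" where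
  "fundamental_forms W Y e A b \<longleftrightarrow>
     (\<forall>x\<in>W. \<forall>u w.
        first_ff Y x u w = (\<Sum>i\<in>UNIV. (b x $ i)\<^sup>2 * u $ i * w $ i) \<and>
        second_ff Y e x u w =
          (\<Sum>i\<in>UNIV. \<Sum>j\<in>UNIV. (b x $ i * A x $ j $ i * u $ i * w $ i) *\<^sub>R e j x))"

text \<open>The conditions on \<open>(\<phi>, A, b)\<close> in part (i) of the theorem: \<open>\<phi>\<close> is the inverse of the coordinate
  chart $(x_1,\dots,x_n)$.\<close>

definition adapted_coords ::
  "(real^'n::finite) set \<Rightarrow> (real^'n \<Rightarrow> real^('m::finite + 'n))
     \<Rightarrow> ('m \<Rightarrow> real^'n \<Rightarrow> real^('m + 'n)) \<Rightarrow> (real^'n \<Rightarrow> real^'n) \<Rightarrow> (real^'n) set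
     \<Rightarrow> (real^'n \<Rightarrow> real^'n^'m) \<Rightarrow> (real^'n \<Rightarrow> real^'n) \<Rightarrow> bool" where
  "adapted_coords U X e \<phi> W A b \<longleftrightarrow>
     diffeo \<phi> W (\<phi> ` W) \<and> \<phi> ` W \<subseteq> U \<and>
     line_of_curvature_coords W (X \<circ> \<phi>) (\<lambda>j. e j \<circ> \<phi>) \<and>
     smooth_on W A \<and> smooth_on W b \<and>
     (\<forall>x\<in>W. transpose (A x) ** A x = mat 1) \<and>
     fundamental_forms W (X \<circ> \<phi>) (\<lambda>j. e j \<circ> \<phi>) A b"


section \<open>The $G_{m,n}$-system I\<close>

definition G_system_I ::
  "(real^'n::finite) set \<Rightarrow> (real^'n \<Rightarrow> real^'n^'m::finite) \<Rightarrow> (real^'n \<Rightarrow> real^'n^'n) \<Rightarrow> bool" where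
  "G_system_I \<Omega> A F \<longleftrightarrow> smooth_on \<Omega> A \<and> smooth_on \<Omega> F \<and>
     (\<forall>x\<in>\<Omega>.
        transpose (A x) ** A x = mat 1 \<and> (\<forall>i. F x $ i $ i = 0) \<and>
        (\<forall>i j k. k \<noteq> j \<longrightarrow> partial (\<lambda>y. A y $ i $ j) k x = F x $ j $ k * A x $ i $ k) \<and>
        (\<forall>i j. i \<noteq> j \<longrightarrow>
           partial (\<lambda>y. F y $ i $ j) j x + partial (\<lambda>y. F y $ j $ i) i x
             + (\<Sum>k\<in>UNIV. F x $ i $ k * F x $ j $ k) = 0) \<and>
        (\<forall>i j k. i \<noteq> j \<and> j \<noteq> k \<and> i \<noteq> k \<longrightarrow>
           partial (\<lambda>y. F y $ i $ j) k x = F x $ i $ k * F x $ k $ j))"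

definition C_mat :: "'n::finite \<Rightarrow> 'a::comm_ring_1^'n^'n" where
  "C_mat i = (\<chi> k l. if k = i \<and> l = i then 1 else 0)"

definition block_matrix ::
  "'a^'m^'m \<Rightarrow> 'a^'n^'m \<Rightarrow> 'a^'m^'n \<Rightarrow> 'a^'n^'n \<Rightarrow> 'a^('m::finite + 'n::finite)^('m + 'n)" where
  "block_matrix P Q R S = (\<chi> r c. case r of
      Inl j \<Rightarrow> (case c of Inl l \<Rightarrow> P $ j $ l | Inr l \<Rightarrow> Q $ j $ l)
    | Inr i \<Rightarrow> (case c of Inl l \<Rightarrow> R $ i $ l | Inr l \<Rightarrow> S $ i $ l))"

text \<open>Coefficient of $dx_i$ in the Lax connection $\theta^I_\lambda$, over an arbitrary ring of
  scalars since the spectral parameter is real here and complex in general.\<close>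

definition lax_I ::
  "'a::comm_ring_1^'n::finite^'m::finite \<Rightarrow> 'a^'n^'n \<Rightarrow> 'a \<Rightarrow> 'n \<Rightarrow> 'a^('m + 'n)^('m + 'n)" where
  "lax_I A F lam i = block_matrix
     0 (- (A ** C_mat i ** mat lam))
     (C_mat i ** transpose A ** mat lam) (- (transpose F ** C_mat i) + C_mat i ** F)"

definition F_of :: "(real^'n::finite \<Rightarrow> real^'n) \<Rightarrow> real^'n \<Rightarrow> real^'n^'n" where
  "F_of b x = (\<chi> i j. if i = j then 0 else partial (\<lambda>y. b y $ i) j x / b x $ j)"

text \<open>The matrix with columns $e_{n+1},\dots,e_{n+m},e_1,\dots,e_n$, where $e_i=Y_{x_i}/b_i$.\<close>

definition adapted_frame ::
  "(real^'n::finite \<Rightarrow> real^('m::finite + 'n)) \<Rightarrow> ('m \<Rightarrow> real^'n \<Rightarrow> real^('m + 'n))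
     \<Rightarrow> (real^'n \<Rightarrow> real^'n) \<Rightarrow> real^'n \<Rightarrow> real^('m + 'n)^('m + 'n)" where
  "adapted_frame Y e b x = (\<chi> r c. case c of
      Inl j \<Rightarrow> e j x $ r
    | Inr i \<Rightarrow> ((1 / b x $ i) *\<^sub>R partial Y i x) $ r)"

end

theory Submission
  imports Defs
begin

text \<open>
  In an adapted orthonormal frame \<open>(e\<^sub>\<alpha>, e\<^sub>i)\<close> with \<open>\<partial>\<^sub>i X = b\<^sub>i e\<^sub>i\<close> and \<open>\<partial>\<^sub>i e\<^sub>\<alpha> = a\<^sub>\<alpha>\<^sub>i e\<^sub>i\<close>,
  the symmetry of the second derivatives of \<open>X\<close> fixes the remaining connection coefficients in terms
  of \<open>f\<^sub>i\<^sub>j = \<partial>\<^sub>j b\<^sub>i / b\<^sub>j\<close>; this is the Lax form of the frame equation, and the symmetry of the second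
  derivatives of the frame is the \<open>G\<close>-system. Conversely the system makes the Lax connections at
  \<open>\<lambda> = 1\<close> and \<open>\<lambda> = 0\<close> flat: integrating them and the closed forms \<open>\<Sum>\<^sub>i b\<^sub>i e\<^sub>i dx\<^sub>i\<close> gives the immersion
  and its flat coordinates. The immersion is spherical exactly if it differs by a constant from a
  constant combination of the \<open>e\<^sub>\<alpha>\<close>.

  For the coordinates themselves, the shape operators commute (Ricci) and, \<open>n\<close> of them being
  independent, some fixed normal direction has simple principal values, which makes the principal
  frame smooth. By Gauss the principal curvature vectors are orthogonal. With \<open>a\<^sub>k\<close> their unit
  vectors, \<open>\<omega>\<^sub>k = \<Sum>\<^sub>\<alpha> a\<^sub>\<alpha>\<^sub>k \<langle>e\<^sub>k, de\<^sub>\<alpha>\<rangle>\<close> is closed, and its potentials are the coordinates.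
\<close>

section \<open>Smooth maps\<close>

text \<open>Smoothness is an inductive notion built on derivatives in fixed directions. A direction
  that varies with the point is therefore expanded in a basis, and when a derivative formula
  contains the unknown function itself, regularity is gained one order at a time; this gives smooth
  inverses and smooth solutions of flat systems. Eigenvectors of a symmetric family may fail to be
  smooth where eigenvalues coincide. Hence the detour through one normal direction with distinct
  principal values: its eigenvectors are smooth by the inverse function theorem, and operators that
  commute with it share them. If \<open>\<kappa>\<close> denotes the lengths of the principal
  curvature vectors, the closed forms are \<open>\<kappa> k\<close> times the dual coframe. This is
  why \<open>b\<close> is the reciprocal of \<open>\<kappa>\<close>, and why orthogonality of the
  curvature vectors becomes \<open>A^t A = I\<close>. At \<lambda> = 0 the Lax connection no longer
  contains \<open>A\<close>; what is left is the Levi-Civita connection of the metric with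
  coefficients \<open>b_i^2\<close>. Its parallel frame lives in n-dimensional space, and the
  resulting potential induces the same metric as the immersion, which proves that metric
  flat.\<close>

abbreviation D :: "('a::real_normed_vector \<Rightarrow> 'b::real_normed_vector) \<Rightarrow> 'a \<Rightarrow> 'a \<Rightarrow> 'b" where
  "D f x \<equiv> frechet_derivative f (at x)"

lemma D_eqI: "(f has_derivative f') (at x) \<Longrightarrow> D f x = f'"
  using frechet_derivative_at by metis

lemma D_cong_open:
  assumes "open S" "x \<in> S" "\<And>y. y \<in> S \<Longrightarrow> f y = g y"
  shows "D f x = D g x"
proof -
  have "(f has_derivative f') (at x) \<longleftrightarrow> (g has_derivative f') (at x)" for f'
    using assms by (metis has_derivative_transform_within_open)
  then show ?thesis
    unfolding frechet_derivative_def by simp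
qed

lemma differentiable_cong_open:
  assumes "open S" "x \<in> S" "\<And>y. y \<in> S \<Longrightarrow> f y = g y" "f differentiable (at x)"
  shows "g differentiable (at x)"
  using assms unfolding differentiable_def by (metis has_derivative_transform_within_open)

lemma Ck_on_cong:
  assumes "open S" "\<And>x. x \<in> S \<Longrightarrow> f x = g x" "Ck_on k S f"
  shows "Ck_on k S g"
  using assms(2,3)
proof (induction k arbitrary: f g)
  case 0
  then show ?case by (simp cong: continuous_on_cong)
next
  case (Suc k)
  have "g differentiable (at x)" if "x \<in> S" for x
    using Suc.prems that differentiable_cong_open[OF assms(1) that, of f g] by auto
  moreover have "Ck_on k S (\<lambda>x. D g x v)" for v
  proof (rule Suc.IH)
    show "D f x v = D g x v" if "x \<in> S" for x
      using D_cong_open[OF assms(1) that, of f g] Suc.prems(1) by simp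
    show "Ck_on k S (\<lambda>x. D f x v)" using Suc.prems(2) by simp
  qed
  ultimately show ?case by simp
qed

lemma Ck_on_subset: "Ck_on k S f \<Longrightarrow> T \<subseteq> S \<Longrightarrow> Ck_on k T f"
  by (induction k arbitrary: f) (auto intro: continuous_on_subset)

text \<open>\<open>Ck_on\<close> is phrased with the chosen \<open>frechet_derivative\<close>. Here
  any explicit derivative may take its place, so each closure property below becomes an induction on
  the order over a differentiation rule.\<close>

lemma Ck_on_SucI:
  assumes "open S" and f': "\<And>x. x \<in> S \<Longrightarrow> (f has_derivative f' x) (at x)"
    and "\<And>v. Ck_on k S (\<lambda>x. f' x v)"
  shows "Ck_on (Suc k) S f"
proof -
  have "f differentiable (at x)" if "x \<in> S" for x
    using f'[OF that] by (auto simp: differentiable_def)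
  moreover have "Ck_on k S (\<lambda>x. D f x v)" for v
    by (rule Ck_on_cong[OF assms(1) _ assms(3)[of v]]) (simp add: D_eqI[OF f'])
  ultimately show ?thesis by simp
qed

lemma Ck_on_Suc_D:
  assumes "Ck_on (Suc k) S f"
  shows "\<And>x. x \<in> S \<Longrightarrow> (f has_derivative D f x) (at x)" "\<And>v. Ck_on k S (\<lambda>x. D f x v)"
  using assms by (auto simp: frechet_derivative_works)

lemma Ck_on_continuous: "Ck_on k S f \<Longrightarrow> continuous_on S f"
  by (cases k)
    (auto intro!: continuous_at_imp_continuous_on differentiable_imp_continuous_within)

lemma Ck_on_lower: "Ck_on (Suc k) S f \<Longrightarrow> Ck_on k S f"
proof (induction k arbitrary: f)
  case 0
  then show ?case using Ck_on_continuous[OF 0] by simp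
next
  case (Suc k)
  then show ?case by (metis Ck_on.simps(2))
qed

lemma Ck_on_const: "open S \<Longrightarrow> Ck_on k S (\<lambda>x. c)"
  by (induction k arbitrary: c) auto

lemma Ck_on_bounded_linear:
  assumes "open S" "bounded_linear L" "Ck_on k S f"
  shows "Ck_on k S (\<lambda>x. L (f x))"
  using assms(3)
proof (induction k arbitrary: f)
  case 0
  then show ?case using assms(2) by (auto intro: bounded_linear.continuous_on)
next
  case (Suc k)
  note f = Ck_on_Suc_D[OF Suc.prems]
  show ?case
    by (rule Ck_on_SucI[OF assms(1), where f' = "\<lambda>x v. L (D f x v)"])
      (auto intro!: bounded_linear.has_derivative[OF assms(2)] f Suc.IH)
qed

lemma Ck_on_ident: "open S \<Longrightarrow> Ck_on k S (\<lambda>x. x)"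
  by (cases k) (auto intro!: Ck_on_SucI Ck_on_const derivative_eq_intros simp del: Ck_on.simps(2))

lemma Ck_on_add:
  assumes "open S" "Ck_on k S f" "Ck_on k S g"
  shows "Ck_on k S (\<lambda>x. f x + g x)"
  using assms(2,3)
proof (induction k arbitrary: f g)
  case (Suc k)
  note f = Ck_on_Suc_D[OF Suc.prems(1)] and g = Ck_on_Suc_D[OF Suc.prems(2)]
  show ?case
    by (rule Ck_on_SucI[OF assms(1), where f' = "\<lambda>x v. D f x v + D g x v"])
      (auto intro!: has_derivative_add f g Suc.IH)
qed (auto intro: continuous_on_add)

lemma Ck_on_sum:
  assumes "open S" "\<And>i. i \<in> I \<Longrightarrow> Ck_on k S (f i)"
  shows "Ck_on k S (\<lambda>x. \<Sum>i\<in>I. f i x)"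
  using assms by (induction I rule: infinite_finite_induct) (auto intro: Ck_on_const Ck_on_add)

lemma Ck_on_bilinear:
  assumes "open S" "bounded_bilinear B" "Ck_on k S f" "Ck_on k S g"
  shows "Ck_on k S (\<lambda>x. B (f x) (g x))"
  using assms(3,4)
proof (induction k arbitrary: f g)
  case 0
  then show ?case using assms(2) by (auto intro: bounded_bilinear.continuous_on)
next
  case (Suc k)
  note f = Ck_on_Suc_D[OF Suc.prems(1)] and g = Ck_on_Suc_D[OF Suc.prems(2)]
  show ?case
    by (rule Ck_on_SucI[OF assms(1), where f' = "\<lambda>x v. B (f x) (D g x v) + B (D f x v) (g x)"])
      (auto intro!: bounded_bilinear.FDERIV[OF assms(2)] f g Suc.IH Ck_on_add[OF assms(1)]
        Ck_on_lower[OF Suc.prems(1)] Ck_on_lower[OF Suc.prems(2)] simp del: Ck_on.simps)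
qed

text \<open>The chain rule applies \<open>D f (g x)\<close> to a direction that varies with
  \<open>x\<close>, while \<open>Ck_on\<close> controls fixed directions only. Expanding
  \<open>D g x v\<close> in the basis separates the two.\<close>

lemma Ck_on_compose:
  fixes f :: "'b::euclidean_space \<Rightarrow> 'c::real_normed_vector" and g :: "'a::euclidean_space \<Rightarrow> 'b"
  assumes "open S" "open T" "Ck_on k T f" "Ck_on k S g" "g ` S \<subseteq> T"
  shows "Ck_on k S (\<lambda>x. f (g x))"
  using assms(3,4)
proof (induction k arbitrary: f)
  case 0
  then show ?case using assms(5) by (auto intro: continuous_on_compose2)
next
  case (Suc k)
  note f = Ck_on_Suc_D[OF Suc.prems(1)] and g = Ck_on_Suc_D[OF Suc.prems(2)]
  have "D f (g x) (D g x v) = (\<Sum>b\<in>Basis. (D g x v \<bullet> b) *\<^sub>R D f (g x) b)" if "x \<in> S" for x v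
  proof -
    have "linear (D f (g x))"
      using f(1)[of "g x"] that assms(5) by (auto intro: has_derivative_linear)
    then have "D f (g x) (\<Sum>b\<in>Basis. (D g x v \<bullet> b) *\<^sub>R b) = (\<Sum>b\<in>Basis. (D g x v \<bullet> b) *\<^sub>R D f (g x) b)"
      by (simp add: linear_sum linear_scale)
    then show ?thesis by (simp add: euclidean_representation)
  qed
  moreover have "Ck_on k S (\<lambda>x. \<Sum>b\<in>Basis. (D g x v \<bullet> b) *\<^sub>R D f (g x) b)" for v
    by (intro Ck_on_sum Ck_on_bilinear[OF assms(1) bounded_bilinear_scaleR]
        Ck_on_bounded_linear[OF assms(1) bounded_linear_inner_left] assms(1) g
        Suc.IH f Ck_on_lower[OF Suc.prems(2)])
  ultimately have "Ck_on k S (\<lambda>x. D f (g x) (D g x v))" for v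
    by (intro Ck_on_cong[OF assms(1) _ \<open>Ck_on k S (\<lambda>x. \<Sum>b\<in>Basis. (D g x v \<bullet> b) *\<^sub>R D f (g x) b)\<close>]) simp
  moreover have "((\<lambda>x. f (g x)) has_derivative (\<lambda>v. D f (g x) (D g x v))) (at x)" if "x \<in> S" for x
    using diff_chain_at[OF g(1)[OF that] f(1)[of "g x"]] that assms(5) by (auto simp: o_def)
  ultimately show ?case
    by (intro Ck_on_SucI[OF assms(1)])
qed

text \<open>The derivative is built from \<open>inverse (f x)\<close> and \<open>D f x v\<close>, so
  the claim at order \<open>k\<close> is what order \<open>Suc k\<close> needs. The square root
  climbs in the same way.\<close>

lemma Ck_on_inverse:
  fixes f :: "'a::euclidean_space \<Rightarrow> real"
  assumes "open S" "Ck_on k S f" "\<And>x. x \<in> S \<Longrightarrow> f x \<noteq> 0"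
  shows "Ck_on k S (\<lambda>x. inverse (f x))"
  using assms(2)
proof (induction k)
  case 0
  then show ?case using assms(3) by (auto intro: continuous_on_inverse)
next
  case (Suc k)
  note f = Ck_on_Suc_D[OF Suc.prems] and IH = Suc.IH[OF Ck_on_lower[OF Suc.prems]]
  show ?case
    by (rule Ck_on_SucI[OF assms(1), where f' = "\<lambda>x v. - (inverse (f x) * D f x v * inverse (f x))"])
      (auto intro!: Deriv.has_derivative_inverse assms f IH Ck_on_bilinear[OF assms(1) bounded_bilinear_mult]
        Ck_on_bounded_linear[OF assms(1) bounded_linear_minus[OF bounded_linear_ident]])
qed

lemma Ck_on_sqrt:
  fixes f :: "'a::euclidean_space \<Rightarrow> real"
  assumes "open S" "Ck_on k S f" "\<And>x. x \<in> S \<Longrightarrow> f x > 0"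
  shows "Ck_on k S (\<lambda>x. sqrt (f x))"
  using assms(2)
proof (induction k)
  case 0
  then show ?case by (auto intro: continuous_on_real_sqrt)
next
  case (Suc k)
  note f = Ck_on_Suc_D[OF Suc.prems] and IH = Suc.IH[OF Ck_on_lower[OF Suc.prems]]
  have "sqrt (f x) \<noteq> 0" if "x \<in> S" for x using assms(3)[OF that] by simp
  moreover have "((\<lambda>x. sqrt (f x)) has_derivative (\<lambda>v. D f x v * (inverse (sqrt (f x)) / 2))) (at x)"
    if "x \<in> S" for x
    using has_derivative_real_sqrt[OF assms(3) f(1), OF that that] by (simp add: mult.commute)
  ultimately show ?case
    by (intro Ck_on_SucI[OF assms(1), where f' = "\<lambda>x v. D f x v * (inverse (sqrt (f x)) / 2)"])
      (auto intro!: f IH Ck_on_inverse[OF assms(1)]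
        Ck_on_bilinear[OF assms(1) bounded_bilinear_mult]
        Ck_on_bounded_linear[OF assms(1) bounded_linear_divide])
qed

lemma smooth_on_D:
  assumes "smooth_on S f"
  shows "x \<in> S \<Longrightarrow> (f has_derivative D f x) (at x)" "smooth_on S (\<lambda>x. D f x v)"
  using assms Ck_on_Suc_D unfolding smooth_on_def by blast+

lemma smooth_on_linear_D: "smooth_on S f \<Longrightarrow> x \<in> S \<Longrightarrow> linear (D f x)"
  using smooth_on_D(1) has_derivative_linear by blast

lemma smooth_on_continuous_on: "smooth_on S f \<Longrightarrow> continuous_on S f"
  using Ck_on_continuous smooth_on_def by blast

lemma smooth_on_subset: "smooth_on S f \<Longrightarrow> T \<subseteq> S \<Longrightarrow> smooth_on T f"
  by (auto simp: smooth_on_def intro: Ck_on_subset)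

lemma smooth_on_cong: "smooth_on S f \<Longrightarrow> open S \<Longrightarrow> (\<And>x. x \<in> S \<Longrightarrow> f x = g x) \<Longrightarrow> smooth_on S g"
  by (auto simp: smooth_on_def intro: Ck_on_cong)

named_theorems smooth_intros

lemma smooth_on_const [smooth_intros]: "open S \<Longrightarrow> smooth_on S (\<lambda>x. c)"
  by (simp add: smooth_on_def Ck_on_const)

lemma smooth_on_ident [smooth_intros]: "open S \<Longrightarrow> smooth_on S (\<lambda>x. x)"
  by (simp add: smooth_on_def Ck_on_ident)

lemma smooth_on_bounded_linear:
  "bounded_linear L \<Longrightarrow> open S \<Longrightarrow> smooth_on S f \<Longrightarrow> smooth_on S (\<lambda>x. L (f x))"
  by (simp add: smooth_on_def Ck_on_bounded_linear)

lemma smooth_on_bilinear: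
  "bounded_bilinear B \<Longrightarrow> open S \<Longrightarrow> smooth_on S f \<Longrightarrow> smooth_on S g \<Longrightarrow> smooth_on S (\<lambda>x. B (f x) (g x))"
  by (simp add: smooth_on_def Ck_on_bilinear)

lemma smooth_on_add [smooth_intros]:
  "open S \<Longrightarrow> smooth_on S f \<Longrightarrow> smooth_on S g \<Longrightarrow> smooth_on S (\<lambda>x. f x + g x)"
  by (simp add: smooth_on_def Ck_on_add)

lemma smooth_on_sum [smooth_intros]:
  "open S \<Longrightarrow> (\<And>i. i \<in> I \<Longrightarrow> smooth_on S (f i)) \<Longrightarrow> smooth_on S (\<lambda>x. \<Sum>i\<in>I. f i x)"
  by (simp add: smooth_on_def Ck_on_sum)

lemmas smooth_on_minus [smooth_intros] =
  smooth_on_bounded_linear[OF bounded_linear_minus[OF bounded_linear_ident]]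
lemmas smooth_on_vec_nth [smooth_intros] = smooth_on_bounded_linear[OF bounded_linear_vec_nth]
lemmas smooth_on_fst [smooth_intros] = smooth_on_bounded_linear[OF bounded_linear_fst]
lemmas smooth_on_snd [smooth_intros] = smooth_on_bounded_linear[OF bounded_linear_snd]
lemmas smooth_on_mult [smooth_intros] = smooth_on_bilinear[OF bounded_bilinear_mult]
lemmas smooth_on_scaleR [smooth_intros] = smooth_on_bilinear[OF bounded_bilinear_scaleR]
lemmas smooth_on_inner [smooth_intros] = smooth_on_bilinear[OF bounded_bilinear_inner]

lemma smooth_on_diff [smooth_intros]:
  "open S \<Longrightarrow> smooth_on S f \<Longrightarrow> smooth_on S g \<Longrightarrow> smooth_on S (\<lambda>x. f x - g x)"
  using smooth_on_add[of S f "\<lambda>x. - g x"] smooth_on_minus[of S g] by simp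

lemma smooth_on_Pair [smooth_intros]:
  assumes "open S" "smooth_on S f" "smooth_on S g"
  shows "smooth_on S (\<lambda>x. (f x, g x))"
proof -
  have "smooth_on S (\<lambda>x. (f x, 0) + (0, g x))"
    by (intro smooth_on_add assms
        smooth_on_bounded_linear[OF bounded_linear_Pair[OF bounded_linear_ident bounded_linear_zero]]
        smooth_on_bounded_linear[OF bounded_linear_Pair[OF bounded_linear_zero bounded_linear_ident]])
  then show ?thesis by simp
qed

lemma smooth_on_compose:
  fixes f :: "'b::euclidean_space \<Rightarrow> 'c::real_normed_vector" and g :: "'a::euclidean_space \<Rightarrow> 'b"
  shows "smooth_on T f \<Longrightarrow> smooth_on S g \<Longrightarrow> open S \<Longrightarrow> open T \<Longrightarrow> g ` S \<subseteq> T \<Longrightarrow> smooth_on S (\<lambda>x. f (g x))"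
  unfolding smooth_on_def using Ck_on_compose by blast

lemma smooth_on_divide [smooth_intros]:
  fixes f g :: "'a::euclidean_space \<Rightarrow> real"
  shows "open S \<Longrightarrow> smooth_on S f \<Longrightarrow> smooth_on S g \<Longrightarrow> (\<And>x. x \<in> S \<Longrightarrow> g x \<noteq> 0) \<Longrightarrow> smooth_on S (\<lambda>x. f x / g x)"
  unfolding smooth_on_def divide_inverse
  by (auto intro!: Ck_on_bilinear[OF _ bounded_bilinear_mult] Ck_on_inverse)

lemma smooth_on_sqrt:
  fixes f :: "'a::euclidean_space \<Rightarrow> real"
  shows "open S \<Longrightarrow> smooth_on S f \<Longrightarrow> (\<And>x. x \<in> S \<Longrightarrow> f x > 0) \<Longrightarrow> smooth_on S (\<lambda>x. sqrt (f x))"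
  unfolding smooth_on_def by (auto intro!: Ck_on_sqrt)

lemma bounded_linear_axis: "bounded_linear (axis i :: 'a::real_normed_vector \<Rightarrow> 'a^'n)"
proof (rule bounded_linear_intro[where K = 1])
  show "norm (axis i x :: 'a^'n) \<le> norm x * 1" for x
    by (simp add: norm_vec_def L2_set_def axis_def if_distrib[of norm] if_distrib[of "\<lambda>t. t\<^sup>2"] cong: if_cong)
qed (auto simp: vec_eq_iff axis_def)

lemma smooth_on_vec [smooth_intros]:
  fixes f :: "'a::euclidean_space \<Rightarrow> 'n::finite \<Rightarrow> 'b::real_normed_vector"
  assumes "open S" "\<And>i. smooth_on S (\<lambda>x. f x i)"
  shows "smooth_on S (\<lambda>x. \<chi> i. f x i)"
proof -
  have "(\<chi> i. f x i) = (\<Sum>i\<in>UNIV. axis i (f x i))" for x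
    by (simp add: vec_eq_iff axis_def)
  then show ?thesis
    by (simp add: assms smooth_on_sum smooth_on_bounded_linear[OF bounded_linear_axis])
qed

section \<open>Symmetry of second derivatives\<close>

lemma has_vector_derivative_along_line:
  assumes "(f has_derivative f') (at (z + s *\<^sub>R u))"
  shows "((\<lambda>s. f (z + s *\<^sub>R u)) has_vector_derivative f' u) (at s within T)"
proof -
  have "((\<lambda>s. z + s *\<^sub>R u) has_vector_derivative u) (at s within T)"
    by (auto intro!: derivative_eq_intros)
  from vector_derivative_diff_chain_within[OF this has_derivative_at_withinI[OF assms]]
  show ?thesis by (simp add: o_def)
qed

text \<open>The mean value theorem twice: along \<open>u\<close> for the increment of
  \<open>f\<close> in direction \<open>v\<close>, then along \<open>v\<close> for the derivative so
  obtained.\<close>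

lemma second_difference_mean_value:
  fixes f :: "'a::euclidean_space \<Rightarrow> real"
  assumes "smooth_on S f" "0 < h"
    and mem: "\<And>s t. s \<in> {0..h} \<Longrightarrow> t \<in> {0..h} \<Longrightarrow> x + s *\<^sub>R u + t *\<^sub>R v \<in> S"
  obtains s t where "s \<in> {0..h}" "t \<in> {0..h}"
    "f (x + h *\<^sub>R u + h *\<^sub>R v) - f (x + h *\<^sub>R u) - f (x + h *\<^sub>R v) + f x
       = h\<^sup>2 * D (\<lambda>y. D f y u) (x + s *\<^sub>R u + t *\<^sub>R v) v"
proof -
  note f = smooth_on_D[OF assms(1)]
  define \<phi> where "\<phi> s = f (x + h *\<^sub>R v + s *\<^sub>R u) - f (x + s *\<^sub>R u)" for s
  have "(\<phi> has_real_derivative (D f (x + h *\<^sub>R v + s *\<^sub>R u) u - D f (x + s *\<^sub>R u) u)) (at s)"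
    if "0 \<le> s" "s \<le> h" for s
    unfolding \<phi>_def has_real_derivative_iff_has_vector_derivative
    using mem[of s h] mem[of s 0] that \<open>0 < h\<close>
    by (intro derivative_intros has_vector_derivative_along_line f) (auto simp: algebra_simps)
  from MVT2[OF \<open>0 < h\<close> this] obtain s where s: "0 < s" "s < h"
    "\<phi> h - \<phi> 0 = h * (D f (x + h *\<^sub>R v + s *\<^sub>R u) u - D f (x + s *\<^sub>R u) u)"
    by auto
  define \<psi> where "\<psi> t = D f (x + s *\<^sub>R u + t *\<^sub>R v) u" for t
  have "(\<psi> has_real_derivative D (\<lambda>y. D f y u) (x + s *\<^sub>R u + t *\<^sub>R v) v) (at t)"
    if "0 \<le> t" "t \<le> h" for t
    unfolding \<psi>_def has_real_derivative_iff_has_vector_derivative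
    using mem[of s t] that s
    by (intro has_vector_derivative_along_line smooth_on_D(1)[OF f(2)]) auto
  from MVT2[OF \<open>0 < h\<close> this] obtain t where t: "0 < t" "t < h"
    "\<psi> h - \<psi> 0 = h * D (\<lambda>y. D f y u) (x + s *\<^sub>R u + t *\<^sub>R v) v"
    by auto
  have "f (x + h *\<^sub>R u + h *\<^sub>R v) - f (x + h *\<^sub>R u) - f (x + h *\<^sub>R v) + f x = \<phi> h - \<phi> 0"
    by (simp add: \<phi>_def algebra_simps)
  also have "\<dots> = h * (\<psi> h - \<psi> 0)"
    unfolding s(3) by (simp add: \<psi>_def algebra_simps)
  also have "\<dots> = h\<^sup>2 * D (\<lambda>y. D f y u) (x + s *\<^sub>R u + t *\<^sub>R v) v"
    by (simp add: t(3) power2_eq_square)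
  finally show ?thesis
    using that[of s t] s t by auto
qed

text \<open>The second difference over the parallelogram of \<open>u\<close> and \<open>v\<close> is
  symmetric, so \<open>P\<close> and \<open>Q\<close> take equal values at two points near
  \<open>x\<close>; continuity carries both values to \<open>x\<close>.\<close>

lemma smooth_on_D_commute_real:
  fixes f :: "'a::euclidean_space \<Rightarrow> real"
  assumes S: "open S" and f: "smooth_on S f" and x: "x \<in> S"
  shows "D (\<lambda>y. D f y u) x v = D (\<lambda>y. D f y v) x u"
proof -
  define P where "P z = D (\<lambda>y. D f y u) z v" for z
  define Q where "Q z = D (\<lambda>y. D f y v) z u" for z
  have "continuous_on S P" "continuous_on S Q"
    unfolding P_def Q_def using smooth_on_D(2)[OF smooth_on_D(2)[OF f]] smooth_on_continuous_on by blast+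
  then have cont: "isCont P x" "isCont Q x"
    using S x continuous_on_eq_continuous_at by blast+
  have "\<bar>P x - Q x\<bar> \<le> 2 * e" if "e > 0" for e
  proof -
    from cont[THEN continuous_at_eps_delta[THEN iffD1]] that obtain d1 d2 where d:
      "d1 > 0" "\<And>z. dist z x < d1 \<Longrightarrow> dist (P z) (P x) < e"
      "d2 > 0" "\<And>z. dist z x < d2 \<Longrightarrow> dist (Q z) (Q x) < e"
      by (metis dist_commute)
    obtain d3 where d3: "d3 > 0" "ball x d3 \<subseteq> S"
      using S x openE by blast
    define m where "m = Min {d1, d2, d3}"
    \<comment> \<open>Keeps the parallelogram within distance \<open>m / 2\<close> of
      \<open>x\<close>; the summand 1 covers \<open>u = v = 0\<close>.\<close>
    define h where "h = m / (2 * (norm u + norm v + 1))"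
    have "m > 0" using d d3 by (simp add: m_def)
    have "norm u + norm v + 1 > 0"
      by (smt (verit) norm_ge_zero)
    then have "h > 0" using \<open>m > 0\<close> by (simp add: h_def)
    have near: "dist (x + s *\<^sub>R u' + t *\<^sub>R v') x < m"
      if "s \<in> {0..h}" "t \<in> {0..h}" "{u', v'} = {u, v}" for s t u' v'
    proof -
      have "norm (s *\<^sub>R u' + t *\<^sub>R v') \<le> h * norm u' + h * norm v'"
        using that by (intro norm_triangle_le add_mono) (auto intro!: mult_right_mono)
      also have "\<dots> \<le> h * (norm u + norm v + 1)"
        using that(3) \<open>h > 0\<close> by (auto simp: doubleton_eq_iff algebra_simps)
      also have "\<dots> = m / 2"
        unfolding h_def using \<open>norm u + norm v + 1 > 0\<close> by (simp only: times_divide_eq_left) (simp del: distrib_left_numeral add: divide_simps)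
      also have "\<dots> < m"
        using \<open>m > 0\<close> by simp
      finally show ?thesis by (simp add: dist_norm add.assoc)
    qed
    have mem: "x + s *\<^sub>R u' + t *\<^sub>R v' \<in> S"
      if "s \<in> {0..h}" "t \<in> {0..h}" "{u', v'} = {u, v}" for s t u' v'
      using near[OF that] d3(2) by (auto simp: m_def dist_commute)
    obtain s t where st: "s \<in> {0..h}" "t \<in> {0..h}"
      "f (x + h *\<^sub>R u + h *\<^sub>R v) - f (x + h *\<^sub>R u) - f (x + h *\<^sub>R v) + f x = h\<^sup>2 * P (x + s *\<^sub>R u + t *\<^sub>R v)"
      unfolding P_def by (rule second_difference_mean_value[OF f \<open>h > 0\<close>, of x u v]) (use mem in auto)
    obtain s' t' where st': "s' \<in> {0..h}" "t' \<in> {0..h}"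
      "f (x + h *\<^sub>R v + h *\<^sub>R u) - f (x + h *\<^sub>R v) - f (x + h *\<^sub>R u) + f x = h\<^sup>2 * Q (x + s' *\<^sub>R v + t' *\<^sub>R u)"
      unfolding Q_def by (rule second_difference_mean_value[OF f \<open>h > 0\<close>, of x v u])
        (use mem[OF _ _ insert_commute] in auto)
    have "h\<^sup>2 * P (x + s *\<^sub>R u + t *\<^sub>R v) = h\<^sup>2 * Q (x + s' *\<^sub>R v + t' *\<^sub>R u)"
      unfolding st(3)[symmetric] st'(3)[symmetric] by (simp add: algebra_simps)
    then have "P (x + s *\<^sub>R u + t *\<^sub>R v) = Q (x + s' *\<^sub>R v + t' *\<^sub>R u)"
      using \<open>h > 0\<close> by simp
    moreover have "dist (P (x + s *\<^sub>R u + t *\<^sub>R v)) (P x) < e"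
      using near[OF st(1,2)] by (intro d) (auto simp: m_def)
    moreover have "dist (Q (x + s' *\<^sub>R v + t' *\<^sub>R u)) (Q x) < e"
      using near[OF st'(1,2)] by (intro d) (auto simp: m_def)
    ultimately show ?thesis by (simp add: dist_real_def)
  qed
  then have "\<bar>P x - Q x\<bar> \<le> 0 + e" if "e > 0" for e
    using that by (metis add_0 field_sum_of_halves half_gt_zero mult_2)
  then show ?thesis
    using field_le_epsilon[of "\<bar>P x - Q x\<bar>" 0] by (simp add: P_def Q_def)
qed

lemma D_bounded_linear:
  "bounded_linear L \<Longrightarrow> (f has_derivative D f x) (at x) \<Longrightarrow> D (\<lambda>y. L (f y)) x v = L (D f x v)"
  by (simp add: D_eqI[OF bounded_linear.has_derivative[of L]])

lemma smooth_on_D_commute: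
  fixes f :: "'a::euclidean_space \<Rightarrow> 'b::euclidean_space"
  assumes S: "open S" and f: "smooth_on S f" and x: "x \<in> S"
  shows "D (\<lambda>y. D f y u) x v = D (\<lambda>y. D f y v) x u"
proof (rule euclidean_eqI)
  fix b :: 'b
  have "D (\<lambda>y. D f y u) x v \<bullet> b = D (\<lambda>y. D (\<lambda>y. f y \<bullet> b) y u) x v" for u v
  proof -
    have "D (\<lambda>y. D (\<lambda>y. f y \<bullet> b) y u) x v = D (\<lambda>y. D f y u \<bullet> b) x v"
      by (intro fun_cong[OF D_cong_open[OF S x]] D_bounded_linear bounded_linear_inner_left smooth_on_D(1)[OF f])
    then show ?thesis
      by (simp add: D_bounded_linear[OF bounded_linear_inner_left smooth_on_D(1)[OF smooth_on_D(2)[OF f] x]])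
  qed
  then show "D (\<lambda>y. D f y u) x v \<bullet> b = D (\<lambda>y. D f y v) x u \<bullet> b"
    using smooth_on_D_commute_real[OF S smooth_on_inner[OF S f smooth_on_const[OF S]] x] by simp
qed

section \<open>Inverse functions\<close>

text \<open>Only continuity of the scalar factor is needed because the other factor vanishes at \<open>x\<close>.\<close>

lemma has_derivative_scaleR_vanishing:
  fixes c :: "'a::real_normed_vector \<Rightarrow> real" and \<phi> :: "'a \<Rightarrow> 'b::real_normed_vector"
  assumes c: "isCont c x" and \<phi>: "(\<phi> has_derivative \<phi>') (at x)" and 0: "\<phi> x = 0"
  shows "((\<lambda>y. c y *\<^sub>R \<phi> y) has_derivative (\<lambda>h. c x *\<^sub>R \<phi>' h)) (at x)"
proof -
  interpret \<phi>': bounded_linear \<phi>' using \<phi> by (rule has_derivative_bounded_linear)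
  obtain K where K: "\<And>h. norm (\<phi>' h) \<le> norm h * K" using \<phi>'.bounded by blast
  define \<rho> where "\<rho> y = norm (\<phi> y - \<phi>' (y - x)) / norm (y - x)" for y
  have \<rho>: "(\<rho> \<longlongrightarrow> 0) (at x)"
    using \<phi> 0 by (simp add: has_derivative_iff_norm \<rho>_def[abs_def])
  have "((\<lambda>y. \<bar>c y\<bar> * \<rho> y + \<bar>c y - c x\<bar> * K) \<longlongrightarrow> \<bar>c x\<bar> * 0 + \<bar>c x - c x\<bar> * K) (at x)"
    using c unfolding isCont_def by (intro tendsto_intros \<rho>)
  then have lim: "((\<lambda>y. \<bar>c y\<bar> * \<rho> y + \<bar>c y - c x\<bar> * K) \<longlongrightarrow> 0) (at x)" by simp
  have "norm (c y *\<^sub>R \<phi> y - c x *\<^sub>R \<phi> x - c x *\<^sub>R \<phi>' (y - x)) / norm (y - x)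
        \<le> \<bar>c y\<bar> * \<rho> y + \<bar>c y - c x\<bar> * K" if "y \<noteq> x" for y
  proof -
    have "c y *\<^sub>R \<phi> y - c x *\<^sub>R \<phi> x - c x *\<^sub>R \<phi>' (y - x)
        = c y *\<^sub>R (\<phi> y - \<phi>' (y - x)) + (c y - c x) *\<^sub>R \<phi>' (y - x)"
      by (simp add: 0 algebra_simps)
    also have "norm \<dots> \<le> \<bar>c y\<bar> * norm (\<phi> y - \<phi>' (y - x)) + \<bar>c y - c x\<bar> * (norm (y - x) * K)"
      using K by (intro norm_triangle_le add_mono) (auto intro: mult_left_mono)
    also have "\<dots> = (\<bar>c y\<bar> * \<rho> y + \<bar>c y - c x\<bar> * K) * norm (y - x)"
      using that by (simp add: \<rho>_def field_simps)
    finally show ?thesis using that by (simp add: field_simps)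
  qed
  then have "((\<lambda>y. norm (c y *\<^sub>R \<phi> y - c x *\<^sub>R \<phi> x - c x *\<^sub>R \<phi>' (y - x)) / norm (y - x)) \<longlongrightarrow> 0) (at x)"
    by (intro tendsto_sandwich[OF _ _ tendsto_const lim]) (auto simp: eventually_at_filter)
  moreover have "bounded_linear (\<lambda>h. c x *\<^sub>R \<phi>' h)"
    by (rule bounded_linear_compose[OF bounded_linear_scaleR_right has_derivative_bounded_linear[OF \<phi>]])
  ultimately show ?thesis by (simp add: has_derivative_iff_norm)
qed

lemma linear_Basis_sum:
  fixes L :: "'a::euclidean_space \<Rightarrow> 'b::real_vector"
  assumes "linear L" shows "L v = (\<Sum>b\<in>Basis. (v \<bullet> b) *\<^sub>R L b)"
proof -
  have "L v = L (\<Sum>b\<in>Basis. (v \<bullet> b) *\<^sub>R b)" by (simp add: euclidean_representation)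
  then show ?thesis using assms by (simp add: linear_sum linear_scale)
qed

text \<open>Serves twice: for the differentials of a map in the inverse function theorem, and for
  the Gram operators of the induced metric.\<close>

locale linear_family =
  fixes S :: "'p::euclidean_space set" and M :: "'p \<Rightarrow> 'a::euclidean_space \<Rightarrow> 'a"
  assumes S: "open S" and linM: "\<And>x. x \<in> S \<Longrightarrow> linear (M x)" and injM: "\<And>x. x \<in> S \<Longrightarrow> inj (M x)"
    and smM: "\<And>w. smooth_on S (\<lambda>x. M x w)"
begin

lemma bijM: "x \<in> S \<Longrightarrow> bij (M x)"
  unfolding bij_def using injM linM linear_inj_imp_surj by blast

lemma inv_M: "x \<in> S \<Longrightarrow> M x (inv (M x) v) = v"
  using bijM bij_inv_eq_iff by metis

lemma inv_M_eq: "x \<in> S \<Longrightarrow> inv (M x) (M x v) = v"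
  using injM inv_f_f by metis

lemma linear_inv: "x \<in> S \<Longrightarrow> linear (inv (M x))"
  using linM bijM inj_linear_imp_inv_linear by (metis bij_def)

text \<open>\<open>M x0\<close> stretches by at least \<open>c\<close>, and
  \<open>\<delta> x\<close> bounds the deviation of \<open>M x\<close> from it. Once
  \<open>\<delta> x < c / 2\<close>, the part of the error that contains the unknown difference is
  absorbed on the left.\<close>

lemma isCont_inv:
  assumes x0: "x0 \<in> S" shows "isCont (\<lambda>x. inv (M x) v) x0"
proof -
  obtain c where c: "c > 0" "\<And>u. c * norm u \<le> norm (M x0 u)"
    using linear_inj_bounded_below_pos[OF linM[OF x0] injM[OF x0]] by (metis mult.commute)
  define \<delta> where "\<delta> x = (\<Sum>b\<in>Basis. norm (M x b - M x0 b))" for x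
  have \<delta>: "norm (M x u - M x0 u) \<le> \<delta> x * norm u" if "x \<in> S" for x u
  proof -
    have "M x u - M x0 u = (\<Sum>b\<in>Basis. (u \<bullet> b) *\<^sub>R (M x b - M x0 b))"
      by (subst (1 2) linear_Basis_sum) (auto simp: linM that x0 sum_subtractf scaleR_diff_right)
    also have "norm \<dots> \<le> (\<Sum>b\<in>Basis. norm u * norm (M x b - M x0 b))"
      by (intro sum_norm_le) (auto intro!: mult_right_mono Basis_le_norm)
    finally show ?thesis by (simp add: \<delta>_def sum_distrib_left mult.commute)
  qed
  have "isCont (\<lambda>x. M x b) x0" for b
    using smooth_on_continuous_on[OF smM] S x0 continuous_on_eq_continuous_at by blast
  then have "(\<delta> \<longlongrightarrow> (\<Sum>b\<in>Basis. norm (M x0 b - M x0 b))) (at x0)"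
    unfolding \<delta>_def isCont_def by (intro tendsto_intros)
  then have \<delta>0: "(\<delta> \<longlongrightarrow> 0) (at x0)" by simp
  have "norm (inv (M x) v - inv (M x0) v) \<le> (2 / c) * \<delta> x * norm (inv (M x0) v)"
    if "x \<in> S" "\<delta> x < c / 2" for x
  proof -
    define z z0 where "z = inv (M x) v" and "z0 = inv (M x0) v"
    have "c * norm (z - z0) \<le> norm (M x0 (z - z0))" by (rule c)
    also have "M x0 (z - z0) = - (M x z - M x0 z)"
      using inv_M that(1) x0 linM[OF x0] by (simp add: z_def z0_def linear_diff)
    also have "norm \<dots> \<le> \<delta> x * norm z" using \<delta>[OF that(1)] by (metis norm_minus_cancel)
    also have "\<dots> \<le> \<delta> x * (norm z0 + norm (z - z0))"
      by (intro mult_left_mono) (use norm_triangle_sub[of z z0] in \<open>auto simp: \<delta>_def sum_nonneg\<close>)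
    also have "\<dots> \<le> \<delta> x * norm z0 + c / 2 * norm (z - z0)"
      using mult_right_mono[of "\<delta> x" "c / 2" "norm (z - z0)"] that(2) by (simp add: distrib_left)
    finally have "c / 2 * norm (z - z0) \<le> \<delta> x * norm z0" by simp
    then show ?thesis using c(1) by (simp add: z_def z0_def field_simps)
  qed
  moreover have "eventually (\<lambda>x. x \<in> S \<and> \<delta> x < c / 2) (at x0)"
    using order_tendstoD(2)[OF \<delta>0, of "c / 2"] c(1) eventually_at_in_open'[OF S x0]
    by (auto elim: eventually_elim2)
  ultimately have "eventually (\<lambda>x. norm (inv (M x) v - inv (M x0) v)
      \<le> (2 / c) * \<delta> x * norm (inv (M x0) v)) (at x0)"
    by (blast intro: eventually_mono)
  moreover have "((\<lambda>x. (2 / c) * \<delta> x * norm (inv (M x0) v)) \<longlongrightarrow> 0) (at x0)"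
    using tendsto_mult[OF tendsto_mult[OF tendsto_const \<delta>0] tendsto_const, of "2 / c" "norm (inv (M x0) v)"]
    by simp
  ultimately have "((\<lambda>x. inv (M x) v - inv (M x0) v) \<longlongrightarrow> 0) (at x0)"
    by (rule Lim_null_comparison)
  then show ?thesis unfolding isCont_def by (simp add: LIM_zero_iff)
qed

text \<open>Differentiates the identity
  \<open>inv (M x) v = N v - N ((M x - M x0) (inv (M x) v))\<close>. The factor
  \<open>M x - M x0\<close> vanishes at \<open>x0\<close>, so continuity of the inverse suffices for
  the other factor.\<close>

lemma has_derivative_inv:
  assumes x0: "x0 \<in> S"
  shows "((\<lambda>x. inv (M x) v) has_derivative
    (\<lambda>h. - (\<Sum>b\<in>Basis. (inv (M x0) v \<bullet> b) *\<^sub>R inv (M x0) (D (\<lambda>y. M y b) x0 h)))) (at x0)"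
proof -
  define N where "N = inv (M x0)"
  have N: "bounded_linear N" unfolding N_def using linear_inv[OF x0] by (simp add: linear_conv_bounded_linear)
  have "((\<lambda>x. \<Sum>b\<in>Basis. (inv (M x) v \<bullet> b) *\<^sub>R N (M x b - M x0 b)) has_derivative
      (\<lambda>h. \<Sum>b\<in>Basis. (inv (M x0) v \<bullet> b) *\<^sub>R N (D (\<lambda>y. M y b) x0 h - 0))) (at x0)"
  proof (intro has_derivative_sum has_derivative_scaleR_vanishing)
    show "isCont (\<lambda>x. inv (M x) v \<bullet> b) x0" for b
      by (intro continuous_intros isCont_inv x0)
    show "((\<lambda>x. N (M x b - M x0 b)) has_derivative (\<lambda>h. N (D (\<lambda>y. M y b) x0 h - 0))) (at x0)" for b
      by (intro bounded_linear.has_derivative[OF N] has_derivative_diff has_derivative_const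
          smooth_on_D(1)[OF smM x0])
  qed (use N in \<open>simp add: bounded_linear_def linear_0\<close>)
  then have "((\<lambda>x. N v - (\<Sum>b\<in>Basis. (inv (M x) v \<bullet> b) *\<^sub>R N (M x b - M x0 b))) has_derivative
      (\<lambda>h. 0 - (\<Sum>b\<in>Basis. (inv (M x0) v \<bullet> b) *\<^sub>R N (D (\<lambda>y. M y b) x0 h - 0)))) (at x0)"
    by (intro has_derivative_diff has_derivative_const)
  moreover have "N v - (\<Sum>b\<in>Basis. (inv (M x) v \<bullet> b) *\<^sub>R N (M x b - M x0 b)) = inv (M x) v"
    if "x \<in> S" for x
  proof -
    define z where "z = inv (M x) v"
    have lN: "linear N" using N by (simp add: bounded_linear_def)
    have "(\<Sum>b\<in>Basis. (z \<bullet> b) *\<^sub>R N (M x b - M x0 b)) = N (M x z) - N (M x0 z)"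
      using linear_Basis_sum[OF linear_compose[OF linM[OF that] lN], of z]
        linear_Basis_sum[OF linear_compose[OF linM[OF x0] lN], of z]
      by (simp add: linear_diff[OF lN] scaleR_diff_right sum_subtractf)
    also have "\<dots> = N v - z"
      using inv_M[OF that] inv_M_eq[OF x0] by (simp add: z_def N_def)
    finally show ?thesis by (simp add: z_def)
  qed
  ultimately have "((\<lambda>x. inv (M x) v) has_derivative
      (\<lambda>h. 0 - (\<Sum>b\<in>Basis. (inv (M x0) v \<bullet> b) *\<^sub>R N (D (\<lambda>y. M y b) x0 h - 0)))) (at x0)"
    by (rule has_derivative_transform_within_open[OF _ S x0])
  then show ?thesis by (simp add: N_def)
qed

text \<open>The derivative formula applies the inverse to a vector that varies with
  \<open>x\<close>; after a basis expansion the inverse meets fixed vectors only, and the induction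
  hypothesis applies to it.\<close>

lemma smooth_on_inv: "smooth_on S (\<lambda>x. inv (M x) v)"
  unfolding smooth_on_def
proof
  show "Ck_on k S (\<lambda>x. inv (M x) v)" for k
  proof (induction k arbitrary: v)
    case 0
    then show ?case using isCont_inv by (simp add: continuous_at_imp_continuous_on)
  next
    case (Suc k)
    have "Ck_on k S (\<lambda>x. - (\<Sum>b\<in>Basis. (inv (M x) v \<bullet> b) *\<^sub>R inv (M x) (D (\<lambda>y. M y b) x h)))" for h
    proof (rule Ck_on_cong[OF S])
      show "- (\<Sum>b\<in>Basis. (inv (M x) v \<bullet> b) *\<^sub>R (\<Sum>c\<in>Basis. (D (\<lambda>y. M y b) x h \<bullet> c) *\<^sub>R inv (M x) c))
        = - (\<Sum>b\<in>Basis. (inv (M x) v \<bullet> b) *\<^sub>R inv (M x) (D (\<lambda>y. M y b) x h))" if "x \<in> S" for x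
        by (simp flip: linear_Basis_sum[OF linear_inv[OF that]])
      show "Ck_on k S (\<lambda>x. - (\<Sum>b\<in>Basis. (inv (M x) v \<bullet> b) *\<^sub>R
          (\<Sum>c\<in>Basis. (D (\<lambda>y. M y b) x h \<bullet> c) *\<^sub>R inv (M x) c)))"
        using smooth_on_D(2)[OF smM] Suc.IH unfolding smooth_on_def
        by (intro Ck_on_bounded_linear[OF S bounded_linear_minus[OF bounded_linear_ident]] Ck_on_sum
            Ck_on_bilinear[OF S bounded_bilinear_scaleR] Ck_on_bounded_linear[OF S bounded_linear_inner_left] S)
          auto
    qed
    with has_derivative_inv show ?case by (rule Ck_on_SucI[OF S])
  qed
qed

end

text \<open>The classical theorem yields a differentiable inverse with derivative
  \<open>inv (D f (g y))\<close>. If \<open>g\<close> is of order \<open>k\<close>, so is this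
  derivative, hence \<open>g\<close> is of order \<open>Suc k\<close>.\<close>

theorem smooth_inverse_function:
  fixes f :: "'a::euclidean_space \<Rightarrow> 'a"
  assumes S: "open S" and f: "smooth_on S f" and p: "p \<in> S" and inj: "inj (D f p)"
  obtains r g where "0 < r" "smooth_on (ball (f p) r) g" "g ` ball (f p) r \<subseteq> S" "g (f p) = p"
    "\<And>y. y \<in> ball (f p) r \<Longrightarrow> f (g y) = y" "open (g ` ball (f p) r)"
proof -
  define f' where "f' x = Blinfun (D f x)" for x
  have f': "blinfun_apply (f' x) = D f x" if "x \<in> S" for x
    unfolding f'_def
    using has_derivative_bounded_linear[OF smooth_on_D(1)[OF f that]] by (simp add: bounded_linear_Blinfun_apply)
  obtain N where N: "linear N" "N \<circ> D f p = id"
    using linear_injective_left_inverse[OF smooth_on_linear_D[OF f p] inj] by blast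
  have cont: "continuous_on S f'"
    by (intro continuous_on_blinfun_componentwise)
      (use smooth_on_continuous_on[OF smooth_on_D(2)[OF f]] in \<open>simp add: f' cong: continuous_on_cong\<close>)
  have inv: "Blinfun N o\<^sub>L f' p = id_blinfun"
    using N p by (intro blinfun_eqI)
      (simp add: f' bounded_linear_Blinfun_apply linear_conv_bounded_linear pointfree_idE)
  have der: "\<And>x. x \<in> S \<Longrightarrow> (f has_derivative blinfun_apply (f' x)) (at x)"
    using smooth_on_D(1)[OF f] f' by simp
  obtain U V g g' where U: "open U" "U \<subseteq> S" "p \<in> U" and V: "open V" "f p \<in> V"
    and hom: "homeomorphism U V f g"
    and g: "\<And>y. y \<in> V \<Longrightarrow> (g has_derivative (g' y)) (at y)"
      "\<And>y. y \<in> V \<Longrightarrow> g' y = Hilbert_Choice.inv (blinfun_apply (f' (g y)))"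
    and bij: "\<And>y. y \<in> V \<Longrightarrow> bij (blinfun_apply (f' (g y)))"
    by (rule inverse_function_theorem[OF S der cont p inv]) auto
  have gV: "g y \<in> U" if "y \<in> V" for y using hom that by (auto simp: homeomorphism_def)
  have fg: "f (g y) = y" if "y \<in> V" for y using hom that by (auto simp: homeomorphism_def)
  have gf: "g (f x) = x" "f x \<in> V" if "x \<in> U" for x using hom that by (auto simp: homeomorphism_def)
  have "linear_family U (D f)"
  proof (rule linear_family.intro)
    show "inj (D f x)" if "x \<in> U" for x
      using bij[OF gf(2)[OF that]] gf(1)[OF that] f'[of x] U(2) that by (auto simp: bij_def)
    show "smooth_on U (\<lambda>x. D f x w)" for w
      using smooth_on_subset[OF smooth_on_D(2)[OF f] U(2)] .
    show "linear (D f x)" if "x \<in> U" for x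
      using smooth_on_linear_D[OF f] U(2) that by blast
  qed (rule U(1))
  then interpret linear_family U "D f" .
  have "Ck_on k V g" for k
  proof (induction k)
    case 0
    then show ?case using g(1) by (auto intro: has_derivative_continuous_on has_derivative_at_withinI)
  next
    case (Suc k)
    have "Ck_on k V (\<lambda>y. inv (D f (g y)) v)" for v
      by (rule Ck_on_compose[OF V(1) U(1) _ Suc.IH])
        (use smooth_on_inv[of v] gV in \<open>auto simp: smooth_on_def\<close>)
    moreover have "(g has_derivative inv (D f (g y))) (at y)" if "y \<in> V" for y
      using g(1)[OF that] g(2)[OF that] f'[of "g y"] gV[OF that] U(2) by auto
    ultimately show ?case by (intro Ck_on_SucI[OF V(1)])
  qed
  then have smg: "smooth_on V g" by (simp add: smooth_on_def)
  obtain r where r: "r > 0" "ball (f p) r \<subseteq> V" using V openE by blast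
  \<comment> \<open>The image under \<open>g\<close> is a preimage under the continuous
    \<open>f\<close>, hence open.\<close>
  have "g ` ball (f p) r = U \<inter> f -` ball (f p) r"
    using gV gf fg r(2) by (force simp: image_iff)
  moreover have "open (U \<inter> f -` ball (f p) r)"
    using hom U(1) by (intro continuous_open_preimage) (auto simp: homeomorphism_def)
  ultimately show ?thesis
    using that[of r g] r smg gV gf(1)[OF U(3)] fg U(2) smooth_on_subset by (metis image_subset_iff subset_iff)
qed

section \<open>Linear total differential equations\<close>

text \<open>A factor 1/2 on an interval of length 1 replaces the exponential: at a maximum point
  \<open>s\<close> of the norm, the mean value inequality gives
  \<open>norm (f s) \<le> norm (f s) / 2 + e\<close>.\<close>

lemma gronwall_half:
  fixes f :: "real \<Rightarrow> 'a::real_normed_vector"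
  assumes f: "\<And>t. t \<in> {0..1} \<Longrightarrow> (f has_vector_derivative f' t) (at t within {0..1})"
    and 0: "f 0 = 0" and le: "\<And>t. t \<in> {0..1} \<Longrightarrow> norm (f' t) \<le> norm (f t) / 2 + e"
    and t: "t \<in> {0..1}"
  shows "norm (f t) \<le> 2 * e"
proof -
  have "continuous_on {0..1} (\<lambda>t. norm (f t))"
    by (intro continuous_on_norm continuous_on_vector_derivative) (rule f)
  from continuous_attains_sup[OF _ _ this] obtain s where s: "s \<in> {0..1}"
    "\<And>t. t \<in> {0..1} \<Longrightarrow> norm (f t) \<le> norm (f s)" by auto
  have "norm (f s - f 0) \<le> (norm (f s) / 2 + e) * norm (s - 0)"
  proof (rule differentiable_bound[OF convex_real_interval(5)])
    show "(f has_derivative (\<lambda>r. r *\<^sub>R f' t)) (at t within {0..1})" if "t \<in> {0..1}" for t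
      using f[OF that] by (simp add: has_vector_derivative_def)
    show "onorm (\<lambda>r. r *\<^sub>R f' t) \<le> norm (f s) / 2 + e" if "t \<in> {0..1}" for t
    proof -
      have "onorm (\<lambda>r. r *\<^sub>R f' t) = norm (f' t)"
        using onorm_scaleR_left[OF bounded_linear_ident, of "f' t"] by (simp add: onorm_id)
      then show ?thesis using le[OF that] s(2)[OF that] by simp
    qed
  qed (use s in auto)
  also have "\<dots> \<le> (norm (f s) / 2 + e) * 1"
    using s(1) order_trans[OF norm_ge_zero le[OF s(1)]] by (intro mult_left_mono) auto
  finally have "norm (f s) \<le> 2 * e" using 0 by simp
  then show ?thesis using s(2)[OF t] by simp
qed

lemma linear_ode_unit_interval:
  fixes L :: "real \<Rightarrow> 'b::euclidean_space \<Rightarrow> 'b"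
  assumes lin: "\<And>t. t \<in> {0..1} \<Longrightarrow> linear (L t)" and cont: "\<And>u. continuous_on {0..1} (\<lambda>t. L t u)"
    and half: "\<And>t u. t \<in> {0..1} \<Longrightarrow> norm (L t u) \<le> norm u / 2"
  obtains Y where "Y 0 = y0"
    "\<And>t. t \<in> {0..1} \<Longrightarrow> (Y has_vector_derivative L t (Y t)) (at t within {0..1})"
proof -
  have contL: "continuous_on {0..1} (\<lambda>t. L t (f t))" if "continuous_on {0..1} f" for f
  proof -
    have "continuous_on {0..1} (\<lambda>t. \<Sum>b\<in>Basis. (f t \<bullet> b) *\<^sub>R L t b)"
      by (intro continuous_intros that cont)
    then show ?thesis
      by (rule continuous_on_eq) (use linear_Basis_sum[OF lin] in auto)
  qed
  define F where "F f t = y0 + integral {0..t} (\<lambda>s. L s (f s))" for f and t :: real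
  have der: "(F f has_vector_derivative L t (f t)) (at t within {0..1})"
    if "continuous_on {0..1} f" "t \<in> {0..1}" for f t
    unfolding F_def using integral_has_vector_derivative[OF contL[OF that(1)] that(2)]
    by (auto intro!: derivative_eq_intros)
  then have contF: "continuous_on (cbox 0 1) (F f)" if "continuous_on {0..1} f" for f
    unfolding cbox_interval by (intro continuous_on_vector_derivative) (rule der[OF that])
  \<comment> \<open>The complete space consists of bounded continuous functions on the whole line;
    \<open>clamp\<close> extends the integral constantly beyond the interval.\<close>
  define T :: "(real \<Rightarrow>\<^sub>C 'b) \<Rightarrow> real \<Rightarrow>\<^sub>C 'b" where
    "T f = (SOME g. \<forall>t. apply_bcontfun g t = F f (clamp 0 1 t))" for f
  have cf: "continuous_on A (apply_bcontfun f)" for f :: "real \<Rightarrow>\<^sub>C 'b" and A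
    using apply_bcontfun[of f] by (auto simp: bcontfun_def intro: continuous_on_subset)
  have T: "apply_bcontfun (T f) t = F f (clamp 0 1 t)" for f t
  proof -
    obtain g :: "real \<Rightarrow>\<^sub>C 'b" where "\<And>t. apply_bcontfun g t = F f (clamp 0 1 t)"
      using continuous_on_cbox_bcontfunE[OF contF[OF cf]] by metis
    then show ?thesis
      unfolding T_def using someI_ex[of "\<lambda>g. \<forall>t. apply_bcontfun g t = F f (clamp 0 1 t)"] by blast
  qed
  have "dist (T f) (T g) \<le> (1 / 2) * dist f g" for f g
  proof (rule dist_bound)
    fix t :: real
    define s where "s = clamp 0 1 t"
    have s: "s \<in> {0..1}" using clamp_in_interval[of "0::real" 1 t] by (simp add: s_def)
    have "norm ((\<lambda>t. F f t - F g t) s - (\<lambda>t. F f t - F g t) 0) \<le> (1 / 2 * dist f g) * norm (s - 0)"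
    proof (rule differentiable_bound[OF convex_real_interval(5)])
      show "((\<lambda>t. F f t - F g t) has_derivative (\<lambda>r. r *\<^sub>R (L t (f t) - L t (g t)))) (at t within {0..1})"
        if "t \<in> {0..1}" for t
        using has_vector_derivative_diff[OF der[OF cf that] der[OF cf that]]
        by (simp add: has_vector_derivative_def)
      show "onorm (\<lambda>r. r *\<^sub>R (L t (f t) - L t (g t))) \<le> 1 / 2 * dist f g" if "t \<in> {0..1}" for t
      proof -
        have "onorm (\<lambda>r. r *\<^sub>R (L t (f t) - L t (g t))) = norm (L t (f t - g t))"
          using onorm_scaleR_left[OF bounded_linear_ident, of "L t (f t) - L t (g t)"]
          by (simp add: onorm_id linear_diff[OF lin[OF that]])
        also have "\<dots> \<le> norm (f t - g t) / 2" by (rule half[OF that])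
        also have "\<dots> \<le> 1 / 2 * dist f g" using dist_bounded[of f t g] by (simp add: dist_norm)
        finally show ?thesis .
      qed
    qed (use s in auto)
    also have "\<dots> \<le> (1 / 2 * dist f g) * 1" using s by (intro mult_left_mono) auto
    finally show "dist (T f t) (T g t) \<le> (1 / 2) * dist f g"
      by (simp add: T dist_norm F_def s_def)
  qed
  then obtain f where f: "T f = f"
    using banach_fix_type[of "1/2" T] by auto
  have fF: "f t = F f t" if "t \<in> {0..1}" for t
    using T[of f t] that by (simp add: f)
  have "(f has_vector_derivative L t (f t)) (at t within {0..1})" if "t \<in> {0..1}" for t
    using der[OF cf that, of f] that fF
    by (auto intro: has_vector_derivative_transform[OF that])
  moreover have "f 0 = y0" using fF[of 0] by (simp add: F_def)
  ultimately show ?thesis using that by blast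
qed

text \<open>Continuity on a compact set bounds the finitely many basis derivatives, hence the
  operator norm; convexity turns this into a Lipschitz constant.\<close>

lemma smooth_on_Lipschitz:
  fixes f :: "'a::euclidean_space \<Rightarrow> 'b::real_normed_vector"
  assumes f: "smooth_on S f" and K: "compact K" "convex K" "K \<subseteq> S"
  obtains C where "0 \<le> C" "\<And>x v. x \<in> K \<Longrightarrow> norm (D f x v) \<le> C * norm v"
    "\<And>x y. x \<in> K \<Longrightarrow> y \<in> K \<Longrightarrow> norm (f y - f x) \<le> C * norm (y - x)"
proof -
  have "\<exists>c. \<forall>x\<in>K. norm (D f x b) \<le> c" for b
    using compact_imp_bounded[OF compact_continuous_image[OF
        continuous_on_subset[OF smooth_on_continuous_on[OF smooth_on_D(2)[OF f]] K(3)] K(1)], of b]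
    unfolding bounded_iff by blast
  then obtain c where c: "\<And>b x. x \<in> K \<Longrightarrow> norm (D f x b) \<le> c b" by metis
  define C where "C = (\<Sum>b\<in>Basis. \<bar>c b\<bar>)"
  have bd: "norm (D f x v) \<le> C * norm v" if "x \<in> K" for x v
  proof -
    have "norm (D f x v) = norm (\<Sum>b\<in>Basis. (v \<bullet> b) *\<^sub>R D f x b)"
      using linear_Basis_sum[OF smooth_on_linear_D[OF f]] that K(3) by (metis subsetD)
    also have "\<dots> \<le> (\<Sum>b\<in>Basis. norm v * \<bar>c b\<bar>)"
    proof (intro sum_norm_le)
      fix b :: 'a assume "b \<in> Basis"
      then show "norm ((v \<bullet> b) *\<^sub>R D f x b) \<le> norm v * \<bar>c b\<bar>"
        using c[OF that, of b] by (auto intro!: mult_mono Basis_le_norm)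
    qed
    finally show ?thesis by (simp add: C_def sum_distrib_left mult.commute)
  qed
  have "0 \<le> C" by (simp add: C_def sum_nonneg)
  moreover have "norm (f y - f x) \<le> C * norm (y - x)" if "x \<in> K" "y \<in> K" for x y
    by (rule differentiable_bound[OF K(2) has_derivative_at_withinI[OF smooth_on_D(1)[OF f]] onorm_bound])
      (use K(3) that bd \<open>0 \<le> C\<close> in auto)
  ultimately show ?thesis using that bd by blast
qed

text \<open>The basis derivatives are Lipschitz, hence so is \<open>D f\<close>; the mean value
  inequality along the segment then makes the linearization error quadratic.\<close>

lemma smooth_on_Taylor:
  fixes f :: "'a::euclidean_space \<Rightarrow> 'b::real_normed_vector"
  assumes f: "smooth_on S f" and K: "compact K" "convex K" "K \<subseteq> S"
  obtains C where "0 \<le> C" "\<And>x y. x \<in> K \<Longrightarrow> y \<in> K \<Longrightarrow> norm (f y - f x - D f x (y - x)) \<le> C * (norm (y - x))\<^sup>2"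
proof -
  have "\<exists>C\<ge>0. \<forall>x\<in>K. \<forall>y\<in>K. norm (D f y b - D f x b) \<le> C * norm (y - x)" for b
    by (rule smooth_on_Lipschitz[OF smooth_on_D(2)[OF f] K]) blast
  then obtain c where c: "\<And>b. c b \<ge> 0" "\<And>b x y. x \<in> K \<Longrightarrow> y \<in> K \<Longrightarrow> norm (D f y b - D f x b) \<le> c b * norm (y - x)"
    by metis
  define C where "C = (\<Sum>b\<in>Basis. c b)"
  have C: "0 \<le> C" using c by (simp add: C_def sum_nonneg)
  have lin: "linear (D f x)" if "x \<in> K" for x using smooth_on_linear_D[OF f] that K(3) by blast
  have bd: "norm (D f y v - D f x v) \<le> C * norm (y - x) * norm v" if "x \<in> K" "y \<in> K" for x y v
  proof -
    have "D f y v - D f x v = (\<Sum>b\<in>Basis. (v \<bullet> b) *\<^sub>R (D f y b - D f x b))"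
      by (subst (1 2) linear_Basis_sum) (auto simp: lin that sum_subtractf scaleR_diff_right)
    also have "norm \<dots> \<le> (\<Sum>b\<in>Basis. norm v * (c b * norm (y - x)))"
      using c that by (intro sum_norm_le) (auto intro!: mult_mono Basis_le_norm)
    finally show ?thesis by (simp add: C_def sum_distrib_left sum_distrib_right mult_ac)
  qed
  have "norm (f y - f x - D f x (y - x)) \<le> C * (norm (y - x))\<^sup>2" if xy: "x \<in> K" "y \<in> K" for x y
  proof -
    have seg: "closed_segment x y \<subseteq> K" using xy K(2) by (simp add: closed_segment_subset)
    have "norm (f y - f x - D f x (y - x)) \<le> norm (y - x) * (C * norm (y - x))"
    proof (rule differentiable_bound_linearization[where S = "closed_segment x y"])
      show "x + t *\<^sub>R (y - x) \<in> closed_segment x y" if "t \<in> {0..1}" for t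
        using that by (auto simp: in_segment algebra_simps intro!: exI[of _ t])
      show "(f has_derivative D f z) (at z within closed_segment x y)" if "z \<in> closed_segment x y" for z
        using smooth_on_D(1)[OF f] seg K(3) that by (blast intro: has_derivative_at_withinI)
      show "onorm (D f z - D f x) \<le> C * norm (y - x)" if "z \<in> closed_segment x y" for z
      proof (rule onorm_bound)
        fix v
        have "norm ((D f z - D f x) v) \<le> C * norm (z - x) * norm v"
          using bd[of x z v] seg that xy by auto
        also have "\<dots> \<le> C * norm (y - x) * norm v"
          using segment_bound1[OF that] C by (auto intro!: mult_right_mono mult_left_mono)
        finally show "norm ((D f z - D f x) v) \<le> C * norm (y - x) * norm v" .
      qed (use C in simp)
    qed auto
    then show ?thesis by (simp add: power2_eq_square mult_ac)
  qed
  then show ?thesis using that C by blast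
qed

text \<open>The system \<open>dy = B(x)(dx) y\<close>; \<open>flat\<close> says that its mixed second derivatives agree.\<close>

locale flat_linear_system =
  fixes S :: "'a::euclidean_space set" and B :: "'a \<Rightarrow> 'a \<Rightarrow> 'b::euclidean_space \<Rightarrow> 'b"
  assumes S: "open S" and bil: "\<And>x. x \<in> S \<Longrightarrow> bilinear (B x)"
    and smooth: "\<And>h u. smooth_on S (\<lambda>x. B x h u)"
    and flat: "\<And>x h v u. x \<in> S \<Longrightarrow>
      D (\<lambda>x. B x h u) x v + B x h (B x v u) = D (\<lambda>x. B x v u) x h + B x v (B x h u)"
begin

abbreviation DB :: "'a \<Rightarrow> 'a \<Rightarrow> 'a \<Rightarrow> 'b \<Rightarrow> 'b" where
  "DB x v h u \<equiv> D (\<lambda>x. B x h u) x v"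

lemma lin_h: "x \<in> S \<Longrightarrow> linear (\<lambda>h. B x h u)" and lin_u: "x \<in> S \<Longrightarrow> linear (B x h)"
  using bil by (auto simp: bilinear_def)

text \<open>Reduces every estimate on \<open>B\<close> to the finitely many functions
  \<open>B x i j\<close>, which makes the bounds uniform in \<open>h\<close> and
  \<open>u\<close>.\<close>

lemma B_expand:
  assumes "x \<in> S"
  shows "B x h u = (\<Sum>i\<in>Basis. \<Sum>j\<in>Basis. ((h \<bullet> i) * (u \<bullet> j)) *\<^sub>R B x i j)"
  by (subst linear_Basis_sum[OF lin_h[OF assms], where v = h],
      subst linear_Basis_sum[OF lin_u[OF assms], where v = u]) (simp add: scaleR_sum_right)

lemma DB_expand:
  assumes "x \<in> S"
  shows "DB x v h u = (\<Sum>i\<in>Basis. \<Sum>j\<in>Basis. ((h \<bullet> i) * (u \<bullet> j)) *\<^sub>R DB x v i j)"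
proof -
  have "D (\<lambda>x. B x h u) x = D (\<lambda>x. \<Sum>i\<in>Basis. \<Sum>j\<in>Basis. ((h \<bullet> i) * (u \<bullet> j)) *\<^sub>R B x i j) x"
    by (rule D_cong_open[OF S assms B_expand])
  also have "\<dots> = (\<lambda>v. \<Sum>i\<in>Basis. \<Sum>j\<in>Basis. ((h \<bullet> i) * (u \<bullet> j)) *\<^sub>R DB x v i j)"
    by (intro D_eqI has_derivative_sum has_derivative_scaleR_right smooth_on_D(1)[OF smooth assms])
  finally show ?thesis by simp
qed

lemma norm_expand_le:
  fixes c :: "'a \<Rightarrow> 'b \<Rightarrow> 'c::real_normed_vector" and M :: real
  assumes "\<And>i j. i \<in> Basis \<Longrightarrow> j \<in> Basis \<Longrightarrow> norm (c i j) \<le> C i j * M"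
  shows "norm (\<Sum>i\<in>Basis. \<Sum>j\<in>Basis. ((h \<bullet> i) * (u \<bullet> j)) *\<^sub>R c i j)
      \<le> (\<Sum>i\<in>Basis. \<Sum>j\<in>Basis. C i j) * M * norm h * norm u"
proof -
  have "norm (\<Sum>i\<in>Basis. \<Sum>j\<in>Basis. ((h \<bullet> i) * (u \<bullet> j)) *\<^sub>R c i j)
      \<le> (\<Sum>i\<in>Basis. \<Sum>j\<in>Basis. (norm h * norm u) * (C i j * M))"
    using assms by (intro sum_norm_le)
      (auto simp: abs_mult intro!: mult_mono Basis_le_norm)
  then show ?thesis by (simp add: sum_distrib_left sum_distrib_right mult_ac)
qed

text \<open>Size, Lipschitz and second-order bounds with one common constant: the three estimates
  needed to compare neighbouring rays.\<close>

lemma local_bounds: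
  assumes "cball p r \<subseteq> S"
  obtains M where "0 \<le> M"
    "\<And>x h u. x \<in> cball p r \<Longrightarrow> norm (B x h u) \<le> M * norm h * norm u"
    "\<And>x y h u. x \<in> cball p r \<Longrightarrow> y \<in> cball p r \<Longrightarrow>
        norm (B y h u - B x h u) \<le> M * norm (y - x) * norm h * norm u"
    "\<And>x y h u. x \<in> cball p r \<Longrightarrow> y \<in> cball p r \<Longrightarrow>
        norm (B y h u - B x h u - DB x (y - x) h u) \<le> M * (norm (y - x))\<^sup>2 * norm h * norm u"
proof -
  let ?K = "cball p r"
  have "\<exists>C\<ge>0. \<forall>x\<in>?K. norm (B x i j) \<le> C" for i j
    using compact_imp_bounded[OF compact_continuous_image[OF
        continuous_on_subset[OF smooth_on_continuous_on[OF smooth] assms] compact_cball], of i j]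
    unfolding bounded_pos by (metis imageI less_imp_le)
  then obtain C1 where C1: "\<And>i j. 0 \<le> C1 i j" "\<And>i j x. x \<in> ?K \<Longrightarrow> norm (B x i j) \<le> C1 i j" by metis
  have "\<exists>C\<ge>0. \<forall>x\<in>?K. \<forall>y\<in>?K. norm (B y i j - B x i j) \<le> C * norm (y - x)" for i j
    by (rule smooth_on_Lipschitz[OF smooth compact_cball convex_cball assms]) blast
  then obtain C2 where C2: "\<And>i j. 0 \<le> C2 i j"
    "\<And>i j x y. x \<in> ?K \<Longrightarrow> y \<in> ?K \<Longrightarrow> norm (B y i j - B x i j) \<le> C2 i j * norm (y - x)" by metis
  have "\<exists>C\<ge>0. \<forall>x\<in>?K. \<forall>y\<in>?K. norm (B y i j - B x i j - DB x (y - x) i j) \<le> C * (norm (y - x))\<^sup>2" for i j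
    by (rule smooth_on_Taylor[OF smooth compact_cball convex_cball assms]) blast
  then obtain C3 where C3: "\<And>i j. 0 \<le> C3 i j"
    "\<And>i j x y. x \<in> ?K \<Longrightarrow> y \<in> ?K \<Longrightarrow> norm (B y i j - B x i j - DB x (y - x) i j) \<le> C3 i j * (norm (y - x))\<^sup>2" by metis
  define M1 M2 M3 where "M1 = (\<Sum>i\<in>Basis. \<Sum>j\<in>Basis. C1 i j)" and "M2 = (\<Sum>i\<in>Basis. \<Sum>j\<in>Basis. C2 i j)"
    and "M3 = (\<Sum>i\<in>Basis. \<Sum>j\<in>Basis. C3 i j)"
  have nn: "0 \<le> M1" "0 \<le> M2" "0 \<le> M3"
    using C1(1) C2(1) C3(1) by (auto simp: M1_def M2_def M3_def intro!: sum_nonneg)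
  have 1: "norm (B x h u) \<le> M1 * 1 * norm h * norm u" if "x \<in> ?K" for x h u
    using norm_expand_le[of "B x" C1 1 h u] C1(2)[OF that] that assms
    unfolding M1_def by (subst B_expand) auto
  have 2: "norm (B y h u - B x h u) \<le> M2 * norm (y - x) * norm h * norm u" if "x \<in> ?K" "y \<in> ?K" for x y h u
  proof -
    have "B y h u - B x h u = (\<Sum>i\<in>Basis. \<Sum>j\<in>Basis. ((h \<bullet> i) * (u \<bullet> j)) *\<^sub>R (B y i j - B x i j))"
      using that assms by (subst (1 2) B_expand) (auto simp: sum_subtractf scaleR_diff_right)
    then show ?thesis unfolding M2_def using that C2 by (auto intro!: norm_expand_le)
  qed
  have 3: "norm (B y h u - B x h u - DB x (y - x) h u) \<le> M3 * (norm (y - x))\<^sup>2 * norm h * norm u"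
    if "x \<in> ?K" "y \<in> ?K" for x y h u
  proof -
    have "B y h u - B x h u - DB x (y - x) h u
        = (\<Sum>i\<in>Basis. \<Sum>j\<in>Basis. ((h \<bullet> i) * (u \<bullet> j)) *\<^sub>R (B y i j - B x i j - DB x (y - x) i j))"
      using that assms by (subst (1 2) B_expand, blast, blast, subst DB_expand)
        (auto simp: sum_subtractf scaleR_diff_right)
    then show ?thesis unfolding M3_def using that C3 by (auto intro!: norm_expand_le)
  qed
  show ?thesis
  proof (rule that[of "M1 + M2 + M3"])
    show "norm (B x h u) \<le> (M1 + M2 + M3) * norm h * norm u" if "x \<in> ?K" for x h u
      by (rule order_trans[OF 1[OF that]]) (use nn in \<open>auto intro!: mult_right_mono\<close>)
    show "norm (B y h u - B x h u) \<le> (M1 + M2 + M3) * norm (y - x) * norm h * norm u"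
      if "x \<in> ?K" "y \<in> ?K" for x y h u
      by (rule order_trans[OF 2[OF that]]) (use nn in \<open>auto intro!: mult_right_mono\<close>)
    show "norm (B y h u - B x h u - DB x (y - x) h u) \<le> (M1 + M2 + M3) * (norm (y - x))\<^sup>2 * norm h * norm u"
      if "x \<in> ?K" "y \<in> ?K" for x y h u
      by (rule order_trans[OF 3[OF that]]) (use nn in \<open>auto intro!: mult_right_mono\<close>)
  qed (use nn in simp)
qed

text \<open>Smoothness of \<open>B\<close> is known for fixed arguments only, so the moving argument
  \<open>Y t\<close> is expanded in the basis before the product rule is applied.\<close>

lemma has_vector_derivative_B:
  assumes c: "(c has_vector_derivative c') (at t within T)" and Y: "(Y has_vector_derivative Y') (at t within T)"
    and "t \<in> T" "c ` T \<subseteq> S"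
  shows "((\<lambda>t. B (c t) h (Y t)) has_vector_derivative DB (c t) c' h (Y t) + B (c t) h Y') (at t within T)"
proof -
  have ct: "c t \<in> S" using assms(3,4) by blast
  have lD: "linear (\<lambda>u. DB (c t) c' h u)"
  proof (rule linearI)
    show "DB (c t) c' h (x + y) = DB (c t) c' h x + DB (c t) c' h y" for x y
      by (simp add: DB_expand[OF ct, where h = h] inner_add_left algebra_simps sum.distrib)
    show "DB (c t) c' h (k *\<^sub>R x) = k *\<^sub>R DB (c t) c' h x" for k x
      by (simp add: DB_expand[OF ct, where h = h] scaleR_sum_right mult_ac)
  qed
  have "((\<lambda>t. B (c t) h j) has_vector_derivative DB (c t) c' h j) (at t within T)" for j
    using vector_derivative_diff_chain_within[OF c has_derivative_at_withinI[OF smooth_on_D(1)[OF smooth ct]]]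
    by (simp add: o_def)
  moreover have "((\<lambda>t. Y t \<bullet> j) has_vector_derivative Y' \<bullet> j) (at t within T)" for j
    by (rule bounded_linear.has_vector_derivative[OF bounded_linear_inner_left Y])
  ultimately have "((\<lambda>t. \<Sum>j\<in>Basis. (Y t \<bullet> j) *\<^sub>R B (c t) h j) has_vector_derivative
      (\<Sum>j\<in>Basis. (Y t \<bullet> j) *\<^sub>R DB (c t) c' h j + (Y' \<bullet> j) *\<^sub>R B (c t) h j)) (at t within T)"
    by (intro has_vector_derivative_sum has_vector_derivative_scaleR)
       (auto simp: has_real_derivative_iff_has_vector_derivative)
  moreover have "(\<Sum>j\<in>Basis. (Y t \<bullet> j) *\<^sub>R DB (c t) c' h j + (Y' \<bullet> j) *\<^sub>R B (c t) h j)
      = DB (c t) c' h (Y t) + B (c t) h Y'"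
    using linear_Basis_sum[OF lD, of "Y t"] linear_Basis_sum[OF lin_u[OF ct], where v = Y']
    by (simp add: sum.distrib)
  ultimately have der: "((\<lambda>t. \<Sum>j\<in>Basis. (Y t \<bullet> j) *\<^sub>R B (c t) h j) has_vector_derivative
      DB (c t) c' h (Y t) + B (c t) h Y') (at t within T)" by simp
  show ?thesis
  proof (rule has_vector_derivative_transform[OF assms(3) _ der])
    show "B (c s) h (Y s) = (\<Sum>j\<in>Basis. (Y s \<bullet> j) *\<^sub>R B (c s) h j)" if "s \<in> T" for s
      by (rule linear_Basis_sum[OF lin_u[OF subsetD[OF assms(4) imageI[OF that]]]])
  qed
qed

text \<open>The equation expresses the derivative of \<open>y\<close> through \<open>y\<close>
  itself, so regularity climbs one order at a time.\<close>

lemma smooth_on_solution: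
  assumes T: "open T" "T \<subseteq> S" and y: "\<And>x. x \<in> T \<Longrightarrow> (y has_derivative (\<lambda>h. B x h (y x))) (at x)"
  shows "smooth_on T y"
  unfolding smooth_on_def
proof
  show "Ck_on k T y" for k
  proof (induction k)
    case 0
    then show ?case
      using has_derivative_continuous_on[OF has_derivative_at_withinI[OF y]] by simp
  next
    case (Suc k)
    have "Ck_on k T (\<lambda>x. B x h (y x))" for h
    proof (rule Ck_on_cong[OF T(1)])
      show "(\<Sum>j\<in>Basis. (y x \<bullet> j) *\<^sub>R B x h j) = B x h (y x)" if "x \<in> T" for x
        by (rule linear_Basis_sum[OF lin_u, symmetric]) (use T(2) that in blast)
      show "Ck_on k T (\<lambda>x. \<Sum>j\<in>Basis. (y x \<bullet> j) *\<^sub>R B x h j)"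
        using smooth_on_subset[OF smooth T(2)] Suc.IH unfolding smooth_on_def
        by (intro Ck_on_sum Ck_on_bilinear[OF T(1) bounded_bilinear_scaleR]
            Ck_on_bounded_linear[OF T(1) bounded_linear_inner_left] T(1)) auto
    qed
    with y show ?case by (intro Ck_on_SucI[OF T(1), where f' = "\<lambda>x h. B x h (y x)"])
  qed
qed

end

text \<open>Each ray from \<open>p\<close> is integrated separately. By flatness, the first-order error of two neighbouring
  rays again satisfies the ray equation up to a quadratic term, so differentiability of the value at
  time 1 follows from Gronwall without smooth dependence on parameters.\<close>

locale flat_linear_system_on_ball = flat_linear_system S B
  for S :: "'a::euclidean_space set" and B :: "'a \<Rightarrow> 'a \<Rightarrow> 'b::euclidean_space \<Rightarrow> 'b" +
  fixes p :: 'a and r0 M r :: real and y0 :: 'b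
  assumes K: "cball p r0 \<subseteq> S" and M0: "0 \<le> M"
    and Mb: "\<And>x h u. x \<in> cball p r0 \<Longrightarrow> norm (B x h u) \<le> M * norm h * norm u"
    and Ml: "\<And>x y h u. x \<in> cball p r0 \<Longrightarrow> y \<in> cball p r0 \<Longrightarrow>
        norm (B y h u - B x h u) \<le> M * norm (y - x) * norm h * norm u"
    and Mt: "\<And>x y h u. x \<in> cball p r0 \<Longrightarrow> y \<in> cball p r0 \<Longrightarrow>
        norm (B y h u - B x h u - DB x (y - x) h u) \<le> M * (norm (y - x))\<^sup>2 * norm h * norm u"
    and r: "0 < r" "r \<le> r0" "M * r \<le> 1 / 2" "r \<le> 1"
begin

text \<open>The equation restricted to the ray from \<open>p\<close> with velocity \<open>w\<close>.
  The value at time 1 will be the solution at \<open>p + w\<close>.\<close>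

definition radial_solution :: "'a \<Rightarrow> (real \<Rightarrow> 'b) \<Rightarrow> bool" where
  "radial_solution w Y \<longleftrightarrow> Y 0 = y0 \<and>
     (\<forall>t\<in>{0..1}. (Y has_vector_derivative B (p + t *\<^sub>R w) w (Y t)) (at t within {0..1}))"

lemma ray_mem: "norm w < r \<Longrightarrow> t \<in> {0..1} \<Longrightarrow> p + t *\<^sub>R w \<in> cball p r0"
  using r mult_mono[of t 1 "norm w" r] by (auto simp: dist_norm)

text \<open>The locale bound \<open>M * r \<le> 1 / 2\<close> is made for this: both the existence
  result and the Gronwall estimate on the unit interval ask for the factor 1/2.\<close>

lemma ray_half:
  assumes "norm w < r" "t \<in> {0..1}" shows "norm (B (p + t *\<^sub>R w) w u) \<le> norm u / 2"
proof -
  have "norm (B (p + t *\<^sub>R w) w u) \<le> M * norm w * norm u" by (rule Mb[OF ray_mem[OF assms]])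
  also have "\<dots> \<le> M * r * norm u" using assms M0 by (intro mult_right_mono mult_left_mono) auto
  also have "\<dots> \<le> 1 / 2 * norm u" using r(3) by (rule mult_right_mono) simp
  finally show ?thesis by simp
qed

lemma radial_solution_ex:
  assumes "norm w < r" shows "\<exists>Y. radial_solution w Y"
proof -
  obtain Y where "Y 0 = y0"
    "\<And>t. t \<in> {0..1} \<Longrightarrow> (Y has_vector_derivative B (p + t *\<^sub>R w) w (Y t)) (at t within {0..1})"
  proof (rule linear_ode_unit_interval[of "\<lambda>t. B (p + t *\<^sub>R w) w" y0])
    show "continuous_on {0..1} (\<lambda>t. B (p + t *\<^sub>R w) w u)" for u
      by (rule continuous_on_compose2[OF smooth_on_continuous_on[OF smooth]])
        (use ray_mem[OF assms] K in \<open>auto intro!: continuous_intros\<close>)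
    show "linear (B (p + t *\<^sub>R w) w)" if "t \<in> {0..1}" for t
      using ray_mem[OF assms that] K lin_u by blast
  qed (use ray_half[OF assms] in auto)
  then show ?thesis by (auto simp: radial_solution_def)
qed

lemma radial_solution_bound:
  assumes w: "norm w < r" and Y: "radial_solution w Y" and t: "t \<in> {0..1}"
  shows "norm (Y t) \<le> 2 * norm y0"
proof -
  have "norm (Y t - y0) \<le> 2 * (norm y0 / 2)"
  proof (rule gronwall_half[OF _ _ _ t])
    show "((\<lambda>t. Y t - y0) has_vector_derivative B (p + t *\<^sub>R w) w (Y t) - 0) (at t within {0..1})"
      if "t \<in> {0..1}" for t
      using Y that unfolding radial_solution_def by (intro derivative_intros) auto
    show "norm (B (p + t *\<^sub>R w) w (Y t) - 0) \<le> norm (Y t - y0) / 2 + norm y0 / 2" if "t \<in> {0..1}" for t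
      using ray_half[OF w that, of "Y t"] norm_triangle_sub[of "Y t" y0] by simp
  qed (use Y in \<open>simp add: radial_solution_def\<close>)
  then show ?thesis using norm_triangle_sub[of "Y t" y0] by simp
qed

text \<open>The right-hand sides differ by a change of solution, absorbed by Gronwall, a change of
  velocity and a change of base point. The last two are each at most
  \<open>2 * M * norm y0 * norm (w' - w)\<close>, and Gronwall doubles their sum.\<close>

lemma radial_solution_Lipschitz:
  assumes w: "norm w < r" "norm w' < r" and Y: "radial_solution w Y" "radial_solution w' Y'" and t: "t \<in> {0..1}"
  shows "norm (Y' t - Y t) \<le> 8 * M * norm y0 * norm (w' - w)"
proof -
  have "norm (Y' t - Y t) \<le> 2 * (4 * M * norm y0 * norm (w' - w))"
  proof (rule gronwall_half[OF _ _ _ t])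
    show "((\<lambda>t. Y' t - Y t) has_vector_derivative B (p + t *\<^sub>R w') w' (Y' t) - B (p + t *\<^sub>R w) w (Y t))
      (at t within {0..1})" if "t \<in> {0..1}" for t
      using Y that unfolding radial_solution_def by (intro derivative_intros) auto
    fix t :: real assume t: "t \<in> {0..1}"
    define c c' where "c = p + t *\<^sub>R w" and "c' = p + t *\<^sub>R w'"
    have mem: "c \<in> cball p r0" "c' \<in> cball p r0" using ray_mem w t by (auto simp: c_def c'_def)
    have cS: "c' \<in> S" using mem K by blast
    have "norm (c' - c) = t * norm (w' - w)"
      using t by (simp add: c_def c'_def flip: scaleR_diff_right)
    then have cc: "norm (c' - c) \<le> norm (w' - w)" using t by (simp add: mult_left_le_one_le)
    have m: "norm (Y t) \<le> 2 * norm y0" by (rule radial_solution_bound[OF w(1) Y(1) t])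
    have "B c' w' (Y' t) - B c w (Y t)
        = B c' w' (Y' t - Y t) + (B c' (w' - w) (Y t) + (B c' w (Y t) - B c w (Y t)))"
      by (simp add: linear_diff[OF lin_u[OF cS]] linear_diff[OF lin_h[OF cS]])
    moreover have "norm (B c' w' (Y' t - Y t)) \<le> norm (Y' t - Y t) / 2"
      unfolding c'_def by (rule ray_half[OF w(2) t])
    moreover have "norm (B c' (w' - w) (Y t)) \<le> M * norm (w' - w) * (2 * norm y0)"
      by (rule order_trans[OF Mb[OF mem(2)]]) (use m M0 in \<open>auto intro!: mult_left_mono\<close>)
    moreover have "norm (B c' w (Y t) - B c w (Y t)) \<le> M * norm (w' - w) * 1 * (2 * norm y0)"
      by (rule order_trans[OF Ml[OF mem]]) (intro mult_mono, use m M0 cc w r in auto)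
    moreover have "M * norm (w' - w) * (2 * norm y0) + M * norm (w' - w) * 1 * (2 * norm y0)
        = 4 * M * norm y0 * norm (w' - w)" by (simp add: algebra_simps)
    ultimately show "norm (B (p + t *\<^sub>R w') w' (Y' t) - B (p + t *\<^sub>R w) w (Y t))
        \<le> norm (Y' t - Y t) / 2 + 4 * M * norm y0 * norm (w' - w)"
      unfolding c_def[symmetric] c'_def[symmetric] by (smt (verit) norm_triangle_ineq)
  qed (use Y in \<open>simp add: radial_solution_def\<close>)
  then show ?thesis by simp
qed

lemma radial_solution_Taylor:
  assumes w: "norm w < r" "norm w' < r" and Y: "radial_solution w Y" "radial_solution w' Y'"
  defines "h \<equiv> w' - w"
  shows "norm (Y' 1 - Y 1 - B (p + w) h (Y 1)) \<le> (8 * M * norm y0 + 32 * M * M * norm y0) * (norm h)\<^sup>2"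
proof -
  define k where "k = 8 * M * norm y0"
  \<comment> \<open>The sum of the four quadratic remainders estimated below; \<open>k\<close> is
    the Lipschitz constant of the rays.\<close>
  define e where "e = (4 * M * norm y0 + 2 * M * k) * (norm h)\<^sup>2"
  define c where "c t = p + t *\<^sub>R w" for t
  define c' where "c' t = p + t *\<^sub>R w'" for t
  \<comment> \<open>The point at time \<open>t\<close> moves by \<open>t *\<^sub>R h\<close>, so a
    solution of the full system would change to first order by the subtracted term. At time 1 this
    is the Taylor remainder sought.\<close>
  define d where "d t = Y' t - Y t - t *\<^sub>R B (c t) h (Y t)" for t
  have mem: "c t \<in> cball p r0" "c' t \<in> cball p r0" if "t \<in> {0..1}" for t
    using ray_mem w that by (auto simp: c_def c'_def)
  have "norm (d 1) \<le> 2 * e"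
  proof (rule gronwall_half)
    fix t :: real assume t: "t \<in> {0..1}"
    let ?T = "{0..1::real}"
    have dY: "(Y has_vector_derivative B (c t) w (Y t)) (at t within ?T)"
      "(Y' has_vector_derivative B (c' t) w' (Y' t)) (at t within ?T)"
      using Y t by (auto simp: radial_solution_def c_def c'_def)
    have "(c has_vector_derivative w) (at t within ?T)"
      unfolding c_def by (auto intro!: derivative_eq_intros)
    from has_vector_derivative_B[OF this dY(1) t] mem(1) K
    have "((\<lambda>t. B (c t) h (Y t)) has_vector_derivative DB (c t) w h (Y t) + B (c t) h (B (c t) w (Y t))) (at t within ?T)"
      by blast
    from has_vector_derivative_scaleR[OF DERIV_ident this]
    show "(d has_vector_derivative B (c' t) w' (Y' t) - B (c t) w (Y t)
        - (t *\<^sub>R (DB (c t) w h (Y t) + B (c t) h (B (c t) w (Y t))) + 1 *\<^sub>R B (c t) h (Y t))) (at t within ?T)"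
      unfolding d_def by (intro has_vector_derivative_diff dY)
    have cS: "c t \<in> S" "c' t \<in> S" using mem[OF t] K by blast+
    have w': "w' = w + h" by (simp add: h_def)
    define z where "z = Y' t - Y t"
    have hz: "norm z \<le> k * norm h"
      unfolding z_def k_def h_def by (rule radial_solution_Lipschitz[OF w Y t])
    have cc: "c' t - c t = t *\<^sub>R h" by (simp add: c_def c'_def h_def scaleR_diff_right)
    have ncc: "norm (c' t - c t) \<le> norm h" using t by (simp add: cc mult_left_le_one_le)
    have m: "norm (Y t) \<le> 2 * norm y0" by (rule radial_solution_bound[OF w(1) Y(1) t])
    have k0: "0 \<le> k" using M0 by (simp add: k_def)
    \<comment> \<open>Flatness trades the derivative of \<open>B\<close> along \<open>w\<close> for
      its derivative along \<open>h\<close>. The latter is the linear part of the change of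
      \<open>B\<close> from \<open>c t\<close> to \<open>c' t\<close>, so beyond
      \<open>B (c t) w (d t)\<close> only second-order terms remain.\<close>
    have "B (c' t) w' (Y' t) - B (c t) w (Y t)
        - (t *\<^sub>R (DB (c t) w h (Y t) + B (c t) h (B (c t) w (Y t))) + 1 *\<^sub>R B (c t) h (Y t))
      = B (c t) w (d t) + ((B (c' t) w (Y t) - B (c t) w (Y t) - DB (c t) (c' t - c t) w (Y t))
        + (B (c' t) w z - B (c t) w z) + B (c' t) h z + (B (c' t) h (Y t) - B (c t) h (Y t)))"
      unfolding cc w' flat[OF cS(1), of h "Y t" w] d_def z_def
      by (simp add: linear_diff[OF lin_u] linear_add[OF lin_u] linear_add[OF lin_h] linear_scale[OF lin_u] cS
          linear_scale[OF smooth_on_linear_D[OF smooth cS(1)]] algebra_simps)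
    moreover have "norm (B (c t) w (d t)) \<le> norm (d t) / 2"
      unfolding c_def by (rule ray_half[OF w(1) t])
    moreover have "norm (B (c' t) w (Y t) - B (c t) w (Y t) - DB (c t) (c' t - c t) w (Y t))
        \<le> M * (norm h)\<^sup>2 * 1 * (2 * norm y0)"
      by (rule order_trans[OF Mt[OF mem[OF t]]]) (intro mult_mono power_mono, use m M0 ncc w r in auto)
    moreover have "norm (B (c' t) w z - B (c t) w z) \<le> M * norm h * 1 * (k * norm h)"
      by (rule order_trans[OF Ml[OF mem[OF t]]]) (intro mult_mono, use hz M0 ncc w r k0 in auto)
    moreover have "norm (B (c' t) h z) \<le> M * norm h * (k * norm h)"
      by (rule order_trans[OF Mb[OF mem(2)[OF t]]]) (use hz M0 in \<open>auto intro!: mult_left_mono\<close>)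
    moreover have "norm (B (c' t) h (Y t) - B (c t) h (Y t)) \<le> M * norm h * norm h * (2 * norm y0)"
      by (rule order_trans[OF Ml[OF mem[OF t]]]) (intro mult_mono, use m M0 ncc in auto)
    moreover have "M * (norm h)\<^sup>2 * 1 * (2 * norm y0) + M * norm h * 1 * (k * norm h)
        + M * norm h * (k * norm h) + M * norm h * norm h * (2 * norm y0) = e"
      by (simp add: e_def power2_eq_square algebra_simps)
    ultimately show "norm (B (c' t) w' (Y' t) - B (c t) w (Y t)
        - (t *\<^sub>R (DB (c t) w h (Y t) + B (c t) h (B (c t) w (Y t))) + 1 *\<^sub>R B (c t) h (Y t)))
        \<le> norm (d t) / 2 + e"
      by (smt (verit) norm_triangle_ineq)
  qed (use Y in \<open>auto simp: d_def radial_solution_def\<close>)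
  also have "2 * e = (8 * M * norm y0 + 32 * M * M * norm y0) * (norm h)\<^sup>2"
    by (simp add: e_def k_def algebra_simps)
  finally show ?thesis by (simp add: d_def c_def)
qed

end

theorem (in flat_linear_system) local_solution:
  assumes "p \<in> S"
  obtains r where "0 < r" "ball p r \<subseteq> S"
    "\<And>y0. \<exists>y. y p = y0 \<and> smooth_on (ball p r) y \<and> (\<forall>x\<in>ball p r. (y has_derivative (\<lambda>h. B x h (y x))) (at x))"
proof -
  obtain r0 where r0: "0 < r0" "cball p r0 \<subseteq> S" using S assms open_contains_cball by blast
  obtain M where M: "0 \<le> M"
    "\<And>x h u. x \<in> cball p r0 \<Longrightarrow> norm (B x h u) \<le> M * norm h * norm u"
    "\<And>x y h u. x \<in> cball p r0 \<Longrightarrow> y \<in> cball p r0 \<Longrightarrow>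
        norm (B y h u - B x h u) \<le> M * norm (y - x) * norm h * norm u"
    "\<And>x y h u. x \<in> cball p r0 \<Longrightarrow> y \<in> cball p r0 \<Longrightarrow>
        norm (B y h u - B x h u - DB x (y - x) h u) \<le> M * (norm (y - x))\<^sup>2 * norm h * norm u"
    by (rule local_bounds[OF r0(2)]) blast
  \<comment> \<open>\<open>M + 1\<close> avoids a division by zero and also gives
    \<open>r \<le> 1\<close>. The radius does not depend on the initial value, so one ball serves
    all of them.\<close>
  define r where "r = min r0 (1 / (2 * (M + 1)))"
  have "M * r \<le> M * (1 / (2 * (M + 1)))" using M(1) by (intro mult_left_mono) (auto simp: r_def)
  also have "\<dots> \<le> 1 / 2" using M(1) by (simp add: field_simps)
  finally have Mr: "M * r \<le> 1 / 2" .
  have "1 / (2 * (M + 1)) \<le> 1" using M(1) by (simp add: field_simps)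
  then have "r \<le> 1" unfolding r_def by (rule min.coboundedI2)
  with r0 M(1) have r: "0 < r" "r \<le> r0" "r \<le> 1" by (auto simp: r_def)
  have sub: "ball p r \<subseteq> S" using r r0(2) by auto
  have "\<exists>y. y p = y0 \<and> smooth_on (ball p r) y \<and> (\<forall>x\<in>ball p r. (y has_derivative (\<lambda>h. B x h (y x))) (at x))" for y0
  proof -
    interpret flat_linear_system_on_ball S B p r0 M r y0
      by unfold_locales (fact r0(2) M r Mr)+
    obtain Y where Y: "\<And>w. norm w < r \<Longrightarrow> radial_solution w (Y w)"
      using radial_solution_ex by metis
    define y where "y x = Y (x - p) 1" for x
    define C where "C = 8 * M * norm y0 + 32 * M * M * norm y0"
    have der: "(y has_derivative (\<lambda>h. B x h (y x))) (at x)" if x: "x \<in> ball p r" for x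
    proof -
      have xS: "x \<in> S" using x sub by blast
      have "norm (y z - y x - B x (z - x) (y x)) / norm (z - x) \<le> C * norm (z - x)"
        if "z \<in> ball p r" "z \<noteq> x" for z
      proof -
        have "norm (x - p) < r" "norm (z - p) < r" using x that by (auto simp: dist_norm norm_minus_commute)
        from radial_solution_Taylor[OF this Y[OF this(1)] Y[OF this(2)]]
        have "norm (y z - y x - B x (z - x) (y x)) \<le> C * (norm (z - x))\<^sup>2"
          by (simp add: y_def C_def)
        then show ?thesis using that(2) by (simp add: field_simps power2_eq_square)
      qed
      then have "eventually (\<lambda>z. norm (norm (y z - y x - B x (z - x) (y x)) / norm (z - x)) \<le> C * norm (z - x)) (at x)"
        using eventually_at_in_open[OF open_ball x] by (auto elim!: eventually_mono)
      moreover have "((\<lambda>z. C * norm (z - x)) \<longlongrightarrow> 0) (at x)"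
        by (rule tendsto_eq_intros refl | simp)+
      ultimately have "((\<lambda>z. norm (y z - y x - B x (z - x) (y x)) / norm (z - x)) \<longlongrightarrow> 0) (at x)"
        by (rule Lim_null_comparison)
      then show ?thesis
        using lin_h[OF xS] by (simp add: has_derivative_iff_norm linear_conv_bounded_linear)
    qed
    \<comment> \<open>The ray with zero velocity has zero derivative; Gronwall with
      \<open>e = 0\<close> says that it stays at \<open>y0\<close>.\<close>
    have "y p = y0"
    proof -
      have Y0: "radial_solution 0 (Y 0)" using Y r by simp
      have "norm (Y 0 1 - y0) \<le> 2 * 0"
      proof (rule gronwall_half[where f' = "\<lambda>_. 0"])
        show "((\<lambda>t. Y 0 t - y0) has_vector_derivative 0) (at t within {0..1})" if "t \<in> {0..1}" for t
          using Y0 that linear_0[OF lin_h[OF assms]]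
          by (auto simp: radial_solution_def intro!: derivative_eq_intros)
      qed (use Y0 in \<open>auto simp: radial_solution_def\<close>)
      then show ?thesis by (simp add: y_def)
    qed
    then show ?thesis using der smooth_on_solution[OF open_ball sub der] by blast
  qed
  then show ?thesis using that r(1) sub by blast
qed

text \<open>A local Poincare lemma drawn from \<open>local_solution\<close>. In the auxiliary system
  two successive operators \<open>B x h\<close> compose to zero, so its flatness is exactly the
  closedness of \<open>w\<close>.\<close>

lemma closed_one_form_exact:
  fixes w :: "'a::euclidean_space \<Rightarrow> 'a \<Rightarrow> 'c::euclidean_space"
  assumes S: "open S" and lin: "\<And>x. x \<in> S \<Longrightarrow> linear (w x)" and sm: "\<And>h. smooth_on S (\<lambda>x. w x h)"
    and closed: "\<And>x h v. x \<in> S \<Longrightarrow> D (\<lambda>x. w x h) x v = D (\<lambda>x. w x v) x h" and p: "p \<in> S"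
  obtains r f where "0 < r" "ball p r \<subseteq> S" "smooth_on (ball p r) f"
    "\<And>x. x \<in> ball p r \<Longrightarrow> (f has_derivative w x) (at x)"
proof -
  \<comment> \<open>the linear system \<open>df = s w\<close>, \<open>ds = 0\<close> with \<open>s = 1\<close> at \<open>p\<close>\<close>
  define B :: "'a \<Rightarrow> 'a \<Rightarrow> 'c \<times> real \<Rightarrow> 'c \<times> real" where "B x h u = (snd u *\<^sub>R w x h, 0)" for x h u
  have DB: "D (\<lambda>x. B x h u) x v = (snd u *\<^sub>R D (\<lambda>x. w x h) x v, 0)" if "x \<in> S" for x h u v
    unfolding B_def
    by (intro fun_cong[OF D_eqI] has_derivative_Pair has_derivative_scaleR_right has_derivative_const
        smooth_on_D(1)[OF sm that])
  interpret flat_linear_system S B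
  proof
    show "bilinear (B x)" if "x \<in> S" for x
      using lin[OF that] by (auto simp: bilinear_def B_def linear_iff algebra_simps)
    show "smooth_on S (\<lambda>x. B x h u)" for h u
      unfolding B_def by (intro smooth_intros S sm)
    show "D (\<lambda>x. B x h u) x v + B x h (B x v u) = D (\<lambda>x. B x v u) x h + B x v (B x h u)"
      if "x \<in> S" for x h v u
      using closed[OF that] by (simp add: DB[OF that]) (simp add: B_def)
  qed (rule S)
  obtain r where r: "0 < r" "ball p r \<subseteq> S" and
    ex: "\<And>y0. \<exists>y. y p = y0 \<and> smooth_on (ball p r) y \<and> (\<forall>x\<in>ball p r. (y has_derivative (\<lambda>h. B x h (y x))) (at x))"
    by (rule local_solution[OF p]) blast
  from ex[of "(0, 1)"] obtain y where y: "y p = (0, 1)" "smooth_on (ball p r) y"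
    "\<And>x. x \<in> ball p r \<Longrightarrow> (y has_derivative (\<lambda>h. B x h (y x))) (at x)" by blast
  have "((\<lambda>x. snd (y x)) has_derivative (\<lambda>h. 0)) (at x)" if "x \<in> ball p r" for x
    using has_derivative_snd[OF y(3)[OF that]] by (simp add: B_def)
  then have "snd (y x) = 1" if "x \<in> ball p r" for x
    using has_derivative_zero_unique_connected[of "ball p r" "\<lambda>x. snd (y x)" p x] y(1) r(1) that by simp
  then have "((\<lambda>x. fst (y x)) has_derivative w x) (at x)" if "x \<in> ball p r" for x
    using has_derivative_fst[OF y(3)[OF that]] that by (simp add: B_def)
  then show ?thesis
    using that[of r "\<lambda>x. fst (y x)"] r smooth_on_fst[OF open_ball y(2)] by blast
qed

section \<open>Eigenvectors\<close>

text \<open>Take a maximizer \<open>v\<close> of the quadratic form on the unit sphere of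
  \<open>V\<close>. Moving from \<open>v\<close> along the defect \<open>w\<close> would increase
  the normalized form to first order unless \<open>w = 0\<close>.\<close>

lemma self_adjoint_eigenvector:
  fixes S :: "'a::euclidean_space \<Rightarrow> 'a"
  assumes V: "subspace V" "V \<noteq> {0}" and S: "linear S" "S ` V \<subseteq> V"
    and adj: "\<And>u w. u \<in> V \<Longrightarrow> w \<in> V \<Longrightarrow> S u \<bullet> w = u \<bullet> S w"
  obtains v where "v \<in> V" "norm v = 1" "S v = (S v \<bullet> v) *\<^sub>R v"
proof -
  let ?K = "V \<inter> sphere 0 1"
  obtain u where "u \<in> V" "u \<noteq> 0" using V subspace_0 by fastforce
  then have "(1 / norm u) *\<^sub>R u \<in> ?K" using V(1) by (simp add: subspace_scale)
  then have "?K \<noteq> {}" by blast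
  moreover have "compact ?K" using closed_subspace[OF V(1)] compact_sphere by (simp add: closed_Int_compact)
  moreover have "continuous_on ?K (\<lambda>v. S v \<bullet> v)"
    using S(1) by (intro continuous_intros linear_continuous_on) (simp add: linear_conv_bounded_linear)
  ultimately obtain v where v: "v \<in> ?K" "\<And>u. u \<in> ?K \<Longrightarrow> S u \<bullet> u \<le> S v \<bullet> v"
    using continuous_attains_sup[of ?K "\<lambda>v. S v \<bullet> v"] by blast
  define c where "c = S v \<bullet> v"
  define w where "w = S v - c *\<^sub>R v"
  have vV: "v \<in> V" and nv: "v \<bullet> v = 1" using v(1) by (auto simp: norm_eq_1)
  have wV: "w \<in> V" using vV S(2) V(1) by (auto simp: w_def intro!: subspace_diff subspace_scale)
  have vw: "v \<bullet> w = 0" using nv by (simp add: w_def c_def inner_diff_right inner_commute)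
  have Sw: "S v \<bullet> w = w \<bullet> w" using vw by (simp add: w_def inner_diff_left inner_commute)
  have max: "S u \<bullet> u \<le> c * (u \<bullet> u)" if "u \<in> V" for u
  proof (cases "u = 0")
    case False
    have "(1 / norm u) *\<^sub>R u \<in> ?K" using V(1) that False by (simp add: subspace_scale)
    from v(2)[OF this] have "(S u \<bullet> u) / (norm u)\<^sup>2 \<le> c"
      by (simp add: linear_scale[OF S(1)] c_def power2_eq_square)
    then show ?thesis using False by (simp add: field_simps power2_norm_eq_inner)
  qed (use linear_0[OF S(1)] in simp)
  have t: "2 * t * (w \<bullet> w) \<le> t\<^sup>2 * (c * (w \<bullet> w) - S w \<bullet> w)" for t :: real
  proof -
    have "S w \<bullet> v = w \<bullet> w" using adj[OF wV vV] Sw by (simp add: inner_commute)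
    then have "S (v + t *\<^sub>R w) \<bullet> (v + t *\<^sub>R w) = c + 2 * t * (w \<bullet> w) + t\<^sup>2 * (S w \<bullet> w)"
      using Sw by (simp add: linear_add[OF S(1)] linear_scale[OF S(1)] inner_add_left inner_add_right
          c_def[symmetric] power2_eq_square distrib_left)
    moreover have "(v + t *\<^sub>R w) \<bullet> (v + t *\<^sub>R w) = 1 + t\<^sup>2 * (w \<bullet> w)"
      using nv vw by (simp add: inner_add_left inner_add_right inner_commute[of w v] power2_eq_square)
    moreover have "v + t *\<^sub>R w \<in> V" using vV wV V(1) by (intro subspace_add subspace_scale)
    ultimately show ?thesis using max[of "v + t *\<^sub>R w"] by (simp add: algebra_simps)
  qed
  have "w \<bullet> w \<le> 0"
  proof (rule ccontr)
    assume a: "\<not> w \<bullet> w \<le> 0"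
    \<comment> \<open>\<open>d\<close> bounds the quadratic coefficient and is positive thanks to
      the summand 1. At the \<open>s\<close> chosen next the quadratic bound is only half of the
      linear term, a contradiction.\<close>
    define d where "d = \<bar>c * (w \<bullet> w) - S w \<bullet> w\<bar> + 1"
    define s where "s = (w \<bullet> w) / d"
    have d: "d > 0" "c * (w \<bullet> w) - S w \<bullet> w \<le> d" by (auto simp: d_def)
    then have "s > 0" unfolding s_def by (intro divide_pos_pos) (use a in linarith)
    have "2 * s * (w \<bullet> w) \<le> s\<^sup>2 * d"
      by (rule order_trans[OF t[of s]]) (use d in \<open>auto intro!: mult_left_mono\<close>)
    also have "s\<^sup>2 * d = s * (w \<bullet> w)" using d by (simp add: s_def power2_eq_square)
    finally show False using \<open>s > 0\<close> a by simp
  qed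
  then have "w \<bullet> w = 0" using inner_ge_zero[of w] by linarith
  then have "w = 0" by simp
  then have "S v = (S v \<bullet> v) *\<^sub>R v" by (simp add: w_def c_def)
  then show ?thesis using that[of v] v(1) by simp
qed

text \<open>A non-zero invariant subspace of minimal dimension coincides with each of its eigenspaces.\<close>

lemma common_eigenvector:
  fixes F :: "('a::euclidean_space \<Rightarrow> 'a) set"
  assumes "subspace V" "V \<noteq> {0}" and lin: "\<And>S. S \<in> F \<Longrightarrow> linear S" and "\<And>S. S \<in> F \<Longrightarrow> S ` V \<subseteq> V"
    and "\<And>S u w. S \<in> F \<Longrightarrow> u \<in> V \<Longrightarrow> w \<in> V \<Longrightarrow> S u \<bullet> w = u \<bullet> S w"
    and "\<And>S T u. S \<in> F \<Longrightarrow> T \<in> F \<Longrightarrow> u \<in> V \<Longrightarrow> S (T u) = T (S u)"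
  shows "\<exists>v\<in>V. norm v = 1 \<and> (\<forall>S\<in>F. \<exists>c. S v = c *\<^sub>R v)"
  using assms(1,2,4,5,6)
proof (induction "dim V" arbitrary: V rule: less_induct)
  case less
  show ?case
  proof (cases "\<forall>S\<in>F. \<exists>c. \<forall>v\<in>V. S v = c *\<^sub>R v")
    case True
    obtain u where "u \<in> V" "u \<noteq> 0" using less.prems(1,2) subspace_0 by fastforce
    then have "(1 / norm u) *\<^sub>R u \<in> V" "norm ((1 / norm u) *\<^sub>R u) = 1"
      using less.prems(1) by (auto simp: subspace_scale)
    then show ?thesis using True by blast
  next
    case False
    then obtain S where S: "S \<in> F" "\<And>c. \<exists>v\<in>V. S v \<noteq> c *\<^sub>R v" by blast
    obtain v where v: "v \<in> V" "norm v = 1" "S v = (S v \<bullet> v) *\<^sub>R v"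
      using self_adjoint_eigenvector[OF less.prems(1,2) lin[OF S(1)] less.prems(3)[OF S(1)] less.prems(4)[OF S(1)]]
      by blast
    define c where "c = S v \<bullet> v"
    define V' where "V' = {u \<in> V. S u = c *\<^sub>R u}"
    have V': "subspace V'"
      using less.prems(1) lin[OF S(1)]
      by (auto simp: subspace_def V'_def linear_0 linear_add linear_scale scaleR_add_right)
    obtain v' where "v' \<in> V" "S v' \<noteq> c *\<^sub>R v'" using S(2) by blast
    then have "v' \<notin> V'" "V' \<subseteq> V" by (auto simp: V'_def)
    then have "V' \<subset> V" using \<open>v' \<in> V\<close> by blast
    then have "dim V' < dim V"
      by (intro dim_psubset) (simp only: span_eq_iff[THEN iffD2, OF V'] span_eq_iff[THEN iffD2, OF less.prems(1)])
    moreover have "v \<in> V'" using v(1,3) by (simp only: V'_def c_def mem_Collect_eq simp_thms)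
    then have "V' \<noteq> {0}" using v(2) by auto
    moreover have "T ` V' \<subseteq> V'" if "T \<in> F" for T
      using less.prems(3)[OF that] less.prems(5)[OF S(1) that] linear_scale[OF lin[OF that]]
      by (auto simp: V'_def)
    ultimately have "\<exists>v\<in>V'. norm v = 1 \<and> (\<forall>S\<in>F. \<exists>c. S v = c *\<^sub>R v)"
      using V' subsetD[OF psubset_imp_subset[OF \<open>V' \<subset> V\<close>]] less.prems(4,5)
      by (intro less.hyps) simp_all
    then show ?thesis using \<open>V' \<subset> V\<close> by blast
  qed
qed

text \<open>Splits off one common unit eigenvector; by self-adjointness its orthogonal complement in
  \<open>V\<close> is again invariant, and has smaller dimension.\<close>

lemma common_orthonormal_eigenbasis:
  fixes F :: "('a::euclidean_space \<Rightarrow> 'a) set"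
  assumes "subspace V" and lin: "\<And>S. S \<in> F \<Longrightarrow> linear S" and "\<And>S. S \<in> F \<Longrightarrow> S ` V \<subseteq> V"
    and "\<And>S u w. S \<in> F \<Longrightarrow> u \<in> V \<Longrightarrow> w \<in> V \<Longrightarrow> S u \<bullet> w = u \<bullet> S w"
    and "\<And>S T u. S \<in> F \<Longrightarrow> T \<in> F \<Longrightarrow> u \<in> V \<Longrightarrow> S (T u) = T (S u)"
  shows "\<exists>B\<subseteq>V. pairwise orthogonal B \<and> (\<forall>v\<in>B. norm v = 1) \<and> span B = V \<and> (\<forall>v\<in>B. \<forall>S\<in>F. \<exists>c. S v = c *\<^sub>R v)"
  using assms(1,3,4,5)
proof (induction "dim V" arbitrary: V rule: less_induct)
  case less
  show ?case
  proof (cases "V = {0}")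
    case True
    then show ?thesis by (intro exI[of _ "{}"]) auto
  next
    case False
    have "\<exists>v\<in>V. norm v = 1 \<and> (\<forall>S\<in>F. \<exists>c. S v = c *\<^sub>R v)"
      by (rule common_eigenvector[OF less.prems(1) False]) (fact lin less.prems)+
    then obtain v where v: "v \<in> V" "norm v = 1" "\<And>S. S \<in> F \<Longrightarrow> \<exists>c. S v = c *\<^sub>R v"
      by blast
    define V' where "V' = {u \<in> V. v \<bullet> u = 0}"
    have V': "subspace V'"
      using less.prems(1) by (auto simp: subspace_def V'_def inner_add_right)
    have "v \<notin> V'" using v by (auto simp: V'_def)
    moreover have "V' \<subseteq> V" by (auto simp: V'_def)
    ultimately have "V' \<subset> V" using v(1) by blast
    then have "dim V' < dim V"
      by (intro dim_psubset) (simp only: span_eq_iff[THEN iffD2, OF V'] span_eq_iff[THEN iffD2, OF less.prems(1)])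
    moreover have "S ` V' \<subseteq> V'" if S: "S \<in> F" for S
    proof -
      obtain c where "S v = c *\<^sub>R v" using v(3)[OF S] by blast
      then have "v \<bullet> S u = 0" if "u \<in> V'" for u
        using less.prems(3)[OF S v(1), of u] that by (auto simp: V'_def)
      then show ?thesis using less.prems(2)[OF S] by (auto simp: V'_def)
    qed
    ultimately have "\<exists>B\<subseteq>V'. pairwise orthogonal B \<and> (\<forall>v\<in>B. norm v = 1) \<and> span B = V' \<and>
        (\<forall>v\<in>B. \<forall>S\<in>F. \<exists>c. S v = c *\<^sub>R v)"
      using V' subsetD[OF psubset_imp_subset[OF \<open>V' \<subset> V\<close>]] less.prems(3,4)
      by (intro less.hyps) simp_all
    then obtain B where B: "B \<subseteq> V'" "pairwise orthogonal B" "\<And>v. v \<in> B \<Longrightarrow> norm v = 1" "span B = V'"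
      "\<And>v S. v \<in> B \<Longrightarrow> S \<in> F \<Longrightarrow> \<exists>c. S v = c *\<^sub>R v" by blast
    have "span (insert v B) = V"
    proof
      show "span (insert v B) \<subseteq> V"
        using B(1) v(1) \<open>V' \<subset> V\<close> less.prems(1) by (intro span_minimal) auto
      show "V \<subseteq> span (insert v B)"
      proof
        fix u assume "u \<in> V"
        then have "u - (v \<bullet> u) *\<^sub>R v \<in> V'"
          using v less.prems(1) by (simp add: V'_def subspace_diff subspace_scale inner_diff_right dot_square_norm)
        then show "u \<in> span (insert v B)" unfolding span_insert using B(4) by blast
      qed
    qed
    moreover have "pairwise orthogonal (insert v B)"
      using B(1,2) by (auto simp: pairwise_insert orthogonal_def V'_def inner_commute)
    ultimately show ?thesis
      using B v \<open>V' \<subset> V\<close> by (intro exI[of _ "insert v B"]) auto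
  qed
qed

text \<open>The inverse function theorem applies to \<open>(u, s, x) \<mapsto> (M(x) u - s u, u \<bullet> E, x)\<close>.\<close>

lemma smooth_simple_eigenvector:
  fixes M :: "'p::euclidean_space \<Rightarrow> 'a::euclidean_space \<Rightarrow> 'a"
  assumes U: "open U" "p \<in> U" and lin: "\<And>x. x \<in> U \<Longrightarrow> linear (M x)" and sm: "\<And>w. smooth_on U (\<lambda>x. M x w)"
    and E: "E \<noteq> 0" "M p E = \<mu> *\<^sub>R E"
    and simple: "\<And>u s. M p u - \<mu> *\<^sub>R u = s *\<^sub>R E \<Longrightarrow> u \<bullet> E = 0 \<Longrightarrow> u = 0"
  obtains r u s where "0 < r" "ball p r \<subseteq> U" "smooth_on (ball p r) u" "smooth_on (ball p r) s"
    "u p = E" "s p = \<mu>" "\<And>x. x \<in> ball p r \<Longrightarrow> M x (u x) = s x *\<^sub>R u x"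
proof -
  define \<Phi> :: "('a \<times> real) \<times> 'p \<Rightarrow> ('a \<times> real) \<times> 'p" where
    "\<Phi> z = ((M (snd z) (fst (fst z)) - snd (fst z) *\<^sub>R fst (fst z), fst (fst z) \<bullet> E), snd z)" for z
  define z0 where "z0 = ((E, \<mu>), p)"
  define S where "S = (UNIV :: ('a \<times> real) set) \<times> U"
  have S: "open S" "z0 \<in> S" using U by (auto simp: S_def z0_def open_Times)
  \<comment> \<open>\<open>M\<close> is known to be smooth only on fixed vectors, but here the
    vector is itself a variable.\<close>
  have "smooth_on S (\<lambda>z. \<Sum>b\<in>Basis. (fst (fst z) \<bullet> b) *\<^sub>R M (snd z) b)"
    by (intro smooth_intros S(1) smooth_on_compose[OF sm] U(1)) (auto simp: S_def)
  then have smM: "smooth_on S (\<lambda>z. M (snd z) (fst (fst z)))"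
    by (rule smooth_on_cong[OF _ S(1)]) (auto simp: S_def simp flip: linear_Basis_sum[OF lin])
  have sm\<Phi>: "smooth_on S \<Phi>"
    unfolding \<Phi>_def[abs_def] by (intro smooth_intros S(1) smM)
  \<comment> \<open>The parameter component of the differential forces \<open>snd k = 0\<close>.
    What remains is \<open>M p u - \<mu> u = s E\<close> with \<open>u\<close> orthogonal to
    \<open>E\<close>, the very form in which simplicity is assumed.\<close>
  have inj: "inj (D \<Phi> z0)"
    unfolding linear_injective_0[OF smooth_on_linear_D[OF sm\<Phi> S(2)]]
  proof (intro allI impI)
    fix k assume k: "D \<Phi> z0 k = 0"
    have "((\<lambda>z. snd (\<Phi> z)) has_derivative (\<lambda>k. snd (D \<Phi> z0 k))) (at z0)"
      by (rule has_derivative_snd[OF smooth_on_D(1)[OF sm\<Phi> S(2)]])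
    moreover have "((\<lambda>z. snd (\<Phi> z)) has_derivative snd) (at z0)"
      unfolding \<Phi>_def by (auto intro!: derivative_eq_intros)
    ultimately have "snd k = snd (D \<Phi> z0 k)"
      by (metis has_derivative_unique)
    with k have k2: "snd k = 0" by simp
    obtain u s where us: "k = ((u, s), 0)" using k2 by (metis prod.collapse)
    \<comment> \<open>Along this line the parameter stays at \<open>p\<close>, so the differential
      is read off from a polynomial in \<open>t\<close>.\<close>
    have "((\<lambda>t. \<Phi> (z0 + t *\<^sub>R k)) has_vector_derivative D \<Phi> z0 k) (at 0)"
      using has_vector_derivative_along_line[of \<Phi> "D \<Phi> z0" z0 0 k] smooth_on_D(1)[OF sm\<Phi> S(2)] by simp
    moreover have "\<Phi> (z0 + t *\<^sub>R k) = ((M p E + t *\<^sub>R M p u - (\<mu> + t * s) *\<^sub>R (E + t *\<^sub>R u), E \<bullet> E + t * (u \<bullet> E)), p)" for t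
      using lin[OF U(2)] by (simp add: \<Phi>_def z0_def us linear_add linear_scale inner_add_left)
    moreover have "((\<lambda>t. ((M p E + t *\<^sub>R M p u - (\<mu> + t * s) *\<^sub>R (E + t *\<^sub>R u), E \<bullet> E + t * (u \<bullet> E)), p))
        has_vector_derivative ((M p u - (\<mu> *\<^sub>R u + s *\<^sub>R E), u \<bullet> E), 0)) (at 0)"
      unfolding has_vector_derivative_def by (auto intro!: derivative_eq_intros simp: algebra_simps)
    ultimately have "D \<Phi> z0 k = ((M p u - (\<mu> *\<^sub>R u + s *\<^sub>R E), u \<bullet> E), 0)"
      using vector_derivative_unique_at by fastforce
    with k have eq: "M p u - \<mu> *\<^sub>R u = s *\<^sub>R E" "u \<bullet> E = 0" by (auto simp: algebra_simps zero_prod_def)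
    then have "u = 0" by (rule simple)
    with eq(1) E(1) linear_0[OF lin[OF U(2)]] show "k = 0" by (simp add: us zero_prod_def)
  qed
  have \<Phi>z0: "\<Phi> z0 = ((0, E \<bullet> E), p)" using E(2) by (simp add: \<Phi>_def z0_def)
  obtain r g where rg: "0 < r" "smooth_on (ball (\<Phi> z0) r) g" "g ` ball (\<Phi> z0) r \<subseteq> S" "g (\<Phi> z0) = z0"
    "\<And>y. y \<in> ball (\<Phi> z0) r \<Longrightarrow> \<Phi> (g y) = y"
    by (rule smooth_inverse_function[OF S(1) sm\<Phi> S(2) inj]) blast
  \<comment> \<open>On this slice of values the first component 0 is the eigenvalue equation, and
    \<open>E \<bullet> E\<close> fixes the component of the eigenvector along
    \<open>E\<close>.\<close>
  define G where "G x = g ((0, E \<bullet> E), x)" for x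
  have mem: "((0, E \<bullet> E), x) \<in> ball (\<Phi> z0) r" if "x \<in> ball p r" for x
    using that by (simp add: \<Phi>z0 dist_Pair_Pair)
  have smG: "smooth_on (ball p r) G"
    unfolding G_def by (rule smooth_on_compose[OF rg(2)]) (use mem in \<open>auto intro!: smooth_intros\<close>)
  have \<Phi>G: "\<Phi> (G x) = ((0, E \<bullet> E), x)" if "x \<in> ball p r" for x
    unfolding G_def by (rule rg(5)[OF mem[OF that]])
  have sndG: "snd (G x) = x" if "x \<in> ball p r" for x
    using \<Phi>G[OF that] by (simp add: \<Phi>_def)
  have "ball p r \<subseteq> U"
  proof
    fix x assume x: "x \<in> ball p r"
    then have "G x \<in> S" using rg(3) mem[OF x] by (auto simp: G_def)
    then show "x \<in> U" using sndG[OF x] by (auto simp: S_def)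
  qed
  moreover have "M x (fst (fst (G x))) = snd (fst (G x)) *\<^sub>R fst (fst (G x))" if "x \<in> ball p r" for x
    using \<Phi>G[OF that] sndG[OF that] by (simp add: \<Phi>_def)
  moreover have "G p = z0" using rg(4) by (simp add: G_def \<Phi>z0)
  moreover have "smooth_on (ball p r) (\<lambda>x. fst (fst (G x)))" "smooth_on (ball p r) (\<lambda>x. snd (fst (G x)))"
    by (intro smooth_intros open_ball smG)+
  ultimately show ?thesis
    using that[of r "\<lambda>x. fst (fst (G x))" "\<lambda>x. snd (fst (G x))"] rg(1) by (simp add: z0_def)
qed

section \<open>Adapted frames\<close>

lemma sum_UNIV_Plus:
  fixes f :: "'a::finite + 'b::finite \<Rightarrow> 'c::comm_monoid_add"
  shows "(\<Sum>c\<in>UNIV. f c) = (\<Sum>j\<in>UNIV. f (Inl j)) + (\<Sum>i\<in>UNIV. f (Inr i))"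
  unfolding UNIV_Plus_UNIV[symmetric] by (simp add: sum.Plus del: UNIV_Plus_UNIV)

lemma sum_mult_axis_axis:
  fixes g :: "'n::finite \<Rightarrow> real"
  shows "(\<Sum>p\<in>UNIV. g p * axis i 1 $ p * axis k 1 $ p) = (if i = k then g i else 0)"
proof -
  have "g p * axis i 1 $ p * axis k 1 $ p = (if p = i then (if i = k then g i else 0) else 0)" for p
    by (auto simp: axis_def)
  then show ?thesis by simp
qed

lemma D_inner:
  "(f has_derivative D f x) (at x) \<Longrightarrow> (g has_derivative D g x) (at x) \<Longrightarrow>
    D (\<lambda>x. f x \<bullet> g x) x v = f x \<bullet> D g x v + D f x v \<bullet> g x"
  by (rule fun_cong[OF D_eqI[OF has_derivative_inner]])

text \<open>The source of the skew-symmetries below: a constant inner product lets the derivative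
  change sides at the cost of a sign.\<close>

lemma D_inner_const:
  assumes "open S" "x \<in> S" "smooth_on S f" "smooth_on S g" "\<And>y. y \<in> S \<Longrightarrow> f y \<bullet> g y = c"
  shows "D f x u \<bullet> g x = - (f x \<bullet> D g x u)"
proof -
  have "D (\<lambda>y. f y \<bullet> g y) x u = 0"
    using D_cong_open[OF assms(1,2,5)] by simp
  then show ?thesis
    using D_inner[OF smooth_on_D(1)[OF assms(3,2)] smooth_on_D(1)[OF assms(4,2)], of u] by simp
qed

lemma D_scaleR:
  "(a has_derivative D a x) (at x) \<Longrightarrow> (f has_derivative D f x) (at x) \<Longrightarrow>
    D (\<lambda>x. a x *\<^sub>R f x) x v = a x *\<^sub>R D f x v + D a x v *\<^sub>R f x"
  by (rule fun_cong[OF D_eqI[OF has_derivative_scaleR]])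

lemma linear_axis_sum:
  fixes L :: "real^'n::finite \<Rightarrow> 'b::real_vector"
  assumes "linear L" shows "L u = (\<Sum>i\<in>UNIV. u $ i *\<^sub>R L (axis i 1))"
proof -
  have "u = (\<Sum>i\<in>UNIV. u $ i *\<^sub>R axis i 1)"
    by (simp add: vec_eq_iff axis_def if_distrib cong: if_cong)
  then have "L u = L (\<Sum>i\<in>UNIV. u $ i *\<^sub>R axis i 1)" by simp
  then show ?thesis using assms by (simp add: linear_sum linear_scale)
qed

lemma C_mat_mult:
  fixes A :: "'a::comm_ring_1^'n::finite^'m::finite" and B :: "'a^'m^'n"
  shows "(A ** C_mat i) $ j $ l = (if l = i then A $ j $ i else 0)"
    and "(C_mat i ** B) $ k $ j = (if k = i then B $ i $ j else 0)"
  by (auto simp: matrix_matrix_mult_def C_mat_def if_distrib if_distribR cong: if_cong)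

lemma block_matrix_nth [simp]:
  "block_matrix P Q R S $ Inl j $ Inl k = P $ j $ k"
  "block_matrix P Q R S $ Inl j $ Inr l = Q $ j $ l"
  "block_matrix P Q R S $ Inr i $ Inl k = R $ i $ k"
  "block_matrix P Q R S $ Inr i $ Inr l = S $ i $ l"
  by (simp_all add: block_matrix_def)

lemma lax_I_nth:
  fixes A :: "real^'n::finite^'m::finite"
  shows "lax_I A F 1 i $ Inl j $ Inl k = 0"
    "lax_I A F 1 i $ Inl j $ Inr l = (if l = i then - A $ j $ i else 0)"
    "lax_I A F 1 i $ Inr p $ Inl k = (if p = i then A $ k $ i else 0)"
    "lax_I A F 1 i $ Inr p $ Inr l = (if p = i then F $ i $ l else 0) - (if l = i then F $ i $ p else 0)"
  by (auto simp: lax_I_def C_mat_mult transpose_def)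

lemma matrix_inv_left:
  fixes A :: "'a::semiring_1^'n::finite^'n"
  assumes "invertible A" shows "matrix_inv A ** A = mat 1"
  using someI_ex[OF assms[unfolded invertible_def]] unfolding matrix_inv_def by blast

text \<open>Gathers what parts (ii) and (iv) use of adapted coordinates. \<open>D\<epsilon>0\<close>
  is the Weingarten equation of a parallel frame, supplied by \<open>adapted_coords_chart\<close>;
  the signs of \<open>b\<close> are left free.\<close>

locale adapted_chart =
  fixes W :: "(real^'n::finite) set" and Y :: "real^'n \<Rightarrow> real^('m::finite + 'n)"
    and \<epsilon> :: "'m \<Rightarrow> real^'n \<Rightarrow> real^('m + 'n)" and A :: "real^'n \<Rightarrow> real^'n^'m" and b :: "real^'n \<Rightarrow> real^'n"
  assumes W: "open W" and smY: "smooth_on W Y" and sm\<epsilon>: "\<And>j. smooth_on W (\<epsilon> j)"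
    and smA: "smooth_on W A" and smb: "smooth_on W b"
    and b0: "\<And>x i. x \<in> W \<Longrightarrow> b x $ i \<noteq> 0"
    and AtA: "\<And>x. x \<in> W \<Longrightarrow> transpose (A x) ** A x = mat 1"
    and \<epsilon>\<epsilon>: "\<And>x j l. x \<in> W \<Longrightarrow> \<epsilon> j x \<bullet> \<epsilon> l x = (if j = l then 1 else 0)"
    and DY\<epsilon>: "\<And>x u j. x \<in> W \<Longrightarrow> D Y x u \<bullet> \<epsilon> j x = 0"
    and DYDY: "\<And>x u w. x \<in> W \<Longrightarrow> D Y x u \<bullet> D Y x w = (\<Sum>i\<in>UNIV. (b x $ i)\<^sup>2 * u $ i * w $ i)"
    and D\<epsilon>0: "\<And>x j u. x \<in> W \<Longrightarrow> D (\<epsilon> j) x u = (\<Sum>i\<in>UNIV. (u $ i * A x $ j $ i) *\<^sub>R ((1 / b x $ i) *\<^sub>R partial Y i x))"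
begin

definition E :: "'n \<Rightarrow> real^'n \<Rightarrow> real^('m + 'n)" where "E i x = (1 / b x $ i) *\<^sub>R partial Y i x"

lemma D\<epsilon>: "x \<in> W \<Longrightarrow> D (\<epsilon> j) x u = (\<Sum>i\<in>UNIV. (u $ i * A x $ j $ i) *\<^sub>R E i x)"
  by (simp add: D\<epsilon>0 E_def)

lemma smE: "smooth_on W (E i)"
  unfolding E_def partial_def
  by (intro smooth_intros W smb smooth_on_D(2)[OF smY] b0)

lemma EE: "x \<in> W \<Longrightarrow> E i x \<bullet> E k x = (if i = k then 1 else 0)"
  using b0 by (simp add: E_def partial_def DYDY sum_mult_axis_axis power2_eq_square)

lemma E\<epsilon>: "x \<in> W \<Longrightarrow> E i x \<bullet> \<epsilon> j x = 0"
  by (simp add: E_def partial_def DY\<epsilon>)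

lemma \<epsilon>E: "x \<in> W \<Longrightarrow> \<epsilon> j x \<bullet> E i x = 0"
  using E\<epsilon> by (metis inner_commute)

lemma DY: "x \<in> W \<Longrightarrow> D Y x u = (\<Sum>i\<in>UNIV. (u $ i * b x $ i) *\<^sub>R E i x)"
  using b0 linear_axis_sum[OF smooth_on_linear_D[OF smY], of x u] by (simp add: E_def partial_def)

lemma partial_Y: "x \<in> W \<Longrightarrow> partial Y i x = b x $ i *\<^sub>R E i x"
  using b0 by (simp add: E_def)

lemma partial_\<epsilon>: "x \<in> W \<Longrightarrow> partial (\<epsilon> j) i x = A x $ j $ i *\<^sub>R E i x"
  by (simp add: partial_def D\<epsilon> axis_def if_distrib if_distribR cong: if_cong)

lemma sum_A_A: "x \<in> W \<Longrightarrow> (\<Sum>j\<in>UNIV. A x $ j $ i * A x $ j $ k) = (if i = k then 1 else 0)"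
  using AtA[of x] by (simp add: matrix_matrix_mult_def transpose_def mat_def vec_eq_iff)

abbreviation frame :: "real^'n \<Rightarrow> real^('m + 'n)^('m + 'n)" where "frame \<equiv> adapted_frame Y \<epsilon> b"

lemma frame_nth [simp]: "frame x $ r $ Inl j = \<epsilon> j x $ r" "frame x $ r $ Inr i = E i x $ r"
  by (simp_all add: adapted_frame_def E_def)

lemma frame_orthogonal: "x \<in> W \<Longrightarrow> transpose (frame x) ** frame x = mat 1"
  and frame_orthogonal': "x \<in> W \<Longrightarrow> frame x ** transpose (frame x) = mat 1"
proof -
  have "(\<Sum>r\<in>UNIV. frame x $ r $ c * frame x $ r $ d) = (if c = d then 1 else 0)" if "x \<in> W" for c d
    by (cases c; cases d) (simp_all add: that EE[OF that] \<epsilon>\<epsilon>[OF that] E\<epsilon>[OF that] \<epsilon>E[OF that] flip: inner_vec_def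
        inner_real_def)
  then show "x \<in> W \<Longrightarrow> transpose (frame x) ** frame x = mat 1"
    by (simp add: vec_eq_iff matrix_matrix_mult_def transpose_def mat_def)
  then show "x \<in> W \<Longrightarrow> frame x ** transpose (frame x) = mat 1"
    using matrix_left_right_inverse by blast
qed

lemma frame_expand:
  assumes "x \<in> W"
  shows "v = (\<Sum>j\<in>UNIV. (v \<bullet> \<epsilon> j x) *\<^sub>R \<epsilon> j x) + (\<Sum>i\<in>UNIV. (v \<bullet> E i x) *\<^sub>R E i x)"
proof -
  have "v = (frame x ** transpose (frame x)) *v v"
    by (simp add: frame_orthogonal'[OF assms] matrix_vector_mul_lid)
  also have "\<dots> = frame x *v (transpose (frame x) *v v)"
    by (rule matrix_vector_mul_assoc[symmetric])
  also have "\<dots> = (\<Sum>c\<in>UNIV. (\<Sum>r\<in>UNIV. frame x $ r $ c * v $ r) *\<^sub>R (\<chi> r. frame x $ r $ c))"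
    by (simp add: vec_eq_iff matrix_vector_mult_def transpose_def mult.commute del: transpose_matrix_vector)
  also have "\<dots> = (\<Sum>j\<in>UNIV. (v \<bullet> \<epsilon> j x) *\<^sub>R \<epsilon> j x) + (\<Sum>i\<in>UNIV. (v \<bullet> E i x) *\<^sub>R E i x)"
    by (simp add: sum_UNIV_Plus inner_vec_def mult.commute)
  finally show ?thesis .
qed

lemma frame_eqI:
  assumes "x \<in> W" "\<And>j. v \<bullet> \<epsilon> j x = w \<bullet> \<epsilon> j x" "\<And>i. v \<bullet> E i x = w \<bullet> E i x"
  shows "v = w"
  using frame_expand[OF assms(1), of v] frame_expand[OF assms(1), of w] assms(2,3) by simp

lemma frame_inner:
  assumes "x \<in> W"
  shows "v \<bullet> w = (\<Sum>j\<in>UNIV. (v \<bullet> \<epsilon> j x) * (w \<bullet> \<epsilon> j x)) + (\<Sum>i\<in>UNIV. (v \<bullet> E i x) * (w \<bullet> E i x))"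
proof -
  have "v \<bullet> w = v \<bullet> ((\<Sum>j\<in>UNIV. (w \<bullet> \<epsilon> j x) *\<^sub>R \<epsilon> j x) + (\<Sum>i\<in>UNIV. (w \<bullet> E i x) *\<^sub>R E i x))"
    using frame_expand[OF assms, of w] by simp
  then show ?thesis by (simp add: inner_add_right inner_sum_right mult.commute)
qed

lemma partial_commute:
  fixes f :: "real^'n \<Rightarrow> 'c::euclidean_space"
  assumes "x \<in> W" "smooth_on W f"
  shows "partial (partial f i) k x = partial (partial f k) i x"
  using smooth_on_D_commute[OF W assms(2,1)] by (simp add: partial_def[abs_def])

lemma partial_cong: "x \<in> W \<Longrightarrow> (\<And>y. y \<in> W \<Longrightarrow> f y = g y) \<Longrightarrow> partial f i x = partial g i x"
  unfolding partial_def using D_cong_open[OF W] by metis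

lemma partial_scaleR:
  "x \<in> W \<Longrightarrow> smooth_on W a \<Longrightarrow> smooth_on W f \<Longrightarrow>
    partial (\<lambda>y. a y *\<^sub>R f y) i x = a x *\<^sub>R partial f i x + partial a i x *\<^sub>R f x"
  unfolding partial_def by (intro D_scaleR smooth_on_D(1))

lemma partial_inner:
  "x \<in> W \<Longrightarrow> smooth_on W f \<Longrightarrow> smooth_on W g \<Longrightarrow>
    partial (\<lambda>y. f y \<bullet> g y) i x = f x \<bullet> partial g i x + partial f i x \<bullet> g x"
  unfolding partial_def by (intro D_inner smooth_on_D(1))

text \<open>Differentiating \<open>E l \<bullet> \<epsilon> j = 0\<close> moves the derivative onto
  \<open>\<epsilon> j\<close>, where the Weingarten equation evaluates it.\<close>

lemma partial_E_\<epsilon>: "x \<in> W \<Longrightarrow> partial (E l) i x \<bullet> \<epsilon> j x = - (if i = l then A x $ j $ l else 0)"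
  unfolding partial_def
  by (subst D_inner_const[OF W _ smE sm\<epsilon> E\<epsilon>]) (auto simp: EE partial_\<epsilon>[unfolded partial_def])

text \<open>Connection coefficients of the tangent frame: field \<open>l\<close>, direction
  \<open>i\<close>, component \<open>k\<close>. Skewness and \<open>c_sym\<close> determine them, as
  in the uniqueness proof for the Levi-Civita connection.\<close>

definition c :: "real^'n \<Rightarrow> 'n \<Rightarrow> 'n \<Rightarrow> 'n \<Rightarrow> real" where "c x l i k = partial (E l) i x \<bullet> E k x"

lemma c_skew: "x \<in> W \<Longrightarrow> c x l i k = - c x k i l"
  unfolding c_def partial_def
  by (subst D_inner_const[OF W _ smE smE EE]) (auto simp: inner_commute)

text \<open>Each side is the \<open>E k\<close> component of a mixed second derivative of
  \<open>Y\<close>, since the \<open>i\<close>-th partial derivative of \<open>Y\<close> is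
  \<open>b_i E_i\<close>.\<close>

lemma c_sym:
  assumes x: "x \<in> W"
  shows "partial (\<lambda>y. b y $ i) j x * (if i = k then 1 else 0) + b x $ i * c x i j k
    = partial (\<lambda>y. b y $ j) i x * (if j = k then 1 else 0) + b x $ j * c x j i k"
proof -
  have "partial (partial Y i) j x = b x $ i *\<^sub>R partial (E i) j x + partial (\<lambda>y. b y $ i) j x *\<^sub>R E i x" for i j
    by (subst partial_cong[OF x partial_Y]) (auto intro!: partial_scaleR x smooth_intros W smb smE)
  then have "(b x $ i *\<^sub>R partial (E i) j x + partial (\<lambda>y. b y $ i) j x *\<^sub>R E i x) \<bullet> E k x
    = (b x $ j *\<^sub>R partial (E j) i x + partial (\<lambda>y. b y $ j) i x *\<^sub>R E j x) \<bullet> E k x"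
    using partial_commute[OF x smY, of i j] by simp
  then show ?thesis by (simp add: inner_add_left EE[OF x] c_def algebra_simps split: if_splits)
qed

abbreviation F :: "real^'n \<Rightarrow> real^'n^'n" where "F \<equiv> F_of b"

lemma F_diag [simp]: "F x $ i $ i = 0"
  by (simp add: F_of_def)

text \<open>Take \<open>k = i\<close> in \<open>c_sym\<close>: the coefficient
  \<open>c x i j i\<close> vanishes by skewness, and division by \<open>b x $ j\<close> leaves the
  entry of \<open>F\<close>.\<close>

lemma c_F: assumes x: "x \<in> W" and "i \<noteq> j" shows "c x j i i = F x $ i $ j"
  using c_sym[OF x, of i j i] c_skew[OF x, of i j i] assms b0[OF x, of j] by (simp add: F_of_def)

text \<open>\<open>b\<^sub>i c\<^sub>i\<^sub>j\<^sub>k\<close> is symmetric in \<open>i, j\<close> and \<open>c\<close> is skew in its outer indices; going round the cycle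
  changes the sign.\<close>

lemma c_distinct:
  assumes x: "x \<in> W" and "i \<noteq> j" "j \<noteq> k" "i \<noteq> k" shows "c x i j k = 0"
proof -
  have "b x $ i * c x i j k = - b x $ j * c x k i j" "b x $ k * c x k i j = - b x $ i * c x j k i"
    "b x $ j * c x j k i = - b x $ k * c x i j k"
    using c_sym[OF x, of i j k] c_sym[OF x, of k i j] c_sym[OF x, of j k i] assms
      c_skew[OF x, of j i k] c_skew[OF x, of i k j] c_skew[OF x, of k j i] by auto
  then have "b x $ i * b x $ k * c x i j k = 0" by algebra
  then show ?thesis using b0[OF x] by simp
qed

lemma partial_E_E:
  "x \<in> W \<Longrightarrow> partial (E l) i x \<bullet> E k x = (if i = k then F x $ i $ l else 0) - (if i = l then F x $ l $ k else 0)"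
  using c_skew[of x l i l] c_F[of x i l] c_distinct[of x l i k] c_skew[of x l l k] c_F[of x l k]
  unfolding c_def[symmetric] by (cases "i = l"; cases "i = k"; cases "k = l") auto

lemma partial_E:
  assumes x: "x \<in> W"
  shows "partial (E l) i x = F x $ i $ l *\<^sub>R E i x -
    (if i = l then (\<Sum>j\<in>UNIV. A x $ j $ l *\<^sub>R \<epsilon> j x) + (\<Sum>k\<in>UNIV. F x $ l $ k *\<^sub>R E k x) else 0)"
  by (rule frame_eqI[OF x])
    (auto simp: partial_E_\<epsilon>[OF x] partial_E_E[OF x] inner_diff_left inner_add_left inner_sum_left
      EE[OF x] \<epsilon>\<epsilon>[OF x] E\<epsilon>[OF x] \<epsilon>E[OF x] if_distrib cong: if_cong)

lemma smA_nth: "smooth_on W (\<lambda>y. A y $ j $ i)"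
  by (intro smooth_intros W smA)

lemma smF: "smooth_on W F"
  unfolding F_of_def[abs_def]
proof (intro smooth_on_vec W)
  fix i j show "smooth_on W (\<lambda>x. if i = j then 0 else partial (\<lambda>y. b y $ i) j x / b x $ j)"
    unfolding partial_def
    by (cases "i = j") (auto intro!: smooth_intros W b0 smb smooth_on_D(2))
qed

lemma smF_nth: "smooth_on W (\<lambda>y. F y $ i $ j)"
  by (intro smooth_intros W smF)

theorem G_system: "G_system_I W A F"
  unfolding G_system_I_def
proof (intro conjI ballI allI impI smA smF AtA F_diag)
  \<comment> \<open>Codazzi: the mixed second derivatives of \<open>\<epsilon> i\<close>, compared
    in their \<open>E j\<close> component.\<close>
  fix x i j k assume x: "x \<in> W" and "k \<noteq> (j::'n)"
  have "partial (partial (\<epsilon> i) j) k x = A x $ i $ j *\<^sub>R partial (E j) k x + partial (\<lambda>y. A y $ i $ j) k x *\<^sub>R E j x" for j k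
    by (subst partial_cong[OF x partial_\<epsilon>]) (auto intro!: partial_scaleR x smA_nth smE)
  then have "(A x $ i $ j *\<^sub>R partial (E j) k x + partial (\<lambda>y. A y $ i $ j) k x *\<^sub>R E j x) \<bullet> E j x
    = (A x $ i $ k *\<^sub>R partial (E k) j x + partial (\<lambda>y. A y $ i $ k) j x *\<^sub>R E k x) \<bullet> E j x"
    using partial_commute[OF x sm\<epsilon>, of i j k] by simp
  then show "partial (\<lambda>y. A y $ i $ j) k x = F x $ j $ k * A x $ i $ k"
    using \<open>k \<noteq> j\<close> by (simp add: inner_add_left EE[OF x] partial_E_E[OF x])
next
  fix x and i j :: 'n assume x: "x \<in> W" and "i \<noteq> j"
  note smpE = smooth_on_D(2)[OF smE, of _ "axis i 1", folded partial_def]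
  \<comment> \<open>Gauss: the inner product equals \<open>- F y $ i $ j\<close>, so its derivative
    along \<open>j\<close> is one term of the claim and the product rule yields the other
    two.\<close>
  have "partial (\<lambda>y. partial (E i) i y \<bullet> E j y) j x
      = partial (E i) i x \<bullet> partial (E j) j x + partial (partial (E i) i) j x \<bullet> E j x"
    using partial_inner[OF x smpE smE] .
  moreover have "partial (\<lambda>y. partial (E i) i y \<bullet> E j y) j x = partial (\<lambda>y. - F y $ i $ j) j x"
    using \<open>i \<noteq> j\<close> by (intro partial_cong[OF x]) (simp add: partial_E_E)
  moreover have "partial (\<lambda>y. - F y $ i $ j) j x = - partial (\<lambda>y. F y $ i $ j) j x"
    unfolding partial_def
    by (intro D_bounded_linear[OF bounded_linear_minus[OF bounded_linear_ident]] smooth_on_D(1)[OF smF_nth x])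
  \<comment> \<open>The normal components contribute an off-diagonal entry of
    \<open>transpose A ** A\<close>, which is zero.\<close>
  moreover have "partial (E i) i x \<bullet> partial (E j) j x = (\<Sum>k\<in>UNIV. F x $ i $ k * F x $ j $ k)"
    using \<open>i \<noteq> j\<close> sum_A_A[OF x, of i j]
    by (subst frame_inner[OF x]) (simp add: partial_E_\<epsilon>[OF x] partial_E_E[OF x] algebra_simps
        if_distrib if_distribR sum.distrib sum_subtractf cong: if_cong)
  moreover have "partial (partial (E i) i) j x \<bullet> E j x = partial (\<lambda>y. F y $ j $ i) i x"
  proof -
    have "partial (partial (E i) i) j x = partial (partial (E i) j) i x"
      by (rule partial_commute[OF x smE])
    also have "\<dots> = partial (\<lambda>y. F y $ j $ i *\<^sub>R E j y) i x"
      using \<open>i \<noteq> j\<close> by (intro partial_cong[OF x]) (simp add: partial_E)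
    also have "\<dots> = F x $ j $ i *\<^sub>R partial (E j) i x + partial (\<lambda>y. F y $ j $ i) i x *\<^sub>R E j x"
      by (intro partial_scaleR x smF_nth smE)
    finally show ?thesis using \<open>i \<noteq> j\<close> by (simp add: inner_add_left EE[OF x] partial_E_E[OF x])
  qed
  ultimately show "partial (\<lambda>y. F y $ i $ j) j x + partial (\<lambda>y. F y $ j $ i) i x
      + (\<Sum>k\<in>UNIV. F x $ i $ k * F x $ j $ k) = 0"
    by simp
next
  fix x and i j k :: 'n assume x: "x \<in> W" and d: "i \<noteq> j \<and> j \<noteq> k \<and> i \<noteq> k"
  \<comment> \<open>For distinct indices the derivative of \<open>E j\<close> along \<open>i\<close>
    is a multiple of \<open>E i\<close> alone; symmetry of its mixed derivatives is then tested
    against \<open>E i\<close>.\<close>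
  have "partial (partial (E j) i) k x = F x $ i $ j *\<^sub>R partial (E i) k x + partial (\<lambda>y. F y $ i $ j) k x *\<^sub>R E i x"
    if "i \<noteq> j" for i k
  proof -
    have "partial (partial (E j) i) k x = partial (\<lambda>y. F y $ i $ j *\<^sub>R E i y) k x"
      using that by (intro partial_cong[OF x]) (simp add: partial_E)
    also have "\<dots> = F x $ i $ j *\<^sub>R partial (E i) k x + partial (\<lambda>y. F y $ i $ j) k x *\<^sub>R E i x"
      by (intro partial_scaleR x smF_nth smE)
    finally show ?thesis .
  qed
  from this[of i k] this[of k i] d have
    "partial (partial (E j) i) k x = F x $ i $ j *\<^sub>R partial (E i) k x + partial (\<lambda>y. F y $ i $ j) k x *\<^sub>R E i x"
    "partial (partial (E j) k) i x = F x $ k $ j *\<^sub>R partial (E k) i x + partial (\<lambda>y. F y $ k $ j) i x *\<^sub>R E k x"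
    by blast+
  then have "(F x $ i $ j *\<^sub>R partial (E i) k x + partial (\<lambda>y. F y $ i $ j) k x *\<^sub>R E i x) \<bullet> E i x
      = (F x $ k $ j *\<^sub>R partial (E k) i x + partial (\<lambda>y. F y $ k $ j) i x *\<^sub>R E k x) \<bullet> E i x"
    using partial_commute[OF x smE, of j i k] by simp
  then show "partial (\<lambda>y. F y $ i $ j) k x = F x $ i $ k * F x $ k $ j"
    using d by (auto simp: inner_add_left EE[OF x] partial_E_E[OF x])
qed

lemma invertible_frame: "x \<in> W \<Longrightarrow> invertible (frame x)"
  unfolding invertible_def using frame_orthogonal frame_orthogonal' by blast

lemma frame_Lax:
  assumes x: "x \<in> W"
  shows "matrix_inv (frame x) ** D frame x u = (\<Sum>i\<in>UNIV. u $ i *\<^sub>R lax_I (A x) (F x) 1 i)"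
proof -
  have "frame = (\<lambda>x. \<chi> r c. case c of Inl j \<Rightarrow> \<epsilon> j x $ r | Inr i \<Rightarrow> E i x $ r)"
    by (auto simp: adapted_frame_def E_def fun_eq_iff vec_eq_iff split: sum.splits)
  moreover have "smooth_on W (\<lambda>x. case c of Inl j \<Rightarrow> \<epsilon> j x $ r | Inr i \<Rightarrow> E i x $ r)" for c r
    by (cases c) (auto intro!: smooth_intros W sm\<epsilon> smE)
  ultimately have sm: "smooth_on W frame"
    by (auto intro!: smooth_on_vec W)
  have "bounded_linear (\<lambda>M. M $ r $ c)" for r c :: "'m + 'n"
    by (intro bounded_linear_compose[OF bounded_linear_vec_nth bounded_linear_vec_nth])
  from D_bounded_linear[OF this smooth_on_D(1)[OF sm x]]
  have nth: "D frame x u $ r $ c = D (\<lambda>y. frame y $ r $ c) x u" for r c by simp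
  have D_nth: "D (\<lambda>y. f y $ r) x u = D f x u $ r" if "smooth_on W f" for f :: "real^'n \<Rightarrow> real^('m + 'n)" and r
    by (rule D_bounded_linear[OF bounded_linear_vec_nth smooth_on_D(1)[OF that x]])
  define \<Theta> where "\<Theta> = (\<Sum>i\<in>UNIV. u $ i *\<^sub>R lax_I (A x) (F x) 1 i)"
  \<comment> \<open>The equation for the frame matrix, column by column: normal columns by
    Weingarten, tangent columns by \<open>partial_E\<close>.\<close>
  have "D frame x u $ r $ c = (frame x ** \<Theta>) $ r $ c" for r c
  proof (cases c)
    case (Inl j)
    have "\<Theta> $ Inl k $ Inl j = 0" for k
      by (simp add: \<Theta>_def lax_I_nth)
    moreover have "\<Theta> $ Inr k $ Inl j = u $ k * A x $ j $ k" for k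
      by (simp add: \<Theta>_def lax_I_nth if_distrib cong: if_cong)
    ultimately have "(frame x ** \<Theta>) $ r $ c
      = (\<Sum>k\<in>UNIV. E k x $ r * (u $ k * A x $ j $ k))"
      by (simp add: Inl matrix_matrix_mult_def sum_UNIV_Plus)
    then show ?thesis
      by (simp add: Inl nth D_nth sm\<epsilon> D\<epsilon>[OF x] mult.commute)
  next
    case (Inr l)
    define Z where "Z = (\<Sum>j\<in>UNIV. A x $ j $ l *\<^sub>R \<epsilon> j x) + (\<Sum>k\<in>UNIV. F x $ l $ k *\<^sub>R E k x)"
    have "D (E l) x u = (\<Sum>i\<in>UNIV. u $ i *\<^sub>R partial (E l) i x)"
      unfolding partial_def by (rule linear_axis_sum[OF smooth_on_linear_D[OF smE x]])
    also have "\<dots> = (\<Sum>i\<in>UNIV. (u $ i * F x $ i $ l) *\<^sub>R E i x - (if i = l then u $ i *\<^sub>R Z else 0))"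
      unfolding partial_E[OF x] Z_def[symmetric] by (intro sum.cong) (auto simp: scaleR_diff_right)
    also have "\<dots> = (\<Sum>i\<in>UNIV. (u $ i * F x $ i $ l) *\<^sub>R E i x) - u $ l *\<^sub>R Z"
      by (simp add: sum_subtractf)
    finally have DE: "D (E l) x u $ r = (\<Sum>i\<in>UNIV. u $ i * F x $ i $ l * E i x $ r)
        - u $ l * ((\<Sum>j\<in>UNIV. A x $ j $ l * \<epsilon> j x $ r) + (\<Sum>k\<in>UNIV. F x $ l $ k * E k x $ r))"
      by (simp add: Z_def)
    have "\<Theta> $ Inl j $ Inr l = - (u $ l * A x $ j $ l)" for j
      by (simp add: \<Theta>_def lax_I_nth if_distrib cong: if_cong)
    moreover have "\<Theta> $ Inr k $ Inr l = u $ k * F x $ k $ l - u $ l * F x $ l $ k" for k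
    proof -
      have "\<Theta> $ Inr k $ Inr l
          = (\<Sum>i\<in>UNIV. (if k = i then u $ i * F x $ i $ l else 0) - (if l = i then u $ i * F x $ i $ k else 0))"
        by (auto simp: \<Theta>_def lax_I_nth algebra_simps intro!: sum.cong)
      then show ?thesis by (simp add: sum_subtractf)
    qed
    ultimately have "(frame x ** \<Theta>) $ r $ c
      = (\<Sum>j\<in>UNIV. \<epsilon> j x $ r * - (u $ l * A x $ j $ l)) + (\<Sum>k\<in>UNIV. E k x $ r * (u $ k * F x $ k $ l - u $ l * F x $ l $ k))"
      by (simp add: Inr matrix_matrix_mult_def sum_UNIV_Plus)
    then show ?thesis
      by (simp add: Inr nth D_nth smE DE right_diff_distrib distrib_left sum_subtractf sum_distrib_left sum_negf mult_ac)
  qed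
  then have "D frame x u = frame x ** \<Theta>"
    by (simp add: vec_eq_iff)
  then show ?thesis
    using matrix_inv_left[OF invertible_frame[OF x]]
    by (simp add: matrix_mul_assoc matrix_mul_lid flip: \<Theta>_def)
qed

theorem spherical_iff:
  assumes conn: "connected W"
  shows "(\<exists>z. Y ` W \<subseteq> sphere z 1) \<longleftrightarrow> (\<exists>v :: real^'m. norm v = 1 \<and> (\<forall>x\<in>W. b x = v v* A x))"
proof
  assume "\<exists>v :: real^'m. norm v = 1 \<and> (\<forall>x\<in>W. b x = v v* A x)"
  then obtain v :: "real^'m" where v: "norm v = 1" "\<And>x. x \<in> W \<Longrightarrow> b x = v v* A x" by blast
  define N where "N x = (\<Sum>j\<in>UNIV. v $ j *\<^sub>R \<epsilon> j x)" for x
  have "((\<lambda>x. Y x - N x) has_derivative (\<lambda>u. 0)) (at x)" if x: "x \<in> W" for x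
  proof -
    have "((\<lambda>x. Y x - N x) has_derivative (\<lambda>u. D Y x u - (\<Sum>j\<in>UNIV. v $ j *\<^sub>R D (\<epsilon> j) x u))) (at x)"
      unfolding N_def
      by (intro has_derivative_diff has_derivative_sum has_derivative_scaleR_right smooth_on_D(1)[OF smY x]
          smooth_on_D(1)[OF sm\<epsilon> x])
    \<comment> \<open>By \<open>b = v A\<close> both sides have the coefficient
      \<open>u $ i * b x $ i\<close> at \<open>E i\<close>.\<close>
    moreover have "D Y x u = (\<Sum>j\<in>UNIV. v $ j *\<^sub>R D (\<epsilon> j) x u)" for u
    proof -
      have "(\<Sum>j\<in>UNIV. v $ j *\<^sub>R D (\<epsilon> j) x u) = (\<Sum>i\<in>UNIV. \<Sum>j\<in>UNIV. (u $ i * (v $ j * A x $ j $ i)) *\<^sub>R E i x)"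
        unfolding D\<epsilon>[OF x] scaleR_sum_right by (subst sum.swap) (simp add: mult_ac)
      also have "\<dots> = D Y x u"
        unfolding DY[OF x] v(2)[OF x]
        by (simp add: vector_matrix_mult_def sum_distrib_left mult_ac flip: scaleR_sum_left)
      finally show ?thesis by simp
    qed
    ultimately show ?thesis by simp
  qed
  then have const: "Y x - N x = Y y - N y" if "x \<in> W" "y \<in> W" for x y
    using has_derivative_zero_unique_connected[OF W conn, of "\<lambda>x. Y x - N x"] that by blast
  have "norm (N x) = 1" if x: "x \<in> W" for x
  proof -
    have "N x \<bullet> N x = (\<Sum>j\<in>UNIV. v $ j * v $ j)"
      by (simp add: N_def inner_sum_left inner_sum_right \<epsilon>\<epsilon>[OF x] if_distrib cong: if_cong)
    then show ?thesis using v(1) by (simp add: norm_eq_1 inner_vec_def)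
  qed
  then have "Y ` W \<subseteq> sphere (Y y - N y) 1" if "y \<in> W" for y
    using const[OF _ that] that by (auto simp: dist_norm algebra_simps norm_minus_commute)
  then show "\<exists>z. Y ` W \<subseteq> sphere z 1" by blast
next
  assume "\<exists>z. Y ` W \<subseteq> sphere z 1"
  then obtain z where z: "\<And>x. x \<in> W \<Longrightarrow> norm (Y x - z) = 1"
    by (auto simp: dist_norm norm_minus_commute image_subset_iff)
  have smYz: "smooth_on W (\<lambda>x. Y x - z)" by (intro smooth_intros W smY)
  have DYz: "D (\<lambda>x. Y x - z) x u = D Y x u" if "x \<in> W" for x u
    using D_eqI[OF has_derivative_diff[OF smooth_on_D(1)[OF smY that] has_derivative_const]] by simp
  \<comment> \<open>Differentiating the constant length shows that the position vector is normal.
    Since the \<open>\<epsilon> j\<close> have tangent derivatives, its components along them are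
    then constant on the connected chart.\<close>
  have normal: "(Y x - z) \<bullet> D Y x u = 0" if "x \<in> W" for x u
    using D_inner_const[OF W that smYz smYz, of 1 u] z by (simp add: DYz[OF that] inner_commute norm_eq_1)
  then have normalE: "(Y x - z) \<bullet> E i x = 0" if "x \<in> W" for x i
    using that by (simp add: E_def partial_def)
  have "((\<lambda>x. (Y x - z) \<bullet> \<epsilon> j x) has_derivative (\<lambda>u. 0)) (at x)" if x: "x \<in> W" for j x
  proof -
    have "((\<lambda>x. (Y x - z) \<bullet> \<epsilon> j x) has_derivative (\<lambda>u. (Y x - z) \<bullet> D (\<epsilon> j) x u + D (\<lambda>x. Y x - z) x u \<bullet> \<epsilon> j x)) (at x)"
      by (intro has_derivative_inner smooth_on_D(1)[OF smYz x] smooth_on_D(1)[OF sm\<epsilon> x])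
    then show ?thesis
      by (simp add: DYz[OF x] DY\<epsilon>[OF x] D\<epsilon>[OF x] inner_sum_right normalE[OF x])
  qed
  then have const: "(Y x - z) \<bullet> \<epsilon> j x = (Y y - z) \<bullet> \<epsilon> j y" if "x \<in> W" "y \<in> W" for x y j
    using has_derivative_zero_unique_connected[OF W conn, of "\<lambda>x. (Y x - z) \<bullet> \<epsilon> j x"] that by blast
  show "\<exists>v :: real^'m. norm v = 1 \<and> (\<forall>x\<in>W. b x = v v* A x)"
  proof (cases "W = {}")
    \<comment> \<open>On an empty chart the condition on \<open>b\<close> is vacuous, and any unit
      vector will do.\<close>
    case True
    then show ?thesis by (auto intro!: exI[of _ "axis undefined 1"])
  next
    case False
    then obtain y where y: "y \<in> W" by blast
    define v :: "real^'m" where "v = (\<chi> j. (Y y - z) \<bullet> \<epsilon> j y)"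
    have Yv: "Y x - z = (\<Sum>j\<in>UNIV. v $ j *\<^sub>R \<epsilon> j x)" if "x \<in> W" for x
      using frame_expand[OF that, of "Y x - z"] const[OF that y] by (simp add: normalE[OF that] v_def)
    have "v \<bullet> v = (Y y - z) \<bullet> (Y y - z)"
      unfolding frame_inner[OF y, of "Y y - z" "Y y - z"] normalE[OF y] inner_vec_def[of v] by (simp add: v_def)
    then have "norm v = 1" using z[OF y] by (simp add: norm_eq_1)
    moreover have "b x = v v* A x" if x: "x \<in> W" for x
    proof -
      have "D (\<lambda>x. Y x - z) x u = D (\<lambda>x. \<Sum>j\<in>UNIV. v $ j *\<^sub>R \<epsilon> j x) x u" for u
        using D_cong_open[OF W x Yv] by simp
      also have "\<dots> u = (\<Sum>j\<in>UNIV. v $ j *\<^sub>R D (\<epsilon> j) x u)" for u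
        by (intro fun_cong[OF D_eqI] has_derivative_sum has_derivative_scaleR_right smooth_on_D(1)[OF sm\<epsilon> x])
      finally have "D Y x u = (\<Sum>j\<in>UNIV. v $ j *\<^sub>R D (\<epsilon> j) x u)" for u by (simp add: DYz[OF x])
      then have "partial Y i x = (\<Sum>j\<in>UNIV. v $ j *\<^sub>R partial (\<epsilon> j) i x)" for i by (simp add: partial_def)
      then have "b x $ i *\<^sub>R E i x = (\<Sum>j\<in>UNIV. v $ j *\<^sub>R A x $ j $ i *\<^sub>R E i x)" for i
        using x by (simp add: partial_Y partial_\<epsilon>)
      then have "(b x $ i *\<^sub>R E i x) \<bullet> E i x = (\<Sum>j\<in>UNIV. v $ j *\<^sub>R A x $ j $ i *\<^sub>R E i x) \<bullet> E i x" for i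
        by simp
      then have "b x $ i = (\<Sum>j\<in>UNIV. v $ j * A x $ j $ i)" for i
        by (simp add: inner_sum_left EE[OF x])
      then show ?thesis by (simp add: vec_eq_iff vector_matrix_mult_def mult.commute)
    qed
    ultimately show ?thesis by blast
  qed
qed

end

section \<open>Normal projection, parallel frames and adapted coordinates\<close>

lemma normal_part_eqI:
  assumes lin: "linear (D X x)" and w: "w \<in> normal_space X x" "v - w \<in> range (D X x)"
  shows "normal_part X x v = w"
  unfolding normal_part_def
proof (rule the_equality)
  show "w' = w" if w': "w' \<in> normal_space X x \<and> v - w' \<in> range (D X x)" for w'
  proof -
    obtain a a' where a: "v - w = D X x a" "v - w' = D X x a'" using w(2) w' by blast
    then have eq: "w' - w = D X x (a - a')" by (simp add: linear_diff[OF lin] algebra_simps flip: a)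
    have "D X x (a - a') \<bullet> (w' - w) = 0"
      using w(1) w' by (simp add: normal_space_def inner_diff_right)
    then show ?thesis unfolding eq[symmetric] by simp
  qed
qed (use w in simp)

text \<open>Orthogonal decomposition along the tangent space provides a candidate for the definite
  description, and \<open>normal_part_eqI\<close> identifies it.\<close>

lemma normal_part_eq_0_iff:
  fixes X :: "real^'n::finite \<Rightarrow> real^('m::finite + 'n)"
  assumes lin: "linear (D X x)"
  shows "normal_part X x v = 0 \<longleftrightarrow> v \<in> range (D X x)"
proof
  assume *: "normal_part X x v = 0"
  have sub: "span (range (D X x)) = range (D X x)"
    using linear_subspace_image[OF lin subspace_UNIV] by (simp add: span_eq_iff)
  obtain y z where yz: "y \<in> range (D X x)" "\<And>w. w \<in> range (D X x) \<Longrightarrow> orthogonal z w" "v = y + z"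
    using orthogonal_subspace_decomp_exists[of "range (D X x)" v] unfolding sub by blast
  have "normal_part X x v = z"
    using yz(1,3) yz(2)[OF rangeI]
    by (intro normal_part_eqI[OF lin]) (auto simp: normal_space_def orthogonal_def inner_commute[of _ z])
  with * yz show "v \<in> range (D X x)" by simp
next
  assume "v \<in> range (D X x)"
  then show "normal_part X x v = 0"
    by (intro normal_part_eqI[OF lin]) (auto simp: normal_space_def)
qed

text \<open>Turns parallelism into a statement about ambient derivatives. For coordinate directions
  it is the vanishing of the normal part; linearity covers the others.\<close>

lemma parallel_normal_frame_D_tangent:
  assumes im: "immersion_on U X" and e: "parallel_normal_frame U X e" and x: "x \<in> U"
  shows "D (e j) x u \<in> range (D X x)"
proof -
  have lin: "linear (D X x)" using im x by (auto simp: immersion_on_def intro: smooth_on_linear_D)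
  have "partial (e j) k x \<in> range (D X x)" for k
    using e x by (simp add: parallel_normal_frame_def normal_deriv_def flip: normal_part_eq_0_iff[OF lin])
  moreover have "linear (D (e j) x)"
    using e x by (auto simp: parallel_normal_frame_def intro: smooth_on_linear_D)
  ultimately show ?thesis
    unfolding linear_axis_sum[OF \<open>linear (D (e j) x)\<close>, of u] partial_def
    by (intro subspace_sum subspace_scale linear_subspace_image[OF lin subspace_UNIV])
qed

lemma D_compose:
  assumes "(g has_derivative D g x) (at x)" "(f has_derivative D f (g x)) (at (g x))"
  shows "D (f \<circ> g) x u = D f (g x) (D g x u)"
  using D_eqI[OF diff_chain_at[OF assms]] by simp

text \<open>The chain rule for the left inverse gives injectivity, equality of dimensions gives
  surjectivity.\<close>

lemma diffeo_D_bij: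
  assumes "diffeo \<phi> W V" "x \<in> W"
  shows "inj (D \<phi> x)" "surj (D \<phi> x)"
proof -
  obtain \<psi> where W: "open W" "open V" "smooth_on W \<phi>" "\<phi> ` W = V" and \<psi>: "smooth_on V \<psi>" "\<And>x. x \<in> W \<Longrightarrow> \<psi> (\<phi> x) = x"
    using assms(1) by (auto simp: diffeo_def)
  have "D (\<psi> \<circ> \<phi>) x u = D \<psi> (\<phi> x) (D \<phi> x u)" for u
    using W \<psi> assms(2) by (intro D_compose smooth_on_D(1)) auto
  moreover have "D (\<psi> \<circ> \<phi>) x = (\<lambda>u. u)"
    using D_cong_open[OF W(1) assms(2), of "\<psi> \<circ> \<phi>" "\<lambda>x. x"] \<psi>(2) by simp
  ultimately show "inj (D \<phi> x)" by (metis injI)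
  then show "surj (D \<phi> x)"
    by (rule linear_inj_imp_surj[OF smooth_on_linear_D[OF W(3) assms(2)]])
qed

lemma second_ff_inner:
  assumes "\<And>l. e j x \<bullet> e l x = (if j = l then 1 else 0)"
  shows "second_ff Y e x u w \<bullet> e j x = D Y x u \<bullet> D (e j) x w"
proof -
  have "e l x \<bullet> e j x = (if j = l then 1 else 0)" for l
    using assms[of l] by (simp add: inner_commute)
  then have "second_ff Y e x u w \<bullet> e j x = (\<Sum>l\<in>UNIV. if j = l then D Y x u \<bullet> D (e l) x w else 0)"
    unfolding second_ff_def inner_sum_left inner_scaleR_left by (intro sum.cong) simp_all
  then show ?thesis by simp
qed

text \<open>The second fundamental form fixes only the pairings of the derivatives of the normal
  frame with tangent vectors. Parallelism excludes normal components, so these derivatives are fully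
  determined.\<close>

lemma adapted_coords_chart:
  fixes X :: "real^'n::finite \<Rightarrow> real^('m::finite + 'n)"
  assumes im: "immersion_on U X" and e: "parallel_normal_frame U X e" and ac: "adapted_coords U X e \<phi> W A b"
  shows "adapted_chart W (X \<circ> \<phi>) (\<lambda>j. e j \<circ> \<phi>) A b"
proof
  have df: "diffeo \<phi> W (\<phi> ` W)" and sub: "\<phi> ` W \<subseteq> U" and ff: "fundamental_forms W (X \<circ> \<phi>) (\<lambda>j. e j \<circ> \<phi>) A b"
    using ac by (auto simp: adapted_coords_def)
  have U: "open U" "smooth_on U X" "\<And>x. x \<in> U \<Longrightarrow> inj (D X x)"
    using im by (auto simp: immersion_on_def)
  have sm\<phi>: "smooth_on W \<phi>" using df by (auto simp: diffeo_def)
  have sme: "smooth_on U (e j)" for j using e by (auto simp: parallel_normal_frame_def)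
  show W: "open W" using df by (auto simp: diffeo_def)
  show smY: "smooth_on W (X \<circ> \<phi>)" and sm\<epsilon>: "smooth_on W (e j \<circ> \<phi>)" for j
    unfolding o_def by (intro smooth_on_compose[OF _ sm\<phi> W U(1) sub] U sme)+
  show "smooth_on W A" "smooth_on W b" using ac by (auto simp: adapted_coords_def)
  fix x assume x: "x \<in> W"
  then have xU: "\<phi> x \<in> U" using sub by blast
  show "transpose (A x) ** A x = mat 1" using ac x by (auto simp: adapted_coords_def)
  show \<epsilon>\<epsilon>: "(e j \<circ> \<phi>) x \<bullet> (e l \<circ> \<phi>) x = (if j = l then 1 else 0)" for j l
    using e xU by (auto simp: parallel_normal_frame_def)
  have DY: "D (X \<circ> \<phi>) x u = D X (\<phi> x) (D \<phi> x u)" for u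
    by (intro D_compose smooth_on_D(1)[OF sm\<phi> x] smooth_on_D(1)[OF U(2) xU])
  have De: "D (e j \<circ> \<phi>) x u = D (e j) (\<phi> x) (D \<phi> x u)" for u j
    by (intro D_compose smooth_on_D(1)[OF sm\<phi> x] smooth_on_D(1)[OF sme xU])
  show "D (X \<circ> \<phi>) x u \<bullet> (e j \<circ> \<phi>) x = 0" for u j
    using e xU by (auto simp: parallel_normal_frame_def normal_space_def DY)
  show DYDY: "D (X \<circ> \<phi>) x u \<bullet> D (X \<circ> \<phi>) x w = (\<Sum>i\<in>UNIV. (b x $ i)\<^sup>2 * u $ i * w $ i)" for u w
    using ff x by (auto simp: fundamental_forms_def first_ff_def)
  have linY: "linear (D (X \<circ> \<phi>) x)" by (rule smooth_on_linear_D[OF smY x])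
  have injY: "inj (D (X \<circ> \<phi>) x)"
    using U(3)[OF xU] diffeo_D_bij(1)[OF df x] by (simp add: DY[abs_def] inj_def)
  \<comment> \<open>A zero of \<open>b\<close> would make the \<open>i\<close>-th coordinate vector
    null, against the immersion property.\<close>
  show b0: "b x $ i \<noteq> 0" for i
  proof
    assume "b x $ i = 0"
    then have "D (X \<circ> \<phi>) x (axis i 1) \<bullet> D (X \<circ> \<phi>) x (axis i 1) = 0"
      unfolding DYDY sum_mult_axis_axis by simp
    then have "axis i (1::real) = 0"
      using injY unfolding linear_injective_0[OF linY] inner_eq_zero_iff by blast
    then show False by (simp add: axis_eq_0_iff)
  qed
  show "D (e j \<circ> \<phi>) x w = (\<Sum>i\<in>UNIV. (w $ i * A x $ j $ i) *\<^sub>R ((1 / b x $ i) *\<^sub>R partial (X \<circ> \<phi>) i x))" for j w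
  proof -
    \<comment> \<open>The defect is tangent, say the image of \<open>u\<close>. Pairing this image
      with both terms of \<open>d\<close> uses just the two fundamental forms and shows that
      \<open>d\<close> has length zero.\<close>
    define d where "d = D (e j \<circ> \<phi>) x w - (\<Sum>i\<in>UNIV. (w $ i * A x $ j $ i) *\<^sub>R ((1 / b x $ i) *\<^sub>R partial (X \<circ> \<phi>) i x))"
    have "D (e j) (\<phi> x) (D \<phi> x w) \<in> range (D X (\<phi> x))"
      by (rule parallel_normal_frame_D_tangent[OF im e xU])
    then obtain z where "D (e j \<circ> \<phi>) x w = D X (\<phi> x) z" unfolding De by blast
    moreover obtain z' where "z = D \<phi> x z'" using diffeo_D_bij(2)[OF df x] by (metis surjD)
    ultimately have "D (e j \<circ> \<phi>) x w \<in> range (D (X \<circ> \<phi>) x)" by (simp add: DY)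
    then have "d \<in> range (D (X \<circ> \<phi>) x)"
      unfolding d_def partial_def
      by (intro subspace_diff subspace_sum subspace_scale linear_subspace_image[OF linY subspace_UNIV]) auto
    then obtain u where u: "d = D (X \<circ> \<phi>) x u" by blast
    have "D (X \<circ> \<phi>) x u \<bullet> D (e j \<circ> \<phi>) x w = second_ff (X \<circ> \<phi>) (\<lambda>j. e j \<circ> \<phi>) x u w \<bullet> (e j \<circ> \<phi>) x"
      using second_ff_inner[of "\<lambda>j. e j \<circ> \<phi>" j x "X \<circ> \<phi>" u w] \<epsilon>\<epsilon> by simp
    also have "\<dots> = (\<Sum>i\<in>UNIV. \<Sum>l\<in>UNIV. (b x $ i * A x $ l $ i * u $ i * w $ i) *\<^sub>R (e l \<circ> \<phi>) x) \<bullet> (e j \<circ> \<phi>) x"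
      using ff x by (simp add: fundamental_forms_def)
    also have "\<dots> = (\<Sum>i\<in>UNIV. b x $ i * A x $ j $ i * u $ i * w $ i)"
      by (simp add: inner_sum_left \<epsilon>\<epsilon>[unfolded o_apply] if_distrib cong: if_cong)
    finally have 1: "D (X \<circ> \<phi>) x u \<bullet> D (e j \<circ> \<phi>) x w = (\<Sum>i\<in>UNIV. b x $ i * A x $ j $ i * u $ i * w $ i)" .
    have "D (X \<circ> \<phi>) x u \<bullet> partial (X \<circ> \<phi>) i x = (b x $ i)\<^sup>2 * u $ i" for i
      unfolding partial_def DYDY by (simp add: axis_def if_distrib cong: if_cong)
    then have "d \<bullet> d = 0"
      unfolding u(1)[symmetric] using 1 b0 unfolding u(1)[symmetric]
      by (subst (2) d_def) (simp add: inner_diff_right inner_sum_right power2_eq_square mult_ac)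
    then show ?thesis by (simp add: d_def)
  qed
qed

section \<open>Immersions from solutions of the system\<close>

lemma partial_nth:
  assumes "smooth_on S f" "x \<in> S"
  shows "partial f i x $ r = partial (\<lambda>y. f y $ r) i x"
  unfolding partial_def
  by (rule D_bounded_linear[OF bounded_linear_vec_nth smooth_on_D(1)[OF assms], symmetric])

lemma smooth_on_matrixI:
  assumes "open S" "\<And>r c. smooth_on S (\<lambda>x. M x $ r $ c)"
  shows "smooth_on S M"
proof -
  have "smooth_on S (\<lambda>x. \<chi> r c. M x $ r $ c)" by (intro smooth_on_vec assms)
  then show ?thesis by (simp add: vec_lambda_eta)
qed

lemma matrix_mult_scaleR_right: "(M :: real^'k::finite^'j::finite) ** (a *\<^sub>R N) = a *\<^sub>R (M ** N)"
  and matrix_mult_scaleR_left: "(a *\<^sub>R M) ** (N :: real^'l::finite^'k) = a *\<^sub>R (M ** N)"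
  by (simp_all add: vec_eq_iff matrix_matrix_mult_def sum_distrib_left mult_ac)

lemma linear_matrix_mult_right: "linear (\<lambda>N. (M :: real^'k::finite^'j::finite) ** (N :: real^'l::finite^'k))"
  by (rule linearI) (auto simp: matrix_add_ldistrib matrix_mult_scaleR_right)

lemma linear_matrix_mult_left: "linear (\<lambda>M. (M :: real^'k::finite^'j::finite) ** (N :: real^'l::finite^'k))"
  by (rule linearI) (auto simp: vec_eq_iff matrix_matrix_mult_def sum.distrib sum_distrib_left algebra_simps)

text \<open>Integrates \<open>dg = g \<theta>\<close> from the identity matrix. Skewness of
  \<open>\<theta>\<close> keeps the solution in the orthogonal group, so its columns form a moving
  orthonormal frame.\<close>

lemma flat_skew_connection:
  fixes \<theta> :: "real^'n::finite \<Rightarrow> 'n \<Rightarrow> real^'k::finite^'k"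
  assumes \<Omega>: "open \<Omega>" and sm: "\<And>i. smooth_on \<Omega> (\<lambda>x. \<theta> x i)"
    and flat: "\<And>x i k. x \<in> \<Omega> \<Longrightarrow> i \<noteq> k \<Longrightarrow>
      partial (\<lambda>y. \<theta> y i) k x + \<theta> x k ** \<theta> x i = partial (\<lambda>y. \<theta> y k) i x + \<theta> x i ** \<theta> x k"
    and skew: "\<And>x i. transpose (\<theta> x i) = - \<theta> x i" and p: "p \<in> \<Omega>"
  obtains r and g :: "real^'n \<Rightarrow> real^'k^'k" where "0 < r" "ball p r \<subseteq> \<Omega>" "smooth_on (ball p r) g"
    "\<And>x. x \<in> ball p r \<Longrightarrow> transpose (g x) ** g x = mat 1"
    "\<And>x i. x \<in> ball p r \<Longrightarrow> partial g i x = g x ** \<theta> x i"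
proof -
  define \<Theta> where "\<Theta> x h = (\<Sum>i\<in>UNIV. h $ i *\<^sub>R \<theta> x i)" for x and h :: "real^'n"
  define B where "B x h u = u ** \<Theta> x h" for x h and u :: "real^'k^'k"
  have lin\<Theta>: "linear (\<Theta> x)" for x
    by (rule linearI) (auto simp: \<Theta>_def algebra_simps sum.distrib scaleR_sum_right)
  have sm\<Theta>: "smooth_on \<Omega> (\<lambda>x. \<Theta> x h)" for h
    unfolding \<Theta>_def by (intro smooth_intros \<Omega> sm)
  have D\<Theta>: "D (\<lambda>x. \<Theta> x h) x v = (\<Sum>i\<in>UNIV. \<Sum>k\<in>UNIV. (h $ i * v $ k) *\<^sub>R partial (\<lambda>y. \<theta> y i) k x)"
    if "x \<in> \<Omega>" for x h v
  proof -
    have "D (\<lambda>x. \<Theta> x h) x v = (\<Sum>i\<in>UNIV. h $ i *\<^sub>R D (\<lambda>y. \<theta> y i) x v)"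
      unfolding \<Theta>_def
      by (intro fun_cong[OF D_eqI] has_derivative_sum has_derivative_scaleR_right smooth_on_D(1)[OF sm that])
    also have "\<dots> = (\<Sum>i\<in>UNIV. \<Sum>k\<in>UNIV. (h $ i * v $ k) *\<^sub>R partial (\<lambda>y. \<theta> y i) k x)"
      unfolding partial_def
      by (subst linear_axis_sum[OF smooth_on_linear_D[OF sm that], of _ v]) (simp add: scaleR_sum_right)
    finally show ?thesis .
  qed
  have \<Theta>\<Theta>: "\<Theta> x v ** \<Theta> x h = (\<Sum>i\<in>UNIV. \<Sum>k\<in>UNIV. (h $ i * v $ k) *\<^sub>R (\<theta> x k ** \<theta> x i))" for x h v
  proof -
    have "\<Theta> x v ** \<Theta> x h = (\<Sum>i\<in>UNIV. h $ i *\<^sub>R (\<Theta> x v ** \<theta> x i))"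
      by (subst (2) \<Theta>_def) (simp add: linear_sum[OF linear_matrix_mult_right] matrix_mult_scaleR_right)
    also have "\<dots> = (\<Sum>i\<in>UNIV. \<Sum>k\<in>UNIV. (h $ i * v $ k) *\<^sub>R (\<theta> x k ** \<theta> x i))"
      by (simp add: \<Theta>_def linear_sum[OF linear_matrix_mult_left] matrix_mult_scaleR_left scaleR_sum_right)
    finally show ?thesis .
  qed
  have flat\<Theta>: "D (\<lambda>x. \<Theta> x h) x v + \<Theta> x v ** \<Theta> x h = D (\<lambda>x. \<Theta> x v) x h + \<Theta> x h ** \<Theta> x v"
    if "x \<in> \<Omega>" for x h v
  proof -
    define c where "c i k = partial (\<lambda>y. \<theta> y i) k x + \<theta> x k ** \<theta> x i" for i k
    have c: "c i k = c k i" for i k using flat[OF that, of i k] by (cases "i = k") (auto simp: c_def)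
    have eq: "D (\<lambda>x. \<Theta> x h) x v + \<Theta> x v ** \<Theta> x h = (\<Sum>i\<in>UNIV. \<Sum>k\<in>UNIV. (h $ i * v $ k) *\<^sub>R c i k)" for h v
      unfolding D\<Theta>[OF that] \<Theta>\<Theta> c_def by (simp add: scaleR_add_right sum.distrib)
    show ?thesis unfolding eq by (subst sum.swap) (simp add: c mult.commute)
  qed
  have DB: "D (\<lambda>x. B x h u) x v = u ** D (\<lambda>x. \<Theta> x h) x v" if "x \<in> \<Omega>" for x h u v
    unfolding B_def
    by (rule D_bounded_linear[OF _ smooth_on_D(1)[OF sm\<Theta> that]])
      (simp add: linear_matrix_mult_right flip: linear_conv_bounded_linear)
  interpret flat_linear_system \<Omega> B
  proof
    show "bilinear (B x)" for x
      unfolding bilinear_def B_def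
      using linear_compose[OF lin\<Theta> linear_matrix_mult_right] linear_matrix_mult_left by (auto simp: o_def)
    show "smooth_on \<Omega> (\<lambda>x. B x h u)" for h u
      unfolding B_def
      by (rule smooth_on_bounded_linear[OF _ \<Omega> sm\<Theta>])
        (simp add: linear_matrix_mult_right flip: linear_conv_bounded_linear)
    show "D (\<lambda>x. B x h u) x v + B x h (B x v u) = D (\<lambda>x. B x v u) x h + B x v (B x h u)" if "x \<in> \<Omega>" for x h v u
      unfolding DB[OF that] unfolding B_def
      using arg_cong[OF flat\<Theta>[OF that, of h v], of "\<lambda>M. u ** M"]
      by (simp add: matrix_add_ldistrib matrix_mul_assoc)
  qed (rule \<Omega>)
  obtain r where r: "0 < r" "ball p r \<subseteq> \<Omega>" and
    ex: "\<And>y0. \<exists>y. y p = y0 \<and> smooth_on (ball p r) y \<and> (\<forall>x\<in>ball p r. (y has_derivative (\<lambda>h. B x h (y x))) (at x))"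
    by (rule local_solution[OF p]) blast
  from ex[of "mat 1"] obtain g where g: "g p = mat 1" "smooth_on (ball p r) g"
    "\<And>x. x \<in> ball p r \<Longrightarrow> (g has_derivative (\<lambda>h. B x h (g x))) (at x)" by blast
  have skew\<Theta>: "a \<bullet> (\<Theta> x h *v d) = - (d \<bullet> (\<Theta> x h *v a))" for x h a d
  proof -
    have "transpose (\<Theta> x h) = (\<Sum>i\<in>UNIV. h $ i *\<^sub>R transpose (\<theta> x i))"
      by (simp add: vec_eq_iff transpose_def \<Theta>_def)
    then have "transpose (\<Theta> x h) = - \<Theta> x h" by (simp add: skew \<Theta>_def sum_negf)
    then have "d v* \<Theta> x h = (- \<Theta> x h) *v d" by (metis transpose_matrix_vector)
    also have "\<dots> = - (\<Theta> x h *v d)"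
      by (simp add: vec_eq_iff matrix_vector_mult_def sum_negf)
    finally have "\<Theta> x h *v d = - (d v* \<Theta> x h)" by simp
    then have "a \<bullet> (\<Theta> x h *v d) = - ((d v* \<Theta> x h) \<bullet> a)" by (simp add: inner_commute)
    then show ?thesis by (simp only: dot_lmul_matrix)
  qed
  have Dg: "D g x h = g x ** \<Theta> x h" if "x \<in> ball p r" for x h
    using D_eqI[OF g(3)[OF that]] by (simp add: B_def)
  \<comment> \<open>The connection multiplies from the right, so it is the rows of \<open>g\<close>
    that evolve by a skew matrix. Orthonormality of the columns follows afterwards because
    \<open>g\<close> is square.\<close>
  have "((\<lambda>x. g x $ s \<bullet> g x $ s') has_derivative (\<lambda>h. 0)) (at x)" if x: "x \<in> ball p r" for s s' x
  proof -
    have nth: "((\<lambda>x. g x $ s) has_derivative (\<lambda>h. (g x $ s) v* \<Theta> x h)) (at x)" for s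
    proof -
      have "((\<lambda>x. g x $ s) has_derivative (\<lambda>h. B x h (g x) $ s)) (at x)"
        by (rule bounded_linear.has_derivative[OF bounded_linear_vec_nth g(3)[OF x]])
      moreover have "B x h (g x) $ s = (g x $ s) v* \<Theta> x h" for h
        by (simp add: B_def vec_eq_iff matrix_matrix_mult_def vector_matrix_mult_def mult.commute)
      ultimately show ?thesis by simp
    qed
    have "g x $ s \<bullet> (g x $ s' v* \<Theta> x h) + (g x $ s v* \<Theta> x h) \<bullet> g x $ s' = 0" for h
      using skew\<Theta>[of "g x $ s" x h "g x $ s'"]
      by (simp add: dot_lmul_matrix inner_commute[of "g x $ s"])
    then show ?thesis using has_derivative_inner[OF nth[of s] nth[of s']] by simp
  qed
  then have "g x $ s \<bullet> g x $ s' = g p $ s \<bullet> g p $ s'" if "x \<in> ball p r" for x s s'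
    using has_derivative_zero_unique_connected[of "ball p r" "\<lambda>x. g x $ s \<bullet> g x $ s'" x p] r(1) that by simp
  moreover have "g p $ s = axis s 1" for s :: 'k
    by (auto simp: g(1) mat_def axis_def vec_eq_iff)
  ultimately have "g x $ s \<bullet> g x $ s' = (if s = s' then 1 else 0)" if "x \<in> ball p r" for x and s s' :: 'k
    using that by (simp add: inner_axis_axis)
  then have "g x ** transpose (g x) = mat 1" if "x \<in> ball p r" for x
    using that by (simp add: vec_eq_iff matrix_matrix_mult_def transpose_def mat_def inner_vec_def)
  then have "transpose (g x) ** g x = mat 1" if "x \<in> ball p r" for x
    using that matrix_left_right_inverse by blast
  moreover have "partial g i x = g x ** \<theta> x i" if "x \<in> ball p r" for x i
    by (simp add: partial_def Dg[OF that] \<Theta>_def axis_def if_distrib if_distribR cong: if_cong)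
  ultimately show ?thesis using that[of r g] r g(2) by blast
qed

text \<open>Entries of \<open>- F^t C_i + C_i F\<close>, the tangential block of the Lax connection
  and all that survives of it at \<lambda> = 0.\<close>

definition rotation_form :: "real^'n::finite^'n \<Rightarrow> 'n \<Rightarrow> real^'n^'n" where
  "rotation_form F i = (\<chi> q l. (if q = i then F $ i $ l else 0) - (if l = i then F $ i $ q else 0))"

lemma rotation_form_skew: "transpose (rotation_form F i) = - rotation_form F i"
  by (simp add: rotation_form_def transpose_def vec_eq_iff)

lemma lax_I_skew: "transpose (lax_I A F (1::real) i) = - lax_I A F 1 i"
proof -
  have "transpose (lax_I A F (1::real) i) $ r $ c = (- lax_I A F 1 i) $ r $ c" for r c
    by (cases r; cases c) (auto simp: transpose_def lax_I_nth)
  then show ?thesis unfolding vec_eq_iff by blast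
qed

section \<open>The flat connections attached to a solution of the system\<close>

context
  fixes \<Omega> :: "(real^'n::finite) set" and A :: "real^'n \<Rightarrow> real^'n^'m::finite" and F :: "real^'n \<Rightarrow> real^'n^'n"
  assumes \<Omega>: "open \<Omega>" and G: "G_system_I \<Omega> A F"
begin

lemma G_smooth: "smooth_on \<Omega> (\<lambda>x. A x $ j $ i)" "smooth_on \<Omega> (\<lambda>x. F x $ i $ k)"
  using G by (auto simp: G_system_I_def intro!: smooth_intros \<Omega>)

lemma
  assumes x: "x \<in> \<Omega>"
  shows G_diag: "F x $ i $ i = 0"
    and G_A: "k \<noteq> i \<Longrightarrow> partial (\<lambda>y. A y $ j $ i) k x = F x $ i $ k * A x $ j $ k"
    and G_F: "i \<noteq> l \<Longrightarrow> partial (\<lambda>y. F y $ i $ l) l x + partial (\<lambda>y. F y $ l $ i) i x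
             + (\<Sum>k\<in>UNIV. F x $ i $ k * F x $ l $ k) = 0"
    and G_F': "i \<noteq> l \<Longrightarrow> l \<noteq> k \<Longrightarrow> i \<noteq> k \<Longrightarrow> partial (\<lambda>y. F y $ i $ l) k x = F x $ i $ k * F x $ k $ l"
    and G_AtA: "(\<Sum>j\<in>UNIV. A x $ j $ i * A x $ j $ k) = (if i = k then 1 else 0)"
proof -
  show "(\<Sum>j\<in>UNIV. A x $ j $ i * A x $ j $ k) = (if i = k then 1 else 0)"
    using G x by (simp add: G_system_I_def matrix_matrix_mult_def transpose_def mat_def vec_eq_iff)
qed (use G x in \<open>auto simp: G_system_I_def\<close>)

lemma partial_if: "partial (\<lambda>y. if P then f y else g y) k x = (if P then partial f k x else partial g k x)"
  by (cases P) simp_all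

lemma partial_const: "partial (\<lambda>y. c) k x = 0"
  by (simp add: partial_def)

lemma partial_diff:
  "smooth_on \<Omega> f \<Longrightarrow> smooth_on \<Omega> g \<Longrightarrow> x \<in> \<Omega> \<Longrightarrow> partial (\<lambda>y. f y - g y) k x = partial f k x - partial g k x"
  unfolding partial_def by (intro fun_cong[OF D_eqI] has_derivative_diff smooth_on_D(1))

lemma partial_minus:
  fixes f :: "real^'n \<Rightarrow> real"
  shows "smooth_on \<Omega> f \<Longrightarrow> x \<in> \<Omega> \<Longrightarrow> partial (\<lambda>y. - f y) k x = - partial f k x"
  unfolding partial_def by (intro fun_cong[OF D_eqI] has_derivative_minus smooth_on_D(1))

lemma smooth_if: "smooth_on \<Omega> f \<Longrightarrow> smooth_on \<Omega> g \<Longrightarrow> smooth_on \<Omega> (\<lambda>y. if P then f y else g y)"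
  by (cases P) simp_all

lemma rotation_form_smooth: "smooth_on \<Omega> (\<lambda>x. rotation_form (F x) i)"
  by (intro smooth_on_matrixI \<Omega>) (simp add: rotation_form_def, intro smooth_on_diff smooth_if smooth_on_const \<Omega> G_smooth)

lemma lax_smooth: "smooth_on \<Omega> (\<lambda>x. lax_I (A x) (F x) (1::real) i)"
proof (intro smooth_on_matrixI \<Omega>)
  fix r c show "smooth_on \<Omega> (\<lambda>x. lax_I (A x) (F x) (1::real) i $ r $ c)"
    by (cases r; cases c; simp only: lax_I_nth)
      (intro smooth_on_diff smooth_on_minus smooth_if smooth_on_const \<Omega> G_smooth)+
qed

lemma rotation_form_flat_nth:
  assumes x: "x \<in> \<Omega>" and ik: "i \<noteq> k"
  shows "partial (\<lambda>y. rotation_form (F y) i $ q $ l) k x + (\<Sum>s\<in>UNIV. rotation_form (F x) k $ q $ s * rotation_form (F x) i $ s $ l)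
    = partial (\<lambda>y. rotation_form (F y) k $ q $ l) i x + (\<Sum>s\<in>UNIV. rotation_form (F x) i $ q $ s * rotation_form (F x) k $ s $ l)"
proof -
  have 1: "partial (\<lambda>y. rotation_form (F y) i $ q $ l) k x
      = (if q = i then partial (\<lambda>y. F y $ i $ l) k x else 0) - (if l = i then partial (\<lambda>y. F y $ i $ q) k x else 0)" for i k
    unfolding rotation_form_def
    by (simp add: partial_diff[OF smooth_if smooth_if x] smooth_on_const \<Omega> G_smooth partial_if partial_const)
  \<comment> \<open>Only \<open>s = i\<close> and \<open>s = k\<close> contribute, except at
    position \<open>(k, i)\<close>, where the full sum of the second equation of the system
    appears.\<close>
  have 2: "(\<Sum>s\<in>UNIV. rotation_form (F x) k $ q $ s * rotation_form (F x) i $ s $ l)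
      = (if q = k then F x $ k $ i * F x $ i $ l else 0) - (if q = k \<and> l = i then (\<Sum>s\<in>UNIV. F x $ k $ s * F x $ i $ s) else 0)
        + (if l = i then F x $ k $ q * F x $ i $ k else 0)" if "i \<noteq> k" for i k
  proof -
    have "rotation_form (F x) k $ q $ s * rotation_form (F x) i $ s $ l
      = (if s = i then (if q = k then F x $ k $ i * F x $ i $ l else 0) else 0)
        - (if q = k \<and> l = i then F x $ k $ s * F x $ i $ s else 0)
        + (if s = k then (if l = i then F x $ k $ q * F x $ i $ k else 0) else 0)" for s
      using that by (auto simp: rotation_form_def algebra_simps)
    then show ?thesis by (cases "q = k \<and> l = i") (auto simp: sum.distrib sum_subtractf)
  qed
  have 3: "(\<Sum>s\<in>UNIV. F x $ k $ s * F x $ i $ s) = (\<Sum>s\<in>UNIV. F x $ i $ s * F x $ k $ s)"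
    by (simp add: mult.commute)
  show ?thesis
    unfolding 1 2[OF ik] 2[OF ik[symmetric]]
    using ik G_F[OF x ik] G_F'[OF x, of i l k] G_F'[OF x, of k l i] G_F'[OF x, of i q k] G_F'[OF x, of k q i]
    by (cases "q = i"; cases "q = k"; cases "l = i"; cases "l = k") (auto simp: G_diag[OF x] 3)
qed

lemma rotation_form_flat:
  assumes x: "x \<in> \<Omega>" and ik: "i \<noteq> k"
  shows "partial (\<lambda>y. rotation_form (F y) i) k x + rotation_form (F x) k ** rotation_form (F x) i
    = partial (\<lambda>y. rotation_form (F y) k) i x + rotation_form (F x) i ** rotation_form (F x) k"
  using rotation_form_flat_nth[OF x ik]
  by (simp add: vec_eq_iff matrix_matrix_mult_def partial_nth[OF rotation_form_smooth x]
      partial_nth[OF smooth_on_vec_nth[OF \<Omega> rotation_form_smooth] x])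

lemma lax_flat:
  assumes x: "x \<in> \<Omega>" and ik: "i \<noteq> k"
  shows "partial (\<lambda>y. lax_I (A y) (F y) (1::real) i) k x + lax_I (A x) (F x) 1 k ** lax_I (A x) (F x) 1 i
    = partial (\<lambda>y. lax_I (A y) (F y) 1 k) i x + lax_I (A x) (F x) 1 i ** lax_I (A x) (F x) 1 k"
proof -
  let ?L = "\<lambda>i y. lax_I (A y) (F y) (1::real) i"
  define P where "P i k r c = partial (\<lambda>y. ?L i y $ r $ c) k x + (\<Sum>s\<in>UNIV. ?L k x $ r $ s * ?L i x $ s $ c)" for i k r c
  have "P i k r c = P k i r c" for r c
  proof (cases r; cases c)
    \<comment> \<open>Normal block: a nonzero summand would require \<open>k = i\<close>.\<close>
    fix j l assume rc: "r = Inl j" "c = Inl l"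
    have "P i k r c = 0" if "i \<noteq> k" for i k
    proof -
      have "(\<Sum>s\<in>UNIV. ?L k x $ Inl j $ Inr s * ?L i x $ Inr s $ Inl l) = 0"
        using that by (intro sum.neutral) (auto simp: lax_I_nth)
      then show ?thesis by (simp add: P_def rc sum_UNIV_Plus lax_I_nth(1) partial_const)
    qed
    with ik show ?thesis by metis
  next
    \<comment> \<open>Upper right block: the equation for the derivatives of \<open>A\<close>
      cancels the product.\<close>
    fix j l assume rc: "r = Inl j" "c = Inr l"
    have "P i k r c = 0" if "i \<noteq> k" for i k
    proof -
      have "?L k x $ Inl j $ Inr s * ?L i x $ Inr s $ Inr l = (if s = k then (if l = i then A x $ j $ k * F x $ i $ k else 0) else 0)" for s
        using that by (auto simp: lax_I_nth)
      then show ?thesis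
        using that G_A[OF x, of k i j]
        by (simp add: P_def rc sum_UNIV_Plus lax_I_nth(1,2) partial_const partial_if partial_minus[OF G_smooth(1) x])
    qed
    with ik show ?thesis by metis
  next
    \<comment> \<open>Lower left block: here that equation produces the mirror image of the product,
      so the total is symmetric in \<open>i, k\<close>.\<close>
    fix q l assume rc: "r = Inr q" "c = Inl l"
    have "P i k r c = (if q = k then F x $ k $ i * A x $ l $ i else 0) + (if q = i then F x $ i $ k * A x $ l $ k else 0)"
      if "i \<noteq> k" for i k
    proof -
      have "?L k x $ Inr q $ Inr s * ?L i x $ Inr s $ Inl l = (if s = i then (if q = k then F x $ k $ i * A x $ l $ i else 0) else 0)" for s
        using that by (auto simp: lax_I_nth)
      then show ?thesis
        using that G_A[OF x, of k i l]
        by (simp add: P_def rc sum_UNIV_Plus lax_I_nth(1,3) partial_const partial_if)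
    qed
    with ik show ?thesis by (simp add: add.commute)
  next
    \<comment> \<open>Tangential block: the products through normal indices add up to off-diagonal
      entries of \<open>transpose A ** A\<close>, so flatness is inherited from
      \<open>rotation_form\<close>.\<close>
    fix q l assume rc: "r = Inr q" "c = Inr l"
    have rot: "?L i y $ Inr q $ Inr l = rotation_form (F y) i $ q $ l" for i y q l
      by (simp add: lax_I_nth rotation_form_def)
    have "P i k r c = partial (\<lambda>y. rotation_form (F y) i $ q $ l) k x
        + (\<Sum>s\<in>UNIV. rotation_form (F x) k $ q $ s * rotation_form (F x) i $ s $ l)" if "i \<noteq> k" for i k
    proof -
      have "(\<Sum>j\<in>UNIV. ?L k x $ Inr q $ Inl j * ?L i x $ Inl j $ Inr l)
          = (if q = k \<and> l = i then - (\<Sum>j\<in>UNIV. A x $ j $ k * A x $ j $ i) else 0)"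
        by (cases "q = k \<and> l = i") (auto simp: lax_I_nth sum_negf)
      also have "\<dots> = 0" using that G_AtA[OF x, of k i] by simp
      finally show ?thesis by (simp add: P_def rc sum_UNIV_Plus rot)
    qed
    with ik rotation_form_flat_nth[OF x ik] show ?thesis by simp
  qed
  then show ?thesis
    by (simp add: vec_eq_iff P_def matrix_matrix_mult_def partial_nth[OF lax_smooth x]
        partial_nth[OF smooth_on_vec_nth[OF \<Omega> lax_smooth] x])
qed

text \<open>For distinct \<open>i, k\<close> the derivative of \<open>b_i E_i\<close> along
  \<open>k\<close> is \<open>b_i F_ki E_k + F_ik b_k E_i\<close>, symmetric in the two indices, so
  the form is closed. This covers the tangent part of the ambient frame and the intrinsic frame
  alike.\<close>

lemma coordinate_frame_potential:
  fixes E :: "'n \<Rightarrow> real^'n \<Rightarrow> real^'k::finite"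
  assumes T: "open T" "T \<subseteq> \<Omega>" and smb: "smooth_on \<Omega> b" and smE: "\<And>i. smooth_on T (E i)"
    and b: "\<And>x i k. x \<in> \<Omega> \<Longrightarrow> i \<noteq> k \<Longrightarrow> partial (\<lambda>y. b y $ i) k x = F x $ i $ k * b x $ k"
    and E: "\<And>x i k. x \<in> T \<Longrightarrow> i \<noteq> k \<Longrightarrow> partial (E i) k x = F x $ k $ i *\<^sub>R E k x" and p: "p \<in> T"
  obtains r Y where "0 < r" "ball p r \<subseteq> T" "smooth_on (ball p r) Y"
    "\<And>x. x \<in> ball p r \<Longrightarrow> (Y has_derivative (\<lambda>h. \<Sum>i\<in>UNIV. (h $ i * b x $ i) *\<^sub>R E i x)) (at x)"
proof -
  define w where "w x h = (\<Sum>i\<in>UNIV. h $ i *\<^sub>R b x $ i *\<^sub>R E i x)" for x h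
  have smb': "smooth_on T (\<lambda>x. b x $ i)" for i
    using smooth_on_subset[OF smb T(2)] by (intro smooth_intros T(1))
  have smbE: "smooth_on T (\<lambda>x. b x $ i *\<^sub>R E i x)" for i
    by (intro smooth_intros T(1) smb' smE)
  have Dw: "D (\<lambda>x. w x h) x v = (\<Sum>i\<in>UNIV. \<Sum>k\<in>UNIV. (h $ i * v $ k) *\<^sub>R partial (\<lambda>x. b x $ i *\<^sub>R E i x) k x)"
    if "x \<in> T" for x h v
  proof -
    have "D (\<lambda>x. w x h) x v = (\<Sum>i\<in>UNIV. h $ i *\<^sub>R D (\<lambda>x. b x $ i *\<^sub>R E i x) x v)"
      unfolding w_def
      by (intro fun_cong[OF D_eqI] has_derivative_sum has_derivative_scaleR_right smooth_on_D(1)[OF smbE that])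
    also have "\<dots> = (\<Sum>i\<in>UNIV. \<Sum>k\<in>UNIV. (h $ i * v $ k) *\<^sub>R partial (\<lambda>x. b x $ i *\<^sub>R E i x) k x)"
      unfolding partial_def
      by (subst linear_axis_sum[OF smooth_on_linear_D[OF smbE that], of _ v]) (simp add: scaleR_sum_right)
    finally show ?thesis .
  qed
  have sym: "partial (\<lambda>x. b x $ i *\<^sub>R E i x) k x = partial (\<lambda>x. b x $ k *\<^sub>R E k x) i x" if "x \<in> T" for x i k
  proof (cases "i = k")
    case False
    have *: "partial (\<lambda>x. b x $ i *\<^sub>R E i x) k x = b x $ i *\<^sub>R partial (E i) k x + partial (\<lambda>x. b x $ i) k x *\<^sub>R E i x" for i k
      unfolding partial_def by (intro D_scaleR smooth_on_D(1)[OF smb' that] smooth_on_D(1)[OF smE that])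
    have "x \<in> \<Omega>" using that T(2) by blast
    then show ?thesis
      using False b[of x i k] b[of x k i] E[OF that, of i k] E[OF that, of k i]
      by (simp add: * mult.commute add.commute)
  qed simp
  obtain r Y where "0 < r" "ball p r \<subseteq> T" "smooth_on (ball p r) Y"
    "\<And>x. x \<in> ball p r \<Longrightarrow> (Y has_derivative w x) (at x)"
  proof (rule closed_one_form_exact[OF T(1), of w p])
    show "linear (w x)" for x
      by (rule linearI) (auto simp: w_def algebra_simps sum.distrib scaleR_sum_right)
    show "smooth_on T (\<lambda>x. w x h)" for h
      unfolding w_def by (intro smooth_intros T(1) smbE)
    show "D (\<lambda>x. w x h) x v = D (\<lambda>x. w x v) x h" if "x \<in> T" for x h v
      unfolding Dw[OF that] by (subst sum.swap) (simp add: sym[OF that] mult.commute)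
  qed (use p in auto)
  then show ?thesis using that[of r Y] by (simp add: w_def[abs_def])
qed

end

text \<open>Reads a matrix equation \<open>dg = g \<theta>\<close> as the structure equations of the
  frame formed by the columns of \<open>g\<close>.\<close>

lemma partial_column:
  fixes g :: "real^'n::finite \<Rightarrow> real^'k::finite^'k"
  assumes "smooth_on S g" "x \<in> S" "partial g i x = g x ** \<theta>"
  shows "partial (\<lambda>y. column c (g y)) i x = (\<Sum>d\<in>UNIV. \<theta> $ d $ c *\<^sub>R column d (g x))"
proof -
  have "linear (\<lambda>M :: real^'k^'k. column c M)"
    by (rule linearI) (auto simp: column_def vec_eq_iff)
  then have "bounded_linear (\<lambda>M :: real^'k^'k. column c M)" by (simp add: linear_conv_bounded_linear)
  from D_bounded_linear[OF this smooth_on_D(1)[OF assms(1,2)]]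
  have "partial (\<lambda>y. column c (g y)) i x = column c (partial g i x)" by (simp add: partial_def)
  then show ?thesis
    by (simp add: assms(3) vec_eq_iff column_def matrix_matrix_mult_def mult.commute)
qed

lemma smooth_on_column:
  assumes "open S" "smooth_on S g" shows "smooth_on S (\<lambda>x. column c (g x))"
  unfolding column_def by (intro smooth_intros assms)

lemma inner_column:
  assumes "transpose (M :: real^'k::finite^'k) ** M = mat 1"
  shows "column c M \<bullet> column d M = (if c = d then 1 else 0)"
  using assms by (simp add: vec_eq_iff matrix_matrix_mult_def transpose_def mat_def column_def inner_vec_def)

theorem immersion_from_G_system:
  fixes A :: "real^'n::finite \<Rightarrow> real^'n^'m::finite"
  assumes \<Omega>: "open \<Omega>" and G: "G_system_I \<Omega> A F" and smb: "smooth_on \<Omega> b"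
    and b: "\<And>x i j. x \<in> \<Omega> \<Longrightarrow> i \<noteq> j \<Longrightarrow> partial (\<lambda>y. b y $ i) j x = F x $ i $ j * b x $ j"
    and p: "p \<in> \<Omega>" and b0: "\<And>i. b p $ i \<noteq> 0"
  shows "\<exists>V (Y :: real^'n \<Rightarrow> real^('m + 'n)) e.
    p \<in> V \<and> V \<subseteq> \<Omega> \<and> immersion_on V Y \<and> isometric_from_euclidean V Y \<and>
    parallel_normal_frame V Y e \<and> fundamental_forms V Y e A b"
proof -
  \<comment> \<open>The region where the metric with coefficients \<open>b_i^2\<close> is
    nondegenerate, hence where the potentials below are immersions.\<close>
  define T0 where "T0 = (\<Inter>i\<in>UNIV. {x \<in> \<Omega>. b x $ i \<noteq> 0})"
  have "open {x \<in> \<Omega>. b x $ i \<noteq> 0}" for i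
  proof -
    have "open (\<Omega> \<inter> (\<lambda>x. b x $ i) -` (- {0}))"
      by (intro continuous_open_preimage continuous_intros smooth_on_continuous_on smb \<Omega>)
    moreover have "{x \<in> \<Omega>. b x $ i \<noteq> 0} = \<Omega> \<inter> (\<lambda>x. b x $ i) -` (- {0})" by blast
    ultimately show ?thesis by simp
  qed
  then have T0: "open T0" "p \<in> T0" "T0 \<subseteq> \<Omega>" "\<And>x i. x \<in> T0 \<Longrightarrow> b x $ i \<noteq> 0"
    using p b0 by (auto simp: T0_def)
  obtain r1 and g :: "real^'n \<Rightarrow> real^('m + 'n)^('m + 'n)" where g: "0 < r1" "ball p r1 \<subseteq> \<Omega>" "smooth_on (ball p r1) g"
    "\<And>x. x \<in> ball p r1 \<Longrightarrow> transpose (g x) ** g x = mat 1"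
    "\<And>x i. x \<in> ball p r1 \<Longrightarrow> partial g i x = g x ** lax_I (A x) (F x) 1 i"
  proof (rule flat_skew_connection[OF \<Omega> lax_smooth[OF \<Omega> G] lax_flat[OF \<Omega> G] lax_I_skew p])
    fix r and g :: "real^'n \<Rightarrow> real^('m + 'n)^('m + 'n)"
    assume "0 < r" "ball p r \<subseteq> \<Omega>" "smooth_on (ball p r) g"
      "\<And>x. x \<in> ball p r \<Longrightarrow> transpose (g x) ** g x = mat 1"
      "\<And>x i. x \<in> ball p r \<Longrightarrow> partial g i x = g x ** lax_I (A x) (F x) 1 i"
    then show thesis by (rule that)
  qed
  \<comment> \<open>A second frame, in dimension n, for the tangential block alone; it plays for the
    Euclidean coordinates the role that \<open>g\<close> plays for the immersion.\<close>
  obtain r2 and h :: "real^'n \<Rightarrow> real^'n^'n" where h: "0 < r2" "ball p r2 \<subseteq> \<Omega>" "smooth_on (ball p r2) h"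
    "\<And>x. x \<in> ball p r2 \<Longrightarrow> transpose (h x) ** h x = mat 1"
    "\<And>x i. x \<in> ball p r2 \<Longrightarrow> partial h i x = h x ** rotation_form (F x) i"
  proof (rule flat_skew_connection[OF \<Omega> rotation_form_smooth[OF \<Omega> G] rotation_form_flat[OF \<Omega> G] rotation_form_skew p])
    fix r and g :: "real^'n \<Rightarrow> real^'n^'n"
    assume "0 < r" "ball p r \<subseteq> \<Omega>" "smooth_on (ball p r) g"
      "\<And>x. x \<in> ball p r \<Longrightarrow> transpose (g x) ** g x = mat 1"
      "\<And>x i. x \<in> ball p r \<Longrightarrow> partial g i x = g x ** rotation_form (F x) i"
    then show thesis by (rule that)
  qed
  define e where "e j x = column (Inl j) (g x)" for j x
  define E where "E i x = column (Inr i) (g x)" for i x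
  define H where "H i x = column i (h x)" for i x
  have sme: "smooth_on (ball p r1) (e j)" and smE: "smooth_on (ball p r1) (E i)" for i j
    unfolding e_def[abs_def] E_def[abs_def] by (intro smooth_on_column open_ball g)+
  have smH: "smooth_on (ball p r2) (H i)" for i
    unfolding H_def[abs_def] by (intro smooth_on_column open_ball h)
  have pe: "partial (e j) k x = A x $ j $ k *\<^sub>R E k x" if "x \<in> ball p r1" for j k x
    unfolding e_def[abs_def] partial_column[OF g(3) that g(5)[OF that]] E_def
    by (simp add: sum_UNIV_Plus lax_I_nth if_distrib[of scaleR] if_distribR cong: if_cong)
  have pE: "partial (E i) k x = F x $ k $ i *\<^sub>R E k x" if "x \<in> ball p r1" "i \<noteq> k" for i k x
    unfolding E_def[abs_def] partial_column[OF g(3) that(1) g(5)[OF that(1)]]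
    using that(2) by (simp add: sum_UNIV_Plus lax_I_nth if_distrib[of scaleR] if_distribR cong: if_cong)
  have pH: "partial (H i) k x = F x $ k $ i *\<^sub>R H k x" if "x \<in> ball p r2" "i \<noteq> k" for i k x
    unfolding H_def[abs_def] partial_column[OF h(3) that(1) h(5)[OF that(1)]]
    using that(2) by (simp add: rotation_form_def if_distrib[of scaleR] if_distribR cong: if_cong)
  obtain r3 Y where Y: "0 < r3" "ball p r3 \<subseteq> ball p r1" "smooth_on (ball p r3) Y"
    "\<And>x. x \<in> ball p r3 \<Longrightarrow> (Y has_derivative (\<lambda>h. \<Sum>i\<in>UNIV. (h $ i * b x $ i) *\<^sub>R E i x)) (at x)"
    by (rule coordinate_frame_potential[OF \<Omega> G open_ball g(2) smb smE b pE centre_in_ball[THEN iffD2, OF g(1)]])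
      blast+
  \<comment> \<open>The coefficients \<open>b\<close> are the same for \<open>Y\<close> and
    \<open>z\<close> and both frames are orthonormal, so both potentials induce the same
    metric.\<close>
  obtain r4 z where z: "0 < r4" "ball p r4 \<subseteq> ball p r2" "smooth_on (ball p r4) z"
    "\<And>x. x \<in> ball p r4 \<Longrightarrow> (z has_derivative (\<lambda>h. \<Sum>i\<in>UNIV. (h $ i * b x $ i) *\<^sub>R H i x)) (at x)"
    by (rule coordinate_frame_potential[OF \<Omega> G open_ball h(2) smb smH b pH centre_in_ball[THEN iffD2, OF h(1)]])
      blast+
  define T where "T = T0 \<inter> ball p r3 \<inter> ball p r4"
  have T: "open T" "p \<in> T" "T \<subseteq> T0" "T \<subseteq> ball p r3" "T \<subseteq> ball p r1" "T \<subseteq> ball p r4" "T \<subseteq> ball p r2"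
    using T0 Y(1,2) z(1,2) by (auto simp: T_def)
  have DY: "D Y x u = (\<Sum>i\<in>UNIV. (u $ i * b x $ i) *\<^sub>R E i x)" if "x \<in> T" for x u
    using fun_cong[OF D_eqI[OF Y(4)]] that T by blast
  have Dz: "D z x u = (\<Sum>i\<in>UNIV. (u $ i * b x $ i) *\<^sub>R H i x)" if "x \<in> T" for x u
    using fun_cong[OF D_eqI[OF z(4)]] that T by blast
  have on: "E i x \<bullet> E k x = (if i = k then 1 else 0)" "e j x \<bullet> e l x = (if j = l then 1 else 0)" "E i x \<bullet> e j x = 0"
    if "x \<in> T" for i k j l x
    using inner_column[OF g(4)] that T unfolding e_def E_def by auto
  have onH: "H i x \<bullet> H k x = (if i = k then 1 else 0)" if "x \<in> T" for i k x
    using inner_column[OF h(4)] that T unfolding H_def by auto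
  have DYDY: "D Y x u \<bullet> D Y x w = (\<Sum>i\<in>UNIV. (b x $ i)\<^sup>2 * u $ i * w $ i)" if "x \<in> T" for x u w
    by (simp add: DY[OF that] inner_sum_left inner_sum_right on[OF that] if_distrib power2_eq_square mult_ac cong: if_cong)
  have DzDz: "D z x u \<bullet> D z x w = (\<Sum>i\<in>UNIV. (b x $ i)\<^sup>2 * u $ i * w $ i)" if "x \<in> T" for x u w
    by (simp add: Dz[OF that] inner_sum_left inner_sum_right onH[OF that] if_distrib power2_eq_square mult_ac cong: if_cong)
  have inj: "inj L" if L: "linear L" "\<And>u. L u \<bullet> L u = (\<Sum>i\<in>UNIV. (b x $ i)\<^sup>2 * u $ i * u $ i)" and x: "x \<in> T"
    for L :: "real^'n \<Rightarrow> real^'k::finite" and x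
    unfolding linear_injective_0[OF L(1)]
  proof (intro allI impI)
    fix u assume "L u = 0"
    then have "(\<Sum>i\<in>UNIV. (b x $ i * u $ i)\<^sup>2) = 0" using L(2)[of u] by (simp add: power2_eq_square mult_ac)
    then have "b x $ i * u $ i = 0" for i by (simp add: sum_nonneg_eq_0_iff)
    then show "u = 0" using T0(4) T(3) x by (auto simp: vec_eq_iff)
  qed
  have smz: "smooth_on T z" and smY: "smooth_on T Y" and sme': "smooth_on T (e j)" for j
    using z(3) Y(3) sme T smooth_on_subset by blast+
  \<comment> \<open>The local inverse of \<open>z\<close> is the change to Euclidean coordinates, in
    which \<open>Y\<close> induces the standard metric.\<close>
  obtain \<rho> \<psi> where \<psi>: "0 < \<rho>" "smooth_on (ball (z p) \<rho>) \<psi>" "\<psi> ` ball (z p) \<rho> \<subseteq> T" "\<psi> (z p) = p"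
    "\<And>y. y \<in> ball (z p) \<rho> \<Longrightarrow> z (\<psi> y) = y" "open (\<psi> ` ball (z p) \<rho>)"
    using smooth_inverse_function[OF T(1) smz T(2) inj[OF smooth_on_linear_D[OF smz T(2)] DzDz T(2)]] T(2) by metis
  define V where "V = \<psi> ` ball (z p) \<rho>"
  have V: "open V" "V \<subseteq> T" using \<psi> by (auto simp: V_def)
  have pV: "p \<in> V" unfolding V_def using \<psi>(1,4) by (intro image_eqI[of _ _ "z p"]) simp_all
  have "immersion_on V Y"
    using V smooth_on_subset[OF smY V(2)] inj[OF smooth_on_linear_D[OF smY] DYDY]
    by (auto simp: immersion_on_def)
  moreover have "isometric_from_euclidean V Y"
    unfolding isometric_from_euclidean_def
  proof (intro exI conjI ballI allI)
    show "diffeo \<psi> (ball (z p) \<rho>) V"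
      unfolding diffeo_def using \<psi> V smooth_on_subset[OF smz V(2)] by (auto simp: V_def)
    fix y u w assume y: "y \<in> ball (z p) \<rho>"
    have \<psi>T: "\<psi> y \<in> T" using y \<psi>(3) by blast
    note d\<psi> = smooth_on_D(1)[OF \<psi>(2) y]
    have "D (z \<circ> \<psi>) y = (\<lambda>u. u)"
      using D_cong_open[OF open_ball y, of "z \<circ> \<psi>" "\<lambda>y. y"] \<psi>(5) by simp
    then have "D z (\<psi> y) (D \<psi> y u) = u" for u
      using D_compose[OF d\<psi> smooth_on_D(1)[OF smz \<psi>T], of u] by simp
    moreover have "D (Y \<circ> \<psi>) y u = D Y (\<psi> y) (D \<psi> y u)" for u
      by (rule D_compose[OF d\<psi> smooth_on_D(1)[OF smY \<psi>T]])
    ultimately show "first_ff (Y \<circ> \<psi>) y u w = u \<bullet> w"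
      using DYDY[OF \<psi>T, of "D \<psi> y u" "D \<psi> y w"] DzDz[OF \<psi>T, of "D \<psi> y u" "D \<psi> y w"]
      by (simp add: first_ff_def)
  qed
  moreover have "parallel_normal_frame V Y e"
    unfolding parallel_normal_frame_def
  proof (intro conjI allI ballI)
    show "smooth_on V (e j)" for j by (rule smooth_on_subset[OF sme' V(2)])
    fix x j assume "x \<in> V"
    then have x: "x \<in> T" using V by blast
    show "e j x \<in> normal_space Y x"
      by (simp add: normal_space_def DY[OF x] inner_sum_left on[OF x])
    show "e j x \<bullet> e l x = (if j = l then 1 else 0)" for l by (rule on(2)[OF x])
    have "partial (e j) k x \<in> range (D Y x)" for k
    proof -
      have "D Y x (axis k (A x $ j $ k / b x $ k)) = A x $ j $ k *\<^sub>R E k x"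
        using T0(4)[of x k] T(3) x by (simp add: DY axis_def if_distrib if_distribR subset_iff cong: if_cong)
      then show ?thesis using pe[of x j k] x T(5) by (metis rangeI subsetD)
    qed
    then show "normal_deriv Y k (e j) x = 0" for k
      unfolding normal_deriv_def normal_part_eq_0_iff[OF smooth_on_linear_D[OF smY x]] .
  qed
  moreover have "fundamental_forms V Y e A b"
    unfolding fundamental_forms_def
  proof (intro ballI allI conjI)
    fix x u w assume "x \<in> V"
    then have x: "x \<in> T" using V by blast
    show "first_ff Y x u w = (\<Sum>i\<in>UNIV. (b x $ i)\<^sup>2 * u $ i * w $ i)"
      unfolding first_ff_def by (rule DYDY[OF x])
    have De: "D (e j) x w = (\<Sum>k\<in>UNIV. (w $ k * A x $ j $ k) *\<^sub>R E k x)" for j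
      using linear_axis_sum[OF smooth_on_linear_D[OF sme' x], of j w] pe[of x j] x T(5)
      by (auto simp: partial_def)
    have "D Y x u \<bullet> D (e j) x w = (\<Sum>i\<in>UNIV. b x $ i * A x $ j $ i * u $ i * w $ i)" for j
      by (simp add: De DY[OF x] inner_sum_left inner_sum_right on[OF x] if_distrib mult_ac cong: if_cong)
    then show "second_ff Y e x u w = (\<Sum>i\<in>UNIV. \<Sum>j\<in>UNIV. (b x $ i * A x $ j $ i * u $ i * w $ i) *\<^sub>R e j x)"
      by (simp add: second_ff_def scaleR_sum_left) (rule sum.swap)
  qed
  ultimately show ?thesis
    using pV V T(3) T0(3) by (intro exI[of _ V] exI[of _ Y] exI[of _ e]) blast
qed

section \<open>The equations of Gauss and Ricci\<close>

lemma orthonormal_span_expand: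
  fixes e :: "'m::finite \<Rightarrow> 'a::euclidean_space"
  assumes e: "\<And>j l. e j \<bullet> e l = (if j = l then 1 else 0)" and v: "v \<in> span (range e)"
  shows "v = (\<Sum>j\<in>UNIV. (v \<bullet> e j) *\<^sub>R e j)"
proof -
  define w where "w = v - (\<Sum>j\<in>UNIV. (v \<bullet> e j) *\<^sub>R e j)"
  have "w \<bullet> e l = 0" for l
    by (simp add: w_def inner_diff_left inner_sum_left e if_distrib cong: if_cong)
  then have "\<And>u. u \<in> range e \<Longrightarrow> orthogonal w u" by (auto simp: orthogonal_def)
  moreover have "w \<in> span (range e)"
    unfolding w_def by (intro span_diff v span_sum span_scale span_base) auto
  ultimately have "orthogonal w w" by (metis orthogonal_to_span)
  then show ?thesis by (simp add: w_def orthogonal_self)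
qed

locale framed_immersion =
  fixes U :: "(real^'n::finite) set" and X :: "real^'n \<Rightarrow> real^('m::finite + 'n)"
    and e :: "'m \<Rightarrow> real^'n \<Rightarrow> real^('m + 'n)"
  assumes im: "immersion_on U X" and frame: "parallel_normal_frame U X e"
begin

lemma U: "open U" and smX: "smooth_on U X" and injX: "x \<in> U \<Longrightarrow> inj (D X x)"
  using im by (auto simp: immersion_on_def)

lemma sme: "smooth_on U (e j)"
  and ee: "x \<in> U \<Longrightarrow> e j x \<bullet> e l x = (if j = l then 1 else 0)"
  and Xe: "x \<in> U \<Longrightarrow> D X x u \<bullet> e j x = 0"
  using frame by (auto simp: parallel_normal_frame_def normal_space_def)

lemma linX: "x \<in> U \<Longrightarrow> linear (D X x)" and line: "x \<in> U \<Longrightarrow> linear (D (e j) x)"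
  using smooth_on_linear_D smX sme by blast+

lemma e_tangent: "x \<in> U \<Longrightarrow> D (e j) x u \<in> range (D X x)"
  using parallel_normal_frame_D_tangent[OF im frame] .

lemma ee': "x \<in> U \<Longrightarrow> D (e j) x u \<bullet> e l x = 0"
  using e_tangent[of x j u] Xe by auto

lemma smDX: "smooth_on U (\<lambda>x. D X x u)" and smDe: "smooth_on U (\<lambda>x. D (e j) x u)"
  using smooth_on_D(2) smX sme by blast+

text \<open>Moving the derivative from \<open>e j\<close> to \<open>X\<close> leaves a second
  derivative of \<open>X\<close>, which is symmetric.\<close>

lemma e_self_adjoint:
  assumes x: "x \<in> U" shows "D (e j) x u \<bullet> D X x w = D (e j) x w \<bullet> D X x u"
proof -
  have "D (e j) x u \<bullet> D X x w = - (e j x \<bullet> D (\<lambda>y. D X y w) x u)" for u w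
    by (rule D_inner_const[OF U x sme smDX, where c = 0]) (metis Xe inner_commute)
  then show ?thesis using smooth_on_D_commute[OF U smX x] by simp
qed

text \<open>Along a parallel frame \<open>D (e j)\<close> is orthogonal to every \<open>e l\<close>.
  Differentiating this and using the symmetry of the second derivatives of \<open>e j\<close> gives
  the Ricci equation with zero normal curvature.\<close>

lemma Ricci:
  assumes x: "x \<in> U" shows "D (e j) x u \<bullet> D (e l) x w = D (e j) x w \<bullet> D (e l) x u"
proof -
  have "D (\<lambda>y. D (e j) y u) x w \<bullet> e l x = - (D (e j) x u \<bullet> D (e l) x w)" for u w
    by (rule D_inner_const[OF U x smDe sme ee'])
  then show ?thesis using smooth_on_D_commute[OF U sme x, of j u w] by (metis minus_equation_iff)
qed

lemma tangent_eqI: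
  assumes x: "x \<in> U" and "\<And>w. D X x u \<bullet> D X x w = D X x v \<bullet> D X x w"
  shows "u = v"
proof -
  have "D X x (u - v) \<bullet> D X x (u - v) = 0"
    using assms(2)[of "u - v"] linear_diff[OF linX[OF x]] by (simp add: inner_diff_left)
  then have "D X x u = D X x v" using linear_diff[OF linX[OF x]] by simp
  then show ?thesis using injX[OF x] by (simp add: inj_eq)
qed

text \<open>The metric as an operator on coordinate space, so that \<open>linear_family\<close>
  provides a smooth inverse.\<close>

definition gram :: "real^'n \<Rightarrow> real^'n \<Rightarrow> real^'n" where
  "gram x u = (\<chi> i. D X x u \<bullet> D X x (axis i 1))"

lemma linear_gram: "x \<in> U \<Longrightarrow> linear (gram x)"
  using linX by (intro linearI) (auto simp: gram_def vec_eq_iff linear_add linear_scale inner_add_left)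

lemma gram_inner: assumes x: "x \<in> U" shows "gram x u \<bullet> w = D X x u \<bullet> D X x w"
  unfolding linear_axis_sum[OF linX[OF x], of w] inner_vec_def[of "gram x u"]
  by (simp add: gram_def inner_sum_right mult.commute)

lemma linear_family_gram: "linear_family U gram"
proof (rule linear_family.intro)
  show "inj (gram x)" if x: "x \<in> U" for x
    by (rule injI, rule tangent_eqI[OF x]) (metis gram_inner[OF x])
  show "smooth_on U (\<lambda>x. gram x w)" for w
    unfolding gram_def by (intro smooth_intros U smDX)
qed (fact U linear_gram)+

sublocale gram: linear_family U gram
  by (rule linear_family_gram)

text \<open>The shape operator of \<open>e j\<close> in coordinates, that is, the tangent preimage
  of \<open>D (e j) x u\<close>, with the sign convention of \<open>second_ff\<close>. The inverse
  of \<open>gram\<close> makes its smoothness visible.\<close>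

definition shape :: "'m \<Rightarrow> real^'n \<Rightarrow> real^'n \<Rightarrow> real^'n" where
  "shape j x u = inv (gram x) (\<chi> i. D (e j) x u \<bullet> D X x (axis i 1))"

lemma DX_shape: assumes x: "x \<in> U" shows "D X x (shape j x u) = D (e j) x u"
proof -
  obtain z where z: "D (e j) x u = D X x z" using e_tangent[OF x] by blast
  have "shape j x u = inv (gram x) (gram x z)" by (simp add: shape_def z gram_def)
  then show ?thesis by (simp add: gram.inv_M_eq[OF x] z)
qed

lemma linear_shape: assumes x: "x \<in> U" shows "linear (shape j x)"
proof (rule linearI)
  show "shape j x (u + v) = shape j x u + shape j x v" for u v
    by (rule tangent_eqI[OF x]) (simp add: DX_shape[OF x] linear_add[OF linX[OF x]] linear_add[OF line[OF x]])
  show "shape j x (c *\<^sub>R u) = c *\<^sub>R shape j x u" for c u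
    by (rule tangent_eqI[OF x]) (simp add: DX_shape[OF x] linear_scale[OF linX[OF x]] linear_scale[OF line[OF x]])
qed

lemma smooth_shape: "smooth_on U (\<lambda>x. shape j x u)"
proof (rule smooth_on_cong[OF _ U])
  show "(\<Sum>c\<in>Basis. ((\<chi> i. D (e j) x u \<bullet> D X x (axis i 1)) \<bullet> c) *\<^sub>R inv (gram x) c) = shape j x u" if "x \<in> U" for x
    unfolding shape_def by (rule linear_Basis_sum[OF gram.linear_inv[OF that], symmetric])
  show "smooth_on U (\<lambda>x. \<Sum>c\<in>Basis. ((\<chi> i. D (e j) x u \<bullet> D X x (axis i 1)) \<bullet> c) *\<^sub>R inv (gram x) c)"
    by (intro smooth_intros U smDX smDe gram.smooth_on_inv)
qed

text \<open>Paired with a tangent vector and made symmetric by self-adjointness, the two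
  compositions are the two sides of \<open>Ricci\<close>.\<close>

lemma shape_commute: assumes x: "x \<in> U" shows "shape j x (shape l x u) = shape l x (shape j x u)"
proof (rule tangent_eqI[OF x])
  have "D X x (shape j x (shape l x u)) \<bullet> D X x w = D (e j) x w \<bullet> D (e l) x u" for j l w
    by (simp add: DX_shape[OF x] e_self_adjoint[OF x, of j "shape l x u"])
  then show "D X x (shape j x (shape l x u)) \<bullet> D X x w = D X x (shape l x (shape j x u)) \<bullet> D X x w" for w
    using Ricci[OF x, of j w l u] by (simp add: inner_commute)
qed

text \<open>The normal space has dimension m by orthogonality to the n-dimensional tangent space, so
  m orthonormal normal vectors span it.\<close>

lemma normal_expand:
  assumes x: "x \<in> U" and v: "v \<in> normal_space X x"
  shows "v = (\<Sum>j\<in>UNIV. (v \<bullet> e j x) *\<^sub>R e j x)"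
proof (rule orthonormal_span_expand[OF ee[OF x]])
  let ?E = "range (\<lambda>j. e j x)"
  have N: "normal_space X x = {y \<in> UNIV. \<forall>u\<in>range (D X x). orthogonal u y}"
    by (auto simp: normal_space_def orthogonal_def)
  have "dim (normal_space X x) + dim (range (D X x)) = DIM(real^('m + 'n))"
    unfolding N using dim_subspace_orthogonal_to_vectors[OF linear_subspace_image[OF linX[OF x] subspace_UNIV] subspace_UNIV]
    by simp
  moreover have "dim (range (D X x)) = CARD('n)"
    using dim_image_eq[OF linX[OF x], of UNIV] injX[OF x] by simp
  ultimately have dimN: "dim (normal_space X x) = CARD('m)" by simp
  have inj: "inj (\<lambda>j. e j x)"
  proof (rule injI)
    fix j l assume "e j x = e l x"
    then have "e j x \<bullet> e l x = 1" using ee[OF x, of l l] by simp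
    then show "j = l" using ee[OF x, of j l] by (simp split: if_splits)
  qed
  have "pairwise orthogonal ?E" by (auto simp: pairwise_def orthogonal_def ee[OF x])
  moreover have "e j x \<noteq> 0" for j using ee[OF x, of j j] by auto
  then have "0 \<notin> ?E" by force
  ultimately have ind: "independent ?E" by (rule pairwise_orthogonal_independent)
  have "?E \<subseteq> normal_space X x" using Xe[OF x] by (auto simp: normal_space_def)
  then have "normal_space X x \<subseteq> span ?E"
    using ind by (rule card_ge_dim_independent) (simp add: dimN card_image[OF inj])
  then show "v \<in> span ?E" using v by blast
qed

lemma normal_inner:
  assumes x: "x \<in> U" and v: "v \<in> normal_space X x"
  shows "v \<bullet> w = (\<Sum>j\<in>UNIV. (v \<bullet> e j x) * (w \<bullet> e j x))"
  by (subst normal_expand[OF x v]) (simp add: inner_sum_left inner_commute[of w])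

section \<open>Christoffel symbols, second derivatives and the Gauss equation\<close>

abbreviation g :: "real^'n \<Rightarrow> real^'n^'n" where "g \<equiv> metric_matrix X"

abbreviation X2 :: "'n \<Rightarrow> 'n \<Rightarrow> real^'n \<Rightarrow> real^('m + 'n)" where "X2 i j \<equiv> partial (partial X j) i"

lemma smX1: "smooth_on U (partial X i)"
  unfolding partial_def[abs_def] by (rule smDX)

lemma smooth_partial: "smooth_on U f \<Longrightarrow> smooth_on U (partial f i)"
  unfolding partial_def[abs_def] by (rule smooth_on_D(2))

lemma g_nth: "g x $ i $ j = partial X i x \<bullet> partial X j x"
  by (simp add: metric_matrix_def first_ff_def partial_def)

lemma g_sym: "g x $ i $ j = g x $ j $ i"
  by (simp add: g_nth inner_commute)

lemma X2_sym: "x \<in> U \<Longrightarrow> X2 i j x = X2 j i x"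
  using smooth_on_D_commute[OF U smX, of x] by (simp add: partial_def[abs_def])

lemma g_mult: assumes "x \<in> U" shows "g x *v u = gram x u"
  unfolding vec_eq_iff
proof
  fix i
  have "gram x u $ i = D X x (axis i 1) \<bullet> D X x u" by (simp add: gram_def inner_commute)
  also have "\<dots> = (g x *v u) $ i"
    unfolding linear_axis_sum[OF linX[OF assms], of u]
    by (simp add: matrix_vector_mult_def g_nth partial_def inner_sum_right mult.commute)
  finally show "(g x *v u) $ i = gram x u $ i" by simp
qed

lemma g_inverse:
  assumes x: "x \<in> U"
  shows "matrix_inv (g x) ** g x = mat 1" "matrix_inv (g x) *v u = inv (gram x) u"
proof -
  have "inj ((*v) (g x))" unfolding g_mult[OF x, abs_def] by (rule gram.injM[OF x])
  then have "invertible (g x)"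
    by (meson invertible_left_inverse matrix_left_invertible_injective)
  then show *: "matrix_inv (g x) ** g x = mat 1" by (rule matrix_inv_left)
  have "matrix_inv (g x) *v (g x *v inv (gram x) u) = inv (gram x) u"
    by (simp add: matrix_vector_mul_assoc * matrix_vector_mul_lid)
  then show "matrix_inv (g x) *v u = inv (gram x) u"
    unfolding g_mult[OF x] gram.inv_M[OF x] .
qed

lemma smooth_g_inverse: "smooth_on U (\<lambda>x. matrix_inv (g x) $ l $ p)"
proof (rule smooth_on_cong[OF _ U])
  show "inv (gram x) (axis p 1) $ l = matrix_inv (g x) $ l $ p" if "x \<in> U" for x
    unfolding g_inverse(2)[OF that, symmetric]
    by (simp add: matrix_vector_mult_def axis_def if_distrib cong: if_cong)
  show "smooth_on U (\<lambda>x. inv (gram x) (axis p 1) $ l)"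
    by (intro smooth_intros U gram.smooth_on_inv)
qed

text \<open>The derivatives of the metric give six products of first and second derivatives of
  \<open>X\<close>; by symmetry of the latter four cancel and two agree.\<close>

lemma christoffel_eq:
  assumes x: "x \<in> U"
  shows "christoffel g j k l x = (\<Sum>p\<in>UNIV. matrix_inv (g x) $ l $ p * (X2 j k x \<bullet> partial X p x))"
proof -
  have dg: "partial (\<lambda>y. g y $ j $ k) i x = partial X j x \<bullet> X2 i k x + X2 i j x \<bullet> partial X k x" for i j k
    unfolding g_nth
    unfolding partial_def by (intro D_inner smooth_on_D(1)[OF smDX x])
  have "partial (\<lambda>y. g y $ k $ p) j x + partial (\<lambda>y. g y $ j $ p) k x - partial (\<lambda>y. g y $ j $ k) p x
      = 2 * (X2 j k x \<bullet> partial X p x)" for p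
    unfolding dg using X2_sym[OF x, of k j] X2_sym[OF x, of p j] X2_sym[OF x, of p k]
    by (simp add: inner_commute)
  then show ?thesis by (simp add: christoffel_def sum_distrib_left mult_ac)
qed

lemma smooth_christoffel: "smooth_on U (christoffel g j k l)"
proof (rule smooth_on_cong[OF _ U christoffel_eq[symmetric]])
  show "smooth_on U (\<lambda>x. \<Sum>p\<in>UNIV. matrix_inv (g x) $ l $ p * (X2 j k x \<bullet> partial X p x))"
    by (intro smooth_intros U smooth_g_inverse smooth_partial smX1)
qed

lemma christoffel_g:
  assumes x: "x \<in> U"
  shows "(\<Sum>l\<in>UNIV. christoffel g j k l x * g x $ l $ q) = X2 j k x \<bullet> partial X q x"
proof -
  have 1: "(\<Sum>l\<in>UNIV. g x $ q $ l * matrix_inv (g x) $ l $ p) = (if q = p then 1 else 0)" for p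
    using g_inverse(1)[OF x] matrix_left_right_inverse[of "matrix_inv (g x)" "g x"]
    by (simp add: vec_eq_iff matrix_matrix_mult_def mat_def)
  have "(\<Sum>l\<in>UNIV. christoffel g j k l x * g x $ l $ q)
      = (\<Sum>l\<in>UNIV. \<Sum>p\<in>UNIV. (X2 j k x \<bullet> partial X p x) * (g x $ q $ l * matrix_inv (g x) $ l $ p))"
    unfolding christoffel_eq[OF x] sum_distrib_right by (simp add: g_sym[of x _ q] mult_ac)
  also have "\<dots> = (\<Sum>p\<in>UNIV. (X2 j k x \<bullet> partial X p x) * (\<Sum>l\<in>UNIV. g x $ q $ l * matrix_inv (g x) $ l $ p))"
    by (subst sum.swap) (simp add: sum_distrib_left)
  also have "\<dots> = X2 j k x \<bullet> partial X q x" unfolding 1 by (simp add: if_distrib cong: if_cong)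
  finally show ?thesis .
qed

text \<open>The Gauss formula: the Christoffel terms are the tangential part of the second
  derivatives, and \<open>N\<close> is what remains.\<close>

definition N :: "'n \<Rightarrow> 'n \<Rightarrow> real^'n \<Rightarrow> real^('m + 'n)" where
  "N j k x = X2 j k x - (\<Sum>l\<in>UNIV. christoffel g j k l x *\<^sub>R partial X l x)"

lemma N_X: "x \<in> U \<Longrightarrow> N j k x \<bullet> partial X q x = 0"
  by (simp add: N_def inner_diff_left inner_sum_left christoffel_g flip: g_nth)

lemma N_normal: assumes "x \<in> U" shows "N j k x \<in> normal_space X x"
  unfolding normal_space_def mem_Collect_eq
proof
  show "D X x u \<bullet> N j k x = 0" for u
    using N_X[OF assms, of j k, unfolded inner_commute[of "N j k x"]]
    unfolding linear_axis_sum[OF linX[OF assms], of u] partial_def by (simp add: inner_sum_left)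
qed

lemma smooth_N: "smooth_on U (N j k)"
  unfolding N_def[abs_def] by (intro smooth_intros U smooth_christoffel smooth_partial smX)

lemma N_e:
  assumes x: "x \<in> U" shows "N j k x \<bullet> e \<alpha> x = - (D (e \<alpha>) x (axis j 1) \<bullet> D X x (axis k 1))"
proof -
  have "X2 j k x \<bullet> e \<alpha> x = - (partial X k x \<bullet> partial (e \<alpha>) j x)"
    unfolding partial_def[abs_def] by (rule D_inner_const[OF U x smDX sme Xe])
  moreover have "partial X l x \<bullet> e \<alpha> x = 0" for l by (simp add: partial_def Xe[OF x])
  ultimately show ?thesis
    by (simp add: N_def inner_diff_left inner_sum_left) (simp add: partial_def inner_commute)
qed

text \<open>Third derivatives of \<open>X\<close> are symmetric in \<open>i, j\<close>. Computing
  their tangential components from the Gauss formula and antisymmetrizing leaves the curvature with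
  lowered index against products of \<open>N\<close>.\<close>

lemma riemann_g:
  assumes x: "x \<in> U"
  shows "(\<Sum>l\<in>UNIV. riemann g i j k l x * g x $ l $ q) = N j k x \<bullet> N i q x - N i k x \<bullet> N j q x"
proof -
  let ?\<Gamma> = "christoffel g"
  have X2N: "X2 j k y = (\<Sum>l\<in>UNIV. ?\<Gamma> j k l y *\<^sub>R partial X l y) + N j k y" for j k y
    by (simp add: N_def)
  have dN: "partial (N j k) i x \<bullet> partial X q x = - (N j k x \<bullet> N i q x)" for i j k
  proof -
    have "partial (N j k) i x \<bullet> partial X q x = - (N j k x \<bullet> X2 i q x)"
      unfolding partial_def[of "N j k"] partial_def[of "partial X q"]
      by (rule D_inner_const[OF U x smooth_N smX1 N_X])
    also have "N j k x \<bullet> X2 i q x = N j k x \<bullet> N i q x"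
      by (simp add: X2N[where j = i and k = q] inner_add_right inner_sum_right N_X[OF x])
    finally show ?thesis .
  qed
  have "partial (X2 j k) i x \<bullet> partial X q x =
      (\<Sum>l\<in>UNIV. (partial (?\<Gamma> j k l) i x + (\<Sum>p\<in>UNIV. ?\<Gamma> j k p x * ?\<Gamma> i p l x)) * g x $ l $ q) - N j k x \<bullet> N i q x" for i j k
  proof -
    have "partial (X2 j k) i x = (\<Sum>l\<in>UNIV. ?\<Gamma> j k l x *\<^sub>R X2 i l x + partial (?\<Gamma> j k l) i x *\<^sub>R partial X l x) + partial (N j k) i x"
    proof -
      have der: "((\<lambda>y. (\<Sum>l\<in>UNIV. ?\<Gamma> j k l y *\<^sub>R partial X l y) + N j k y) has_derivative
        (\<lambda>h. (\<Sum>l\<in>UNIV. ?\<Gamma> j k l x *\<^sub>R D (partial X l) x h + D (?\<Gamma> j k l) x h *\<^sub>R partial X l x) + D (N j k) x h)) (at x)"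
        by (intro has_derivative_add has_derivative_sum has_derivative_scaleR smooth_on_D(1)[OF smooth_N x]
          smooth_on_D(1)[OF smX1 x] smooth_on_D(1)[OF smooth_christoffel x])
      have "X2 j k = (\<lambda>y. (\<Sum>l\<in>UNIV. ?\<Gamma> j k l y *\<^sub>R partial X l y) + N j k y)"
        by (simp add: N_def)
      then have "partial (X2 j k) i x = D (\<lambda>y. (\<Sum>l\<in>UNIV. ?\<Gamma> j k l y *\<^sub>R partial X l y) + N j k y) x (axis i 1)"
        by (simp only: partial_def)
      also have "\<dots> = (\<Sum>l\<in>UNIV. ?\<Gamma> j k l x *\<^sub>R X2 i l x + partial (?\<Gamma> j k l) i x *\<^sub>R partial X l x) + partial (N j k) i x"
        unfolding D_eqI[OF der] by (simp only: partial_def)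
      finally show ?thesis .
    qed
    then have "partial (X2 j k) i x \<bullet> partial X q x
      = (\<Sum>l\<in>UNIV. ?\<Gamma> j k l x * (X2 i l x \<bullet> partial X q x)) + (\<Sum>l\<in>UNIV. partial (?\<Gamma> j k l) i x * g x $ l $ q) - N j k x \<bullet> N i q x"
      by (simp add: inner_add_left inner_sum_left sum.distrib dN g_nth)
    also have "(\<Sum>l\<in>UNIV. ?\<Gamma> j k l x * (X2 i l x \<bullet> partial X q x)) = (\<Sum>l\<in>UNIV. (\<Sum>p\<in>UNIV. ?\<Gamma> j k p x * ?\<Gamma> i p l x) * g x $ l $ q)"
      unfolding christoffel_g[OF x, symmetric] sum_distrib_left sum_distrib_right
      by (subst sum.swap) (simp add: mult_ac)
    finally show ?thesis by (simp add: distrib_right sum.distrib)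
  qed
  moreover have "partial (X2 j k) i x = partial (X2 i k) j x"
    using smooth_on_D_commute[OF U smooth_partial[OF smX, of k] x] by (simp add: partial_def[abs_def])
  ultimately have "(\<Sum>l\<in>UNIV. (partial (?\<Gamma> j k l) i x + (\<Sum>p\<in>UNIV. ?\<Gamma> j k p x * ?\<Gamma> i p l x)) * g x $ l $ q) - N j k x \<bullet> N i q x
    = (\<Sum>l\<in>UNIV. (partial (?\<Gamma> i k l) j x + (\<Sum>p\<in>UNIV. ?\<Gamma> i k p x * ?\<Gamma> j p l x)) * g x $ l $ q) - N i k x \<bullet> N j q x"
    by metis
  then show ?thesis
    by (simp add: riemann_def sum_subtractf algebra_simps sum.distrib)
qed

text \<open>The second fundamental form is \<open>h\<^sub>\<alpha>(u,w) = \<langle>de\<^sub>\<alpha>(u), dX(w)\<rangle>\<close>.\<close>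

lemma Gauss:
  assumes flat: "flat_induced_metric U X" and x: "x \<in> U"
  shows "(\<Sum>\<alpha>\<in>UNIV. (D (e \<alpha>) x u \<bullet> D X x v) * (D (e \<alpha>) x w \<bullet> D X x z))
    = (\<Sum>\<alpha>\<in>UNIV. (D (e \<alpha>) x w \<bullet> D X x v) * (D (e \<alpha>) x u \<bullet> D X x z))"
proof -
  define Q where "Q u v w z = (\<Sum>\<alpha>\<in>UNIV. (D (e \<alpha>) x u \<bullet> D X x v) * (D (e \<alpha>) x w \<bullet> D X x z))" for u v w z
  define R where "R u v w z = Q u v w z - Q w v u z" for u v w z
  have 0: "R (axis j 1) (axis k 1) (axis i 1) (axis q 1) = 0" for j k i q
  proof -
    have "N j k x \<bullet> N i q x = (\<Sum>\<alpha>\<in>UNIV. (D (e \<alpha>) x (axis j 1) \<bullet> D X x (axis k 1))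
        * (D (e \<alpha>) x (axis i 1) \<bullet> D X x (axis q 1)))" for i j
      by (subst normal_inner[OF x N_normal[OF x]]) (simp add: N_e[OF x])
    moreover have "N j k x \<bullet> N i q x = N i k x \<bullet> N j q x"
      using riemann_g[OF x, of i j k q] flat x by (simp add: flat_induced_metric_def)
    ultimately show ?thesis by (simp add: R_def Q_def)
  qed
  \<comment> \<open>The identity known for coordinate vectors passes to arbitrary ones by linearity,
    one slot at a time.\<close>
  have ext: "f v = 0" if "linear f" "\<And>i. f (axis i 1) = 0" for f :: "real^'n \<Rightarrow> real" and v
    using linear_axis_sum[OF that(1), of v] that(2) by simp
  have lin: "linear (\<lambda>u. D (e \<alpha>) x u \<bullet> v)" "linear (\<lambda>v. D (e \<alpha>) x u \<bullet> D X x v)" for \<alpha> u v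
    using linX[OF x] line[OF x]
    by (auto intro!: linearI simp: linear_add linear_scale inner_add_left inner_add_right)
  have sum1: "linear (\<lambda>u. \<Sum>\<alpha>\<in>UNIV. f \<alpha> u * c \<alpha>)" and sum2: "linear (\<lambda>u. \<Sum>\<alpha>\<in>UNIV. c \<alpha> * f \<alpha> u)"
    if "\<And>\<alpha>. linear (f \<alpha>)" for f :: "'m \<Rightarrow> real^'n \<Rightarrow> real" and c
    using that by (auto intro!: linearI simp: linear_add linear_scale sum.distrib sum_distrib_left algebra_simps)
  have Q: "linear (\<lambda>u. Q u v w z)" "linear (\<lambda>v. Q u v w z)" "linear (\<lambda>w. Q u v w z)" "linear (\<lambda>z. Q u v w z)" for u v w z
    unfolding Q_def by (rule sum1[OF lin(1)] sum1[OF lin(2)] sum2[OF lin(1)] sum2[OF lin(2)])+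
  have "R u (axis k 1) (axis i 1) (axis q 1) = 0" for u k i q
    using ext[OF linear_compose_sub[OF Q(1) Q(3)], of "axis k 1" "axis i 1" "axis q 1" "axis i 1" "axis k 1" "axis q 1" u] 0
    by (simp add: R_def)
  then have "R u v (axis i 1) (axis q 1) = 0" for u v i q
    using ext[OF linear_compose_sub[OF Q(2) Q(2)], of u "axis i 1" "axis q 1" "axis i 1" u "axis q 1" v]
    by (simp add: R_def)
  then have "R u v w (axis q 1) = 0" for u v w q
    using ext[OF linear_compose_sub[OF Q(3) Q(1)], of u v "axis q 1" v u "axis q 1" w]
    by (simp add: R_def)
  then have "R u v w z = 0"
    using ext[OF linear_compose_sub[OF Q(4) Q(4)], of u v w w v u z]
    by (simp add: R_def)
  then show ?thesis by (simp add: R_def Q_def)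
qed

end

section \<open>Curvature coordinates\<close>

context framed_immersion
begin

text \<open>Orthonormality is with respect to the induced metric. It makes the synthesis map
  \<open>K\<close> injective, hence surjective since there are n vectors.\<close>

lemma orthonormal_tangent_expand:
  fixes B :: "'n \<Rightarrow> real^'n"
  assumes x: "x \<in> U" and on: "\<And>i k. D X x (B i) \<bullet> D X x (B k) = (if i = k then 1 else 0)"
  shows "u = (\<Sum>i\<in>UNIV. (D X x u \<bullet> D X x (B i)) *\<^sub>R B i)"
proof -
  define K where "K d = (\<Sum>i\<in>UNIV. d $ i *\<^sub>R B i)" for d :: "real^'n"
  have linK: "linear K" by (rule linearI) (auto simp: K_def algebra_simps sum.distrib scaleR_sum_right)
  have K: "D X x (K d) \<bullet> D X x (B k) = d $ k" for d k
    by (simp add: K_def linear_sum[OF linX[OF x]] linear_scale[OF linX[OF x]] inner_sum_left on if_distrib cong: if_cong)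
  have "inj K"
    unfolding linear_injective_0[OF linK]
  proof (intro allI impI)
    fix d assume "K d = 0"
    then have "d $ k = 0" for k using K[of d k] linear_0[OF linX[OF x]] by simp
    then show "d = 0" by (simp add: vec_eq_iff)
  qed
  then obtain d where "u = K d" using linear_injective_imp_surjective[OF linK] by (metis surjD)
  then show ?thesis using K by (simp add: K_def)
qed

text \<open>Diagonalization takes place in the image of \<open>D X x\<close>, where the inner
  product is the ambient one and the shape operators are self-adjoint in the plain sense;
  \<open>L\<close> brings the eigenvectors back to coordinates.\<close>

lemma principal_frame_exists:
  assumes x: "x \<in> U"
  obtains B :: "'n \<Rightarrow> real^'n" and lam where
    "\<And>i k. D X x (B i) \<bullet> D X x (B k) = (if i = k then 1 else 0)"
    "\<And>i j. D (e j) x (B i) = lam i j *\<^sub>R D X x (B i)"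
proof -
  obtain L where L: "linear L" "L \<circ> D X x = id"
    using linear_injective_left_inverse[OF linX[OF x] injX[OF x]] by blast
  then have LX: "L (D X x u) = u" for u by (simp add: fun_eq_iff)
  define V where "V = range (D X x)"
  define Sh where "Sh = (\<lambda>j t. D (e j) x (L t))"
  have Sh: "Sh j (D X x u) = D X x (shape j x u)" for j u by (simp add: Sh_def LX DX_shape[OF x])
  have V: "subspace V" unfolding V_def by (rule linear_subspace_image[OF linX[OF x] subspace_UNIV])
  have "\<exists>C\<subseteq>V. pairwise orthogonal C \<and> (\<forall>v\<in>C. norm v = 1) \<and> span C = V \<and> (\<forall>v\<in>C. \<forall>S\<in>range Sh. \<exists>c. S v = c *\<^sub>R v)"
  proof (rule common_orthonormal_eigenbasis[OF V])
    show "linear S" if "S \<in> range Sh" for S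
      using that linear_compose[OF L(1) line[OF x]] by (auto simp: Sh_def o_def)
    show "S ` V \<subseteq> V" if "S \<in> range Sh" for S
      using that by (auto simp: V_def Sh)
    show "S u \<bullet> w = u \<bullet> S w" if "S \<in> range Sh" "u \<in> V" "w \<in> V" for S u w
      using that e_self_adjoint[OF x] by (auto simp: V_def Sh DX_shape[OF x] inner_commute)
    show "S (T u) = T (S u)" if "S \<in> range Sh" "T \<in> range Sh" "u \<in> V" for S T u
      using that shape_commute[OF x] by (auto simp: V_def Sh)
  qed
  then obtain C where C: "C \<subseteq> V" "pairwise orthogonal C" "\<And>v. v \<in> C \<Longrightarrow> norm v = 1" "span C = V"
    "\<And>v j. v \<in> C \<Longrightarrow> \<exists>c. Sh j v = c *\<^sub>R v" by blast
  have "0 \<notin> C" using C(3) by force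
  then have ind: "independent C" using C(2) pairwise_orthogonal_independent by blast
  have "card C = dim V" using dim_span_eq_card_independent[OF ind] C(4) by simp
  also have "\<dots> = CARD('n)" unfolding V_def using dim_image_eq[OF linX[OF x], of UNIV] injX[OF x] by simp
  finally have "card (UNIV :: 'n set) = card C" by simp
  moreover have "finite C" using independent_imp_finite[OF ind] .
  ultimately obtain f where f: "bij_betw f (UNIV :: 'n set) C"
    using finite_same_card_bij[of "UNIV :: 'n set" C] by auto
  have fC: "f i \<in> C" for i using f by (auto simp: bij_betw_def)
  have XL: "D X x (L (f i)) = f i" for i using fC[of i] C(1) LX by (auto simp: V_def)
  have "f i \<bullet> f k = (if i = k then 1 else 0)" for i k
    using C(2,3) fC[of i] fC[of k] f by (auto simp: pairwise_def orthogonal_def bij_betw_def inj_eq dot_square_norm)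
  moreover define lam where "lam i j = (SOME c. D (e j) x (L (f i)) = c *\<^sub>R f i)" for i j
  have "D (e j) x (L (f i)) = lam i j *\<^sub>R f i" for i j
    using someI_ex[OF C(5)[OF fC[of i], of j]] by (simp add: Sh_def lam_def)
  ultimately show ?thesis using that[of "\<lambda>i. L (f i)" lam] by (simp add: XL)
qed

text \<open>In a principal frame every shape operator is diagonal, so \<open>n\<close> independent shape operators force
  every diagonal to occur.\<close>

lemma principal_values_surj:
  fixes B :: "'n \<Rightarrow> real^'n" and d :: "real^'n"
  assumes x: "x \<in> U" and nd: "dim (shape_operators X e x) = CARD('n)"
    and on: "\<And>i k. D X x (B i) \<bullet> D X x (B k) = (if i = k then 1 else 0)"
    and eig: "\<And>i j. D (e j) x (B i) = lam i j *\<^sub>R D X x (B i)"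
  obtains v :: "real^'m" where "\<And>i. (\<Sum>j\<in>UNIV. v $ j * lam i j) = d $ i"
proof -
  define \<Lambda> :: "real^'m \<Rightarrow> real^'n" where "\<Lambda> v = (\<chi> i. \<Sum>j\<in>UNIV. v $ j * lam i j)" for v
  define \<Delta> :: "real^'n \<Rightarrow> real^'n^'n" where
    "\<Delta> d = (\<Sum>i\<in>UNIV. d $ i *\<^sub>R matrix (\<lambda>u. (D X x u \<bullet> D X x (B i)) *\<^sub>R B i))" for d
  have lin\<Lambda>: "linear \<Lambda>"
    by (rule linearI) (auto simp: \<Lambda>_def vec_eq_iff algebra_simps sum.distrib sum_distrib_left)
  have lin\<Delta>: "linear \<Delta>"
    by (rule linearI) (auto simp: \<Delta>_def algebra_simps sum.distrib scaleR_sum_right)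
  have linP: "linear (\<lambda>u. (D X x u \<bullet> D X x (B i)) *\<^sub>R B i)" for i
    using linX[OF x] by (intro linearI) (auto simp: linear_add linear_scale inner_add_left algebra_simps)
  have \<Delta>: "\<Delta> d *v u = (\<Sum>i\<in>UNIV. (d $ i * (D X x u \<bullet> D X x (B i))) *\<^sub>R B i)" for d u
  proof -
    have lin: "linear (\<lambda>M :: real^'n^'n. M *v u)"
      by (rule linearI) (auto simp: matrix_vector_mult_add_rdistrib scaleR_matrix_vector_assoc)
    then show ?thesis
      by (simp add: \<Delta>_def linear_sum[OF lin] linear_scale[OF lin] fun_cong[OF matrix_vector_mul(2)[OF linP]])
  qed
  \<comment> \<open>\<open>\<Lambda>\<close> sends the components of a normal vector to its
    principal values, and \<open>\<Delta>\<close> turns these into a diagonal operator. As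
    \<open>\<Delta>\<close> cannot raise the dimension, \<open>\<Lambda>\<close> must have full
    rank.\<close>
  have "shape_operators X e x \<subseteq> \<Delta> ` range \<Lambda>"
  proof
    fix S assume "S \<in> shape_operators X e x"
    then obtain v where v: "\<And>u w. D X x (S *v u) \<bullet> D X x w = second_ff X e x u w \<bullet> v"
      by (auto simp: shape_operators_def first_ff_def)
    define v' :: "real^'m" where "v' = (\<chi> j. e j x \<bullet> v)"
    have "S *v B i = (\<Sum>j\<in>UNIV. v' $ j * lam i j) *\<^sub>R B i" for i
    proof (rule tangent_eqI[OF x])
      fix w
      have "D X x (S *v B i) \<bullet> D X x w = (\<Sum>j\<in>UNIV. (D X x (B i) \<bullet> D (e j) x w) * v' $ j)"
        by (simp add: v second_ff_def inner_sum_left v'_def)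
      also have "\<dots> = (\<Sum>j\<in>UNIV. (lam i j * (D X x (B i) \<bullet> D X x w)) * v' $ j)"
        using e_self_adjoint[OF x, of _ w "B i"] by (simp add: eig inner_commute)
      also have "\<dots> = D X x ((\<Sum>j\<in>UNIV. v' $ j * lam i j) *\<^sub>R B i) \<bullet> D X x w"
        by (simp add: linear_scale[OF linX[OF x]] sum_distrib_right sum_distrib_left mult_ac)
      finally show "D X x (S *v B i) \<bullet> D X x w = D X x ((\<Sum>j\<in>UNIV. v' $ j * lam i j) *\<^sub>R B i) \<bullet> D X x w" .
    qed
    then have SB: "S *v B i = \<Lambda> v' $ i *\<^sub>R B i" for i by (simp add: \<Lambda>_def)
    have "S *v u = \<Delta> (\<Lambda> v') *v u" for u
    proof -
      have "S *v u = S *v (\<Sum>i\<in>UNIV. (D X x u \<bullet> D X x (B i)) *\<^sub>R B i)"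
        using orthonormal_tangent_expand[OF x on, of u] by simp
      then show ?thesis
        by (simp add: linear_sum[OF matrix_vector_mul_linear] linear_scale[OF matrix_vector_mul_linear] SB \<Delta> mult.commute)
    qed
    then have "S = \<Delta> (\<Lambda> v')" by (simp add: matrix_eq)
    then show "S \<in> \<Delta> ` range \<Lambda>" by blast
  qed
  then have "CARD('n) \<le> dim (\<Delta> ` range \<Lambda>)" using dim_subset nd by metis
  also have "\<dots> \<le> dim (range \<Lambda>)" by (rule dim_image_le[OF lin\<Delta>])
  finally have "dim (range \<Lambda>) = DIM(real^'n)"
    using dim_subset_UNIV[of "range \<Lambda>"] by simp
  then have "span (range \<Lambda>) = UNIV" by (rule dim_eq_full[THEN iffD1])
  then have "range \<Lambda> = UNIV"
    using span_eq_iff[THEN iffD2, OF linear_subspace_image[OF lin\<Lambda> subspace_UNIV]] by simp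
  then obtain v where "\<Lambda> v = d" by (metis surjD)
  then show ?thesis using that[of v] by (simp add: \<Lambda>_def vec_eq_iff)
qed

lemma smooth_principal_frame:
  assumes p: "p \<in> U" and nd: "nondegenerate_normal_bundle U X e"
  obtains r B and lam :: "'n \<Rightarrow> 'm \<Rightarrow> real^'n \<Rightarrow> real" where "0 < r" "ball p r \<subseteq> U"
    "\<And>i. smooth_on (ball p r) (B i)" "\<And>i j. smooth_on (ball p r) (lam i j)"
    "\<And>x i k. x \<in> ball p r \<Longrightarrow> D X x (B i x) \<bullet> D X x (B k x) = (if i = k then 1 else 0)"
    "\<And>x i j. x \<in> ball p r \<Longrightarrow> D (e j) x (B i x) = lam i j x *\<^sub>R D X x (B i x)"
proof -
  obtain B0 :: "'n \<Rightarrow> real^'n" and lam0 where B0: "\<And>i k. D X p (B0 i) \<bullet> D X p (B0 k) = (if i = k then 1 else 0)"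
    "\<And>i j. D (e j) p (B0 i) = lam0 i j *\<^sub>R D X p (B0 i)"
    by (rule principal_frame_exists[OF p]) blast
  \<comment> \<open>An enumeration of the indices supplies pairwise distinct values to prescribe as
    principal values.\<close>
  obtain f :: "'n \<Rightarrow> nat" where f: "inj f" using finite_imp_inj_to_nat_seg[of "UNIV :: 'n set"] by auto
  define \<mu> where "\<mu> i = real (f i)" for i
  have \<mu>: "\<mu> i \<noteq> \<mu> k" if "i \<noteq> k" for i k using f that by (simp add: \<mu>_def inj_eq)
  have ndp: "dim (shape_operators X e p) = CARD('n)"
    using nd p by (simp add: nondegenerate_normal_bundle_def)
  obtain v :: "real^'m" where "\<And>i. (\<Sum>j\<in>UNIV. v $ j * lam0 i j) = (\<chi> i. \<mu> i) $ i"
    by (rule principal_values_surj[OF p ndp B0]) blast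
  then have v: "(\<Sum>j\<in>UNIV. v $ j * lam0 i j) = \<mu> i" for i by simp
  define S where "S x u = (\<Sum>j\<in>UNIV. v $ j *\<^sub>R shape j x u)" for x u
  have linS: "linear (S x)" if "x \<in> U" for x
    unfolding S_def using linear_shape[OF that]
    by (intro linearI) (auto simp: linear_add linear_scale scaleR_add_right sum.distrib scaleR_sum_right mult.commute)
  have smS: "smooth_on U (\<lambda>x. S x u)" for u
    unfolding S_def by (intro smooth_intros U smooth_shape)
  have XS: "D X x (S x u) \<bullet> D X x w = D X x u \<bullet> D X x (S x w)" if x: "x \<in> U" for x u w
    by (simp add: S_def linear_sum[OF linX[OF x]] linear_scale[OF linX[OF x]] DX_shape[OF x] inner_sum_left
        inner_sum_right e_self_adjoint[OF x, of _ u w] inner_commute[of "D X x u"])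
  have shape0: "shape j p (B0 i) = lam0 i j *\<^sub>R B0 i" for i j
    using injX[OF p] by (rule injD) (simp add: DX_shape[OF p] B0(2) linear_scale[OF linX[OF p]])
  have S0: "S p (B0 i) = \<mu> i *\<^sub>R B0 i" for i
    by (simp add: S_def shape0 v flip: scaleR_sum_left)
  have "\<exists>r u s. 0 < r \<and> ball p r \<subseteq> U \<and> smooth_on (ball p r) u \<and> smooth_on (ball p r) s \<and>
      u p = B0 i \<and> s p = \<mu> i \<and> (\<forall>x\<in>ball p r. S x (u x) = s x *\<^sub>R u x)" for i
  proof -
    have B0i: "B0 i \<noteq> 0" using B0(1)[of i i] linear_0[OF linX[OF p]] by auto
    \<comment> \<open>Distinct eigenvalues leave only the \<open>B0 i\<close> component of
      \<open>u\<close>, and the second equation, in the coordinate inner product, removes that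
      one.\<close>
    have simple: "u = 0" if u: "S p u - \<mu> i *\<^sub>R u = s *\<^sub>R B0 i" "u \<bullet> B0 i = 0" for u s
    proof -
      define c where "c k = D X p u \<bullet> D X p (B0 k)" for k
      have uc: "u = (\<Sum>k\<in>UNIV. c k *\<^sub>R B0 k)"
        unfolding c_def by (rule orthonormal_tangent_expand[OF p B0(1)])
      have "c k = 0" if "k \<noteq> i" for k
      proof -
        have "D X p (S p u - \<mu> i *\<^sub>R u) \<bullet> D X p (B0 k) = (\<mu> k - \<mu> i) * c k"
          by (simp add: linear_diff[OF linX[OF p]] linear_scale[OF linX[OF p]] inner_diff_left XS[OF p] S0
              c_def left_diff_distrib)
        then have "(\<mu> k - \<mu> i) * c k = 0"
          unfolding u(1) using that by (simp add: linear_scale[OF linX[OF p]] B0(1))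
        then show ?thesis using \<mu>[OF that] by simp
      qed
      then have "(\<Sum>k\<in>UNIV. c k *\<^sub>R B0 k) = (\<Sum>k\<in>UNIV. if k = i then c i *\<^sub>R B0 i else 0)"
        by (intro sum.cong) auto
      with uc have "u = c i *\<^sub>R B0 i" by simp
      then show ?thesis using u(2) B0i by auto
    qed
    show ?thesis
      by (rule smooth_simple_eigenvector[OF U p linS smS B0i S0 simple]) blast+
  qed
  then obtain r u s where rus: "\<And>i. 0 < r i" "\<And>i. ball p (r i) \<subseteq> U"
    "\<And>i. smooth_on (ball p (r i)) (u i)" "\<And>i. smooth_on (ball p (r i)) (s i)"
    "\<And>i. u i p = B0 i" "\<And>i. s i p = \<mu> i"
    "\<And>i x. x \<in> ball p (r i) \<Longrightarrow> S x (u i x) = s i x *\<^sub>R u i x"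
    by metis
  have pball: "p \<in> ball p (r i)" for i using rus(1) by simp
  have cont: "isCont (u i) p" "isCont (s i) p" for i
    using smooth_on_continuous_on rus(3,4) pball continuous_on_eq_continuous_at[OF open_ball] by blast+
  have lim: "(u i \<longlongrightarrow> B0 i) (nhds p)" "(s i \<longlongrightarrow> \<mu> i) (nhds p)" for i
    using cont[of i, unfolded isCont_def tendsto_at_iff_tendsto_nhds] rus(5,6)[of i] by simp_all
  have near: "eventually (\<lambda>x. x \<in> ball p (r i)) (nhds p)" for i
    using pball by (intro eventually_nhds_in_open) auto
  have nz: "eventually (\<lambda>x. u i x \<noteq> 0) (nhds p)" for i
  proof -
    have "B0 i \<noteq> 0" using B0(1)[of i i] linear_0[OF linX[OF p]] by auto
    then show ?thesis
      by (rule tendsto_imp_eventually_ne[OF lim(1)])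
  qed
  have ne: "eventually (\<lambda>x. i \<noteq> k \<longrightarrow> s i x \<noteq> s k x) (nhds p)" for i k
  proof (cases "i = k")
    case False
    have "((\<lambda>x. s i x - s k x) \<longlongrightarrow> \<mu> i - \<mu> k) (nhds p)"
      by (intro tendsto_diff lim)
    then show ?thesis
      using tendsto_imp_eventually_ne[of "\<lambda>x. s i x - s k x" "\<mu> i - \<mu> k" "nhds p" 0] \<mu>[OF False]
      by simp
  qed simp
  \<comment> \<open>Nonvanishing eigenvectors and distinct eigenvalues are open conditions, and
    there are finitely many of them.\<close>
  have "eventually (\<lambda>x. (\<forall>i. x \<in> ball p (r i)) \<and> (\<forall>i. u i x \<noteq> 0) \<and> (\<forall>i k. i \<noteq> k \<longrightarrow> s i x \<noteq> s k x)) (nhds p)"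
    by (intro eventually_conj eventually_all_finite near nz ne)
  then have "\<exists>T. open T \<and> p \<in> T \<and> (\<forall>x\<in>T. (\<forall>i. x \<in> ball p (r i)) \<and> (\<forall>i. u i x \<noteq> 0) \<and> (\<forall>i k. i \<noteq> k \<longrightarrow> s i x \<noteq> s k x))"
    unfolding eventually_nhds .
  then obtain T where T: "open T" "p \<in> T"
    "\<forall>x\<in>T. (\<forall>i. x \<in> ball p (r i)) \<and> (\<forall>i. u i x \<noteq> 0) \<and> (\<forall>i k. i \<noteq> k \<longrightarrow> s i x \<noteq> s k x)"
    by (elim exE conjE)
  obtain \<rho> where \<rho>: "0 < \<rho>" "ball p \<rho> \<subseteq> T" using T(1,2) openE by blast
  note near' = bspec[OF T(3) subsetD[OF \<rho>(2)]]
  have u0: "u i x \<noteq> 0" if "x \<in> ball p \<rho>" for i x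
    using near'[OF that] by simp
  have s_ne: "s i x \<noteq> s k x" if "x \<in> ball p \<rho>" "i \<noteq> k" for i k x
    using near'[OF that(1)] that(2) by simp
  have sub: "ball p \<rho> \<subseteq> ball p (r i)" for i
    using near' by (intro subsetI) (rule conjunct1[THEN spec])
  have subU: "ball p \<rho> \<subseteq> U" by (rule order_trans[OF sub rus(2)])
  have smu: "smooth_on (ball p \<rho>) (u i)" for i using smooth_on_subset[OF rus(3) sub] .
  define E where "E i x = D X x (u i x)" for i x
  define n where "n i x = norm (E i x)" for i x
  define B where "B i x = (1 / n i x) *\<^sub>R u i x" for i x
  define lam where "lam i j x = D (e j) x (B i x) \<bullet> D X x (B i x)" for i j x
  have smD: "smooth_on (ball p \<rho>) (\<lambda>x. D f x (w x))"
    if f: "smooth_on U f" and w: "smooth_on (ball p \<rho>) w" for f :: "real^'n \<Rightarrow> real^('m + 'n)" and w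
  proof (rule smooth_on_cong[OF _ open_ball])
    show "(\<Sum>c\<in>Basis. (w x \<bullet> c) *\<^sub>R D f x c) = D f x (w x)" if "x \<in> ball p \<rho>" for x
      using that subU by (intro linear_Basis_sum[symmetric] smooth_on_linear_D[OF f]) blast
    show "smooth_on (ball p \<rho>) (\<lambda>x. \<Sum>c\<in>Basis. (w x \<bullet> c) *\<^sub>R D f x c)"
      by (intro smooth_intros open_ball w smooth_on_subset[OF smooth_on_D(2)[OF f] subU])
  qed
  have n0: "n i x > 0" if "x \<in> ball p \<rho>" for i x
  proof -
    have xU: "x \<in> U" using that subU by blast
    have "E i x \<noteq> 0"
      using injX[OF xU] u0[OF that, of i] unfolding linear_injective_0[OF linX[OF xU]] E_def by blast
    then show ?thesis by (simp add: n_def)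
  qed
  have "smooth_on (ball p \<rho>) (\<lambda>x. sqrt (E i x \<bullet> E i x))" for i
    unfolding E_def using n0
    by (intro smooth_on_sqrt open_ball smooth_intros smD smX smu) (auto simp: n_def E_def)
  then have smn: "smooth_on (ball p \<rho>) (n i)" for i by (simp add: n_def[abs_def] norm_eq_sqrt_inner)
  have smB: "smooth_on (ball p \<rho>) (B i)" for i
    unfolding B_def using n0 by (intro smooth_intros open_ball smn smu) (auto simp: less_imp_neq[symmetric])
  have on: "D X x (B i x) \<bullet> D X x (B k x) = (if i = k then 1 else 0)" if x: "x \<in> ball p \<rho>" for i k x
  proof -
    have xU: "x \<in> U" using x subU by blast
    have XB: "D X x (B i x) = (1 / n i x) *\<^sub>R E i x" for i by (simp add: B_def E_def linear_scale[OF linX[OF xU]])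
    have "(s i x - s k x) * (E i x \<bullet> E k x) = 0"
      using XS[OF xU, of "u i x" "u k x"] rus(7)[OF subsetD[OF sub x], of i] rus(7)[OF subsetD[OF sub x], of k]
      by (simp add: E_def linear_scale[OF linX[OF xU]] left_diff_distrib)
    then have "E i x \<bullet> E k x = 0" if "i \<noteq> k" using s_ne[OF x that] by simp
    moreover have "E i x \<bullet> E i x = (n i x)\<^sup>2" by (simp add: n_def power2_norm_eq_inner)
    ultimately show ?thesis using n0[OF x] by (auto simp: XB power2_eq_square less_imp_neq[symmetric])
  qed
  have eig: "D (e j) x (B i x) = lam i j x *\<^sub>R D X x (B i x)" if x: "x \<in> ball p \<rho>" for i j x
  proof -
    have xU: "x \<in> U" using x subU by blast
    have SB: "S x (B i x) = s i x *\<^sub>R B i x" for i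
      using rus(7)[of x i] x sub[of i] by (simp add: B_def linear_scale[OF linS[OF xU]] mult.commute subset_iff)
    \<comment> \<open>\<open>shape j\<close> commutes with \<open>S\<close>, so \<open>y\<close>
      satisfies the eigenvalue equation of \<open>B i x\<close> for \<open>S\<close>; distinctness
      of the eigenvalues makes it a multiple of \<open>B i x\<close>.\<close>
    define y where "y = shape j x (B i x)"
    have "S x y = shape j x (S x (B i x))"
      unfolding S_def y_def using shape_commute[OF xU, of j]
      by (simp add: linear_sum[OF linear_shape[OF xU]] linear_scale[OF linear_shape[OF xU]])
    then have Sy: "S x y = s i x *\<^sub>R y" by (simp add: SB y_def linear_scale[OF linear_shape[OF xU]])
    have "D X x y \<bullet> D X x (B k x) = 0" if "k \<noteq> i" for k
    proof -
      have "s i x * (D X x y \<bullet> D X x (B k x)) = s k x * (D X x y \<bullet> D X x (B k x))"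
        using XS[OF xU, of y "B k x"] by (simp add: Sy SB linear_scale[OF linX[OF xU]])
      moreover have "s i x \<noteq> s k x" using s_ne[OF x] that by metis
      ultimately show ?thesis by simp
    qed
    then have "(\<Sum>k\<in>UNIV. (D X x y \<bullet> D X x (B k x)) *\<^sub>R B k x)
        = (\<Sum>k\<in>UNIV. if k = i then (D X x y \<bullet> D X x (B i x)) *\<^sub>R B i x else 0)"
      by (intro sum.cong) auto
    with orthonormal_tangent_expand[OF xU on[OF x], of y]
    have "y = (D X x y \<bullet> D X x (B i x)) *\<^sub>R B i x" by simp
    then have "D X x y = (D X x y \<bullet> D X x (B i x)) *\<^sub>R D X x (B i x)"
      by (metis linear_scale[OF linX[OF xU]])
    then show ?thesis by (simp add: y_def DX_shape[OF xU] lam_def)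
  qed
  have "smooth_on (ball p \<rho>) (lam i j)" for i j
    unfolding lam_def by (intro smooth_intros open_ball smD smX sme smB)
  then show ?thesis using that[of \<rho> B lam] \<rho>(1) subU smB on eig by blast
qed

end

lemma (in framed_immersion) curvature_coordinates:
  assumes flat: "flat_induced_metric U X" and nd: "nondegenerate_normal_bundle U X e" and p: "p \<in> U"
  shows "\<exists>\<phi> W A b. connected W \<and> p \<in> \<phi> ` W \<and> adapted_coords U X e \<phi> W A b"
proof -
  obtain r B and lam :: "'n \<Rightarrow> 'm \<Rightarrow> real^'n \<Rightarrow> real" where r: "0 < r" "ball p r \<subseteq> U"
    and smB: "\<And>i. smooth_on (ball p r) (B i)" and smlam: "\<And>i j. smooth_on (ball p r) (lam i j)"
    and on: "\<And>x i k. x \<in> ball p r \<Longrightarrow> D X x (B i x) \<bullet> D X x (B k x) = (if i = k then 1 else 0)"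
    and eig: "\<And>x i j. x \<in> ball p r \<Longrightarrow> D (e j) x (B i x) = lam i j x *\<^sub>R D X x (B i x)"
    by (rule smooth_principal_frame[OF p nd]) blast
  define T where "T = ball p r"
  have T: "open T" "p \<in> T" "T \<subseteq> U" using r by (auto simp: T_def)
  note smB = smB[folded T_def] and smlam = smlam[folded T_def] and on = on[folded T_def] and eig = eig[folded T_def]
  have TU: "x \<in> U" if "x \<in> T" for x using that T(3) by blast
  define E where "E i x = D X x (B i x)" for i x
  have EE: "E i x \<bullet> E k x = (if i = k then 1 else 0)" if "x \<in> T" for i k x
    unfolding E_def by (rule on[OF that])
  have smE: "smooth_on T (E i)" for i
  proof (rule smooth_on_cong[OF _ T(1)])
    show "(\<Sum>c\<in>Basis. (B i x \<bullet> c) *\<^sub>R D X x c) = E i x" if "x \<in> T" for x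
      unfolding E_def by (rule linear_Basis_sum[OF linX[OF TU[OF that]], symmetric])
    show "smooth_on T (\<lambda>x. \<Sum>c\<in>Basis. (B i x \<bullet> c) *\<^sub>R D X x c)"
      by (intro smooth_intros T(1) smB smooth_on_subset[OF smDX T(3)])
  qed
  have expand: "u = (\<Sum>i\<in>UNIV. (D X x u \<bullet> E i x) *\<^sub>R B i x)" if "x \<in> T" for x u
    unfolding E_def by (rule orthonormal_tangent_expand[OF TU[OF that] on[OF that]])
  have DX: "D X x u = (\<Sum>i\<in>UNIV. (D X x u \<bullet> E i x) *\<^sub>R E i x)" if "x \<in> T" for x u
  proof -
    have "D X x u = D X x (\<Sum>i\<in>UNIV. (D X x u \<bullet> E i x) *\<^sub>R B i x)" using expand[OF that, of u] by simp
    then show ?thesis by (simp add: linear_sum[OF linX[OF TU[OF that]]] linear_scale[OF linX[OF TU[OF that]]] E_def)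
  qed
  have De: "D (e j) x u = (\<Sum>i\<in>UNIV. ((D X x u \<bullet> E i x) * lam i j x) *\<^sub>R E i x)" if "x \<in> T" for x u j
  proof -
    have "D (e j) x u = D (e j) x (\<Sum>i\<in>UNIV. (D X x u \<bullet> E i x) *\<^sub>R B i x)" using expand[OF that, of u] by simp
    then show ?thesis
      by (simp add: linear_sum[OF line[OF TU[OF that]]] linear_scale[OF line[OF TU[OF that]]] eig[OF that] E_def)
  qed
  define \<kappa> where "\<kappa> i x = sqrt (\<Sum>j\<in>UNIV. (lam i j x)\<^sup>2)" for i x
  \<comment> \<open>No principal curvature vector vanishes, since by nondegeneracy some normal
    direction has all principal values equal to 1.\<close>
  have lam_pos: "(\<Sum>j\<in>UNIV. (lam i j x)\<^sup>2) > 0" if x: "x \<in> T" for i x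
  proof -
    have ndx: "dim (shape_operators X e x) = CARD('n)"
      using nd TU[OF x] by (simp add: nondegenerate_normal_bundle_def)
    obtain v :: "real^'m" where v: "\<And>i. (\<Sum>j\<in>UNIV. v $ j * lam i j x) = (1 :: real^'n) $ i"
      by (rule principal_values_surj[OF TU[OF x] ndx on[OF x] eig[OF x]]) blast
    have "\<exists>j. lam i j x \<noteq> 0"
    proof (rule ccontr)
      assume "\<not> (\<exists>j. lam i j x \<noteq> 0)"
      then show False using v[of i] by simp
    qed
    then obtain j where "lam i j x \<noteq> 0" by blast
    then show ?thesis by (intro sum_pos2[of _ j]) auto
  qed
  have \<kappa>0: "\<kappa> i x > 0" and \<kappa>2: "(\<Sum>j\<in>UNIV. (lam i j x)\<^sup>2) = (\<kappa> i x)\<^sup>2" if "x \<in> T" for i x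
    using lam_pos[OF that, of i] by (simp_all add: \<kappa>_def)
  have \<kappa>_ne: "\<kappa> i x \<noteq> 0" if "x \<in> T" for i x using \<kappa>0[OF that, of i] by simp
  have sm\<kappa>: "smooth_on T (\<kappa> i)" for i
    unfolding \<kappa>_def[abs_def] power2_eq_square
    by (intro smooth_on_sqrt T(1) smooth_intros smlam) (use lam_pos in \<open>simp add: power2_eq_square\<close>)
  define a where "a i j x = lam i j x / \<kappa> i x" for i j x
  have sma: "smooth_on T (a i j)" for i j
    unfolding a_def[abs_def] by (intro smooth_intros T(1) smlam sm\<kappa> \<kappa>_ne)
  \<comment> \<open>The Gauss equation on the plane of \<open>B i\<close> and \<open>B k\<close>:
    the mixed products vanish in a principal frame.\<close>
  have lam_orth: "(\<Sum>j\<in>UNIV. lam i j x * lam k j x) = 0" if x: "x \<in> T" and "i \<noteq> k" for i k x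
  proof -
    have "D (e j) x (B i x) \<bullet> D X x (B k x) = (if i = k then lam i j x else 0)" for i j k
      by (simp add: eig[OF x] on[OF x])
    then show ?thesis
      using Gauss[OF flat TU[OF x], of "B i x" "B i x" "B k x" "B k x"] that(2) by simp
  qed
  have aa: "(\<Sum>j\<in>UNIV. a i j x * a k j x) = (if i = k then 1 else 0)" if x: "x \<in> T" for i k x
  proof -
    have "(\<Sum>j\<in>UNIV. a i j x * a k j x) = (\<Sum>j\<in>UNIV. lam i j x * lam k j x) / (\<kappa> i x * \<kappa> k x)"
      by (simp add: a_def sum_divide_distrib)
    then show ?thesis
      using \<kappa>2[OF x, of i] \<kappa>_ne[OF x] lam_orth[OF x, of i k] by (auto simp: power2_eq_square)
  qed
  \<comment> \<open>Written with \<open>D (e j)\<close> instead of \<open>D X\<close>, so that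
    closedness can draw on the symmetry of the second derivatives of \<open>e j\<close>.\<close>
  define w where "w k x u = (\<Sum>j\<in>UNIV. a k j x * (E k x \<bullet> D (e j) x u))" for k x u
  have E_De: "E k x \<bullet> D (e j) x u = (D X x u \<bullet> E k x) * lam k j x" if x: "x \<in> T" for k j x u
    by (subst De[OF x]) (simp add: inner_sum_right EE[OF x] if_distrib cong: if_cong)
  \<comment> \<open>The form is \<open>\<kappa> k\<close> times the dual coframe. In coordinates
    given by its potentials the coordinate vectors are therefore the principal directions, with
    lengths \<open>1 / \<kappa> k\<close>.\<close>
  have w: "w k x u = \<kappa> k x * (D X x u \<bullet> E k x)" if x: "x \<in> T" for k x u
  proof -
    have "w k x u = (D X x u \<bullet> E k x) * (\<Sum>j\<in>UNIV. (lam k j x)\<^sup>2) / \<kappa> k x"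
      unfolding w_def E_De[OF x] a_def by (simp add: sum_distrib_left sum_divide_distrib power2_eq_square mult_ac)
    then show ?thesis unfolding \<kappa>2[OF x] using \<kappa>_ne[OF x, of k] by (simp add: power2_eq_square)
  qed
  have De_w: "D (e j) x u = (\<Sum>i\<in>UNIV. (a i j x * w i x u) *\<^sub>R E i x)" if x: "x \<in> T" for x u j
    by (subst De[OF x]) (simp add: a_def w[OF x] \<kappa>_ne[OF x] mult.commute)
  have smDe': "smooth_on T (\<lambda>x. D (e j) x u)" for j u by (rule smooth_on_subset[OF smDe T(3)])
  have smw: "smooth_on T (\<lambda>x. w k x u)" for k u
    unfolding w_def by (intro smooth_intros T(1) sma smE smDe')
  \<comment> \<open>the terms containing \<open>da\<^sub>k\<close> and \<open>dE\<^sub>k\<close> drop out since \<open>a\<^sub>k\<close> and \<open>E\<^sub>k\<close> have constant length\<close>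
  have closed: "D (\<lambda>x. w k x h) x v = D (\<lambda>x. w k x v) x h" if x: "x \<in> T" for k x h v
  proof -
    have Dw: "D (\<lambda>x. w k x h) x v = (\<Sum>j\<in>UNIV. a k j x * (E k x \<bullet> D (\<lambda>y. D (e j) y h) x v))" for h v
    proof -
      have "D (\<lambda>x. w k x h) x v = (\<Sum>j\<in>UNIV. a k j x * (E k x \<bullet> D (\<lambda>y. D (e j) y h) x v + D (E k) x v \<bullet> D (e j) x h)
          + D (a k j) x v * (E k x \<bullet> D (e j) x h))"
        unfolding w_def
        by (intro fun_cong[OF D_eqI] has_derivative_sum has_derivative_mult has_derivative_inner
            smooth_on_D(1)[OF sma x] smooth_on_D(1)[OF smE x] smooth_on_D(1)[OF smDe' x])
      also have "\<dots> = (\<Sum>j\<in>UNIV. a k j x * (E k x \<bullet> D (\<lambda>y. D (e j) y h) x v))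
          + (\<Sum>j\<in>UNIV. a k j x * (D (E k) x v \<bullet> D (e j) x h)) + (\<Sum>j\<in>UNIV. D (a k j) x v * (E k x \<bullet> D (e j) x h))"
        by (simp add: distrib_left sum.distrib)
      also have "(\<Sum>j\<in>UNIV. D (a k j) x v * (E k x \<bullet> D (e j) x h)) = 0"
      proof -
        have "(\<Sum>j\<in>UNIV. a k j x * D (a k j) x v + D (a k j) x v * a k j x) = D (\<lambda>y. \<Sum>j\<in>UNIV. a k j y * a k j y) x v"
          by (intro fun_cong[OF D_eqI, symmetric] has_derivative_sum has_derivative_mult smooth_on_D(1)[OF sma x])
        also have "\<dots> = 0" using D_cong_open[OF T(1) x, of "\<lambda>y. \<Sum>j\<in>UNIV. a k j y * a k j y" "\<lambda>y. 1"] aa by simp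
        finally have "2 * (\<Sum>j\<in>UNIV. D (a k j) x v * a k j x) = 0"
          by (simp add: sum.distrib mult.commute sum_distrib_left)
        moreover have "E k x \<bullet> D (e j) x h = a k j x * w k x h" for j
          unfolding De_w[OF x] by (simp add: inner_sum_right EE[OF x] if_distrib cong: if_cong)
        ultimately show ?thesis by (simp add: mult.assoc[symmetric] flip: sum_distrib_right)
      qed
      also have "(\<Sum>j\<in>UNIV. a k j x * (D (E k) x v \<bullet> D (e j) x h)) = 0"
      proof -
        have "D (E k) x v \<bullet> E k x = 0"
          using D_inner_const[OF T(1) x smE smE EE, of k v k] by (simp add: inner_commute)
        moreover have "(\<Sum>j\<in>UNIV. a k j x * (D (E k) x v \<bullet> D (e j) x h))
            = (\<Sum>i\<in>UNIV. (\<Sum>j\<in>UNIV. a k j x * a i j x) * (w i x h * (D (E k) x v \<bullet> E i x)))"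
          unfolding De_w[OF x] inner_sum_right sum_distrib_left sum_distrib_right
          by (subst sum.swap) (simp add: mult_ac)
        ultimately show ?thesis by (simp add: aa[OF x] if_distrib if_distribR cong: if_cong)
      qed
      finally show ?thesis by simp
    qed
    have "D (\<lambda>y. D (e j) y h) x v = D (\<lambda>y. D (e j) y v) x h" for j
      by (rule smooth_on_D_commute[OF U sme TU[OF x]])
    then show ?thesis unfolding Dw by simp
  qed
  define \<omega> :: "real^'n \<Rightarrow> real^'n \<Rightarrow> real^'n" where "\<omega> x u = (\<chi> k. w k x u)" for x u
  have sm\<omega>: "smooth_on T (\<lambda>x. \<omega> x u)" for u
    unfolding \<omega>_def by (intro smooth_on_vec T(1) smw)
  obtain r' \<xi> where \<xi>: "0 < r'" "ball p r' \<subseteq> T" "smooth_on (ball p r') \<xi>"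
    "\<And>x. x \<in> ball p r' \<Longrightarrow> (\<xi> has_derivative \<omega> x) (at x)"
  proof (rule closed_one_form_exact[OF T(1) _ sm\<omega> _ T(2)])
    show "linear (\<omega> x)" if x: "x \<in> T" for x
      using linX[OF TU[OF x]] unfolding \<omega>_def w[OF x]
      by (intro linearI) (auto simp: vec_eq_iff linear_add linear_scale inner_add_left algebra_simps)
    show "D (\<lambda>x. \<omega> x h) x v = D (\<lambda>x. \<omega> x v) x h" if x: "x \<in> T" for x h v
    proof -
      have "D (\<lambda>x. \<omega> x h) x v $ k = D (\<lambda>x. w k x h) x v" for k h v
        using D_bounded_linear[OF bounded_linear_vec_nth smooth_on_D(1)[OF sm\<omega> x], of h k v] by (simp add: \<omega>_def)
      then show ?thesis using closed[OF x] by (simp add: vec_eq_iff)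
    qed
  qed blast
  have D\<xi>: "D \<xi> x u $ k = w k x u" if "x \<in> ball p r'" for x u k
    using D_eqI[OF \<xi>(4)[OF that]] by (simp add: \<omega>_def)
  have pr': "p \<in> ball p r'" using \<xi>(1) by simp
  have "inj (D \<xi> p)"
    unfolding linear_injective_0[OF smooth_on_linear_D[OF \<xi>(3) pr']]
  proof (intro allI impI)
    fix u assume "D \<xi> p u = 0"
    then have "w k p u = 0" for k using D\<xi>[OF pr', of u k] by simp
    then have "D X p u \<bullet> E k p = 0" for k using w[OF T(2), of k u] \<kappa>_ne[OF T(2), of k] by simp
    then show "u = 0" using expand[OF T(2), of u] by simp
  qed
  from smooth_inverse_function[OF open_ball \<xi>(3) pr' this] obtain \<rho> \<phi> where \<phi>:
    "0 < \<rho>" "smooth_on (ball (\<xi> p) \<rho>) \<phi>" "\<phi> ` ball (\<xi> p) \<rho> \<subseteq> ball p r'" "\<phi> (\<xi> p) = p"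
    "\<And>y. y \<in> ball (\<xi> p) \<rho> \<Longrightarrow> \<xi> (\<phi> y) = y" "open (\<phi> ` ball (\<xi> p) \<rho>)" by blast
  define W where "W = ball (\<xi> p) \<rho>"
  note \<phi> = \<phi>[folded W_def]
  have W: "open W" "connected W" by (simp_all add: W_def)
  have \<phi>r: "\<phi> y \<in> ball p r'" and \<phi>T: "\<phi> y \<in> T" and \<phi>U: "\<phi> y \<in> U" if "y \<in> W" for y
    using \<phi>(3) \<xi>(2) T(3) that by blast+
  define b :: "real^'n \<Rightarrow> real^'n" where "b y = (\<chi> i. 1 / \<kappa> i (\<phi> y))" for y
  define A :: "real^'n \<Rightarrow> real^'n^'m" where "A y = (\<chi> j i. a i j (\<phi> y))" for y
  have comp: "smooth_on W (\<lambda>y. f (\<phi> y))" if "smooth_on T f" for f :: "real^'n \<Rightarrow> real"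
    by (rule smooth_on_compose[OF that \<phi>(2) W(1) T(1)]) (use \<phi>T in blast)
  have smb: "smooth_on W b"
    unfolding b_def by (intro smooth_on_vec smooth_on_divide smooth_on_const W(1) comp sm\<kappa> \<kappa>_ne \<phi>T)
  have smA: "smooth_on W A"
    unfolding A_def by (intro smooth_on_vec W(1) comp sma)
  have w\<phi>: "w k (\<phi> y) (D \<phi> y u) = u $ k" if y: "y \<in> W" for y u k
  proof -
    have "D (\<xi> \<circ> \<phi>) y u = D \<xi> (\<phi> y) (D \<phi> y u)"
      by (rule D_compose[OF smooth_on_D(1)[OF \<phi>(2) y] smooth_on_D(1)[OF \<xi>(3) \<phi>r[OF y]]])
    moreover have "D (\<xi> \<circ> \<phi>) y = (\<lambda>u. u)"
      using D_cong_open[OF W(1) y, of "\<xi> \<circ> \<phi>" "\<lambda>y. y"] \<phi>(5) by simp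
    ultimately show ?thesis using D\<xi>[OF \<phi>r[OF y], of "D \<phi> y u" k] by simp
  qed
  have DY: "D (X \<circ> \<phi>) y u = (\<Sum>i\<in>UNIV. (b y $ i * u $ i) *\<^sub>R E i (\<phi> y))" if y: "y \<in> W" for y u
  proof -
    have "D (X \<circ> \<phi>) y u = D X (\<phi> y) (D \<phi> y u)"
      by (rule D_compose[OF smooth_on_D(1)[OF \<phi>(2) y] smooth_on_D(1)[OF smX \<phi>U[OF y]]])
    moreover have "D X (\<phi> y) (D \<phi> y u) \<bullet> E i (\<phi> y) = b y $ i * u $ i" for i
      using w[OF \<phi>T[OF y], of i "D \<phi> y u"] \<kappa>_ne[OF \<phi>T[OF y], of i] w\<phi>[OF y, of i u] by (simp add: b_def field_simps)
    ultimately show ?thesis using DX[OF \<phi>T[OF y], of "D \<phi> y u"] by simp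
  qed
  have De\<phi>: "D (e j \<circ> \<phi>) y u = (\<Sum>i\<in>UNIV. (A y $ j $ i * u $ i) *\<^sub>R E i (\<phi> y))" if y: "y \<in> W" for j y u
    using D_compose[OF smooth_on_D(1)[OF \<phi>(2) y] smooth_on_D(1)[OF sme \<phi>U[OF y]], of j u]
    by (simp add: De_w[OF \<phi>T[OF y]] w\<phi>[OF y] A_def)
  have first: "first_ff (X \<circ> \<phi>) y u v = (\<Sum>i\<in>UNIV. (b y $ i)\<^sup>2 * u $ i * v $ i)" if y: "y \<in> W" for y u v
    by (simp add: first_ff_def DY[OF y] inner_sum_left inner_sum_right EE[OF \<phi>T[OF y]] if_distrib
        power2_eq_square mult_ac cong: if_cong)
  have second: "second_ff (X \<circ> \<phi>) (\<lambda>j. e j \<circ> \<phi>) y u v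
      = (\<Sum>i\<in>UNIV. \<Sum>j\<in>UNIV. (b y $ i * A y $ j $ i * u $ i * v $ i) *\<^sub>R (e j \<circ> \<phi>) y)" if y: "y \<in> W" for y u v
  proof -
    have "D (X \<circ> \<phi>) y u \<bullet> D (e j \<circ> \<phi>) y v = (\<Sum>i\<in>UNIV. b y $ i * A y $ j $ i * u $ i * v $ i)" for j
      by (simp add: De\<phi>[OF y] DY[OF y] inner_sum_left inner_sum_right EE[OF \<phi>T[OF y]] if_distrib mult_ac cong: if_cong)
    then show ?thesis by (simp add: second_ff_def scaleR_sum_left) (rule sum.swap)
  qed
  have "adapted_coords U X e \<phi> W A b"
    unfolding adapted_coords_def
  proof (intro conjI ballI)
    have "smooth_on (\<phi> ` W) \<xi>" by (rule smooth_on_subset[OF \<xi>(3) \<phi>(3)])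
    then show "diffeo \<phi> W (\<phi> ` W)"
      unfolding diffeo_def using W(1) \<phi>(2,5,6) by blast
    show "\<phi> ` W \<subseteq> U" using \<phi>U by blast
    show "line_of_curvature_coords W (X \<circ> \<phi>) (\<lambda>j. e j \<circ> \<phi>)"
      unfolding line_of_curvature_coords_def
    proof (intro exI conjI ballI allI)
      show "smooth_on W (\<lambda>y. \<chi> j i. b y $ i * A y $ j $ i)"
        by (intro smooth_on_vec smooth_intros W(1) smb smA)
    qed (use smb first second in simp_all)
    show "fundamental_forms W (X \<circ> \<phi>) (\<lambda>j. e j \<circ> \<phi>) A b"
      unfolding fundamental_forms_def using first second by blast
    show "transpose (A y) ** A y = mat 1" if "y \<in> W" for y
      using aa[OF \<phi>T[OF that]] by (simp add: vec_eq_iff matrix_matrix_mult_def transpose_def mat_def A_def)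
  qed (rule smA smb)+
  moreover have "p \<in> \<phi> ` W"
    using \<phi>(1,4) by (intro image_eqI[of _ _ "\<xi> p"]) (simp_all add: W_def)
  ultimately show ?thesis using W(2) by blast
qed

theorem theorem6p3:
  assumes n_le_m: "CARD('n::finite) \<le> CARD('m::finite)"
  shows
    "(\<forall>(U :: (real^'n) set) (X :: real^'n \<Rightarrow> real^('m + 'n)) (e :: 'm \<Rightarrow> real^'n \<Rightarrow> real^('m + 'n)).
        immersion_on U X \<and> flat_induced_metric U X \<and> flat_normal_bundle U X \<and>
        parallel_normal_frame U X e \<and> nondegenerate_normal_bundle U X e \<longrightarrow>
        (\<forall>p\<in>U. \<exists>\<phi> W A b. connected W \<and> p \<in> \<phi> ` W \<and> adapted_coords U X e \<phi> W A b) \<and>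
        (\<forall>\<phi> W A b. adapted_coords U X e \<phi> W A b \<longrightarrow>
           G_system_I W A (F_of b) \<and>
           (let g = adapted_frame (X \<circ> \<phi>) (\<lambda>j. e j \<circ> \<phi>) b;
                \<theta> = (\<lambda>x i. block_matrix
                       0 (- (A x ** C_mat i))
                       (C_mat i ** transpose (A x))
                       (- (transpose (F_of b x) ** C_mat i) + C_mat i ** F_of b x))
            in \<forall>x\<in>W. invertible (g x) \<and>
                 (\<forall>u. matrix_inv (g x) ** frechet_derivative g (at x) u
                        = (\<Sum>i\<in>UNIV. (u $ i) *\<^sub>R \<theta> x i)) \<and>
                 (\<forall>i. \<theta> x i = lax_I (A x) (F_of b x) 1 i))) \<and>
        (\<forall>\<phi> W A b. adapted_coords U X e \<phi> W A b \<and> connected W \<longrightarrow>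
           ((\<exists>c. X ` \<phi> ` W \<subseteq> sphere c 1) \<longleftrightarrow>
            (\<exists>v :: real^'m. norm v = 1 \<and> (\<forall>x\<in>W. b x = v v* A x)))))
     \<and>
     (\<forall>(\<Omega> :: (real^'n) set) (A :: real^'n \<Rightarrow> real^'n^'m) (F :: real^'n \<Rightarrow> real^'n^'n) (b :: real^'n \<Rightarrow> real^'n).
        open \<Omega> \<and> G_system_I \<Omega> A F \<and> smooth_on \<Omega> b \<and>
        (\<forall>x\<in>\<Omega>. \<forall>i j. i \<noteq> j \<longrightarrow> partial (\<lambda>y. b y $ i) j x = F x $ i $ j * b x $ j) \<longrightarrow>
        (\<forall>p\<in>\<Omega>. (\<forall>i. b p $ i \<noteq> 0) \<longrightarrow>
           (\<exists>V (Y :: real^'n \<Rightarrow> real^('m + 'n)) e.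
              p \<in> V \<and> V \<subseteq> \<Omega> \<and> immersion_on V Y \<and> isometric_from_euclidean V Y \<and>
              parallel_normal_frame V Y e \<and> fundamental_forms V Y e A b)))"
proof (intro conjI allI impI ballI)
  fix U :: "(real^'n) set" and X :: "real^'n \<Rightarrow> real^('m + 'n)" and e
  assume hyp: "immersion_on U X \<and> flat_induced_metric U X \<and> flat_normal_bundle U X \<and>
        parallel_normal_frame U X e \<and> nondegenerate_normal_bundle U X e"
  then interpret framed_immersion U X e by unfold_locales auto
  fix p assume "p \<in> U"
  then show "\<exists>\<phi> W A b. connected W \<and> p \<in> \<phi> ` W \<and> adapted_coords U X e \<phi> W A b"
    using curvature_coordinates hyp by blast
next
  fix U :: "(real^'n) set" and X :: "real^'n \<Rightarrow> real^('m + 'n)" and e \<phi> W A b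
  assume hyp: "immersion_on U X \<and> flat_induced_metric U X \<and> flat_normal_bundle U X \<and>
        parallel_normal_frame U X e \<and> nondegenerate_normal_bundle U X e"
    and ac: "adapted_coords U X e \<phi> W A b"
  interpret adapted_chart W "X \<circ> \<phi>" "\<lambda>j. e j \<circ> \<phi>" A b
    using adapted_coords_chart[OF _ _ ac] hyp by blast
  show "G_system_I W A (F_of b)" by (rule G_system)
  \<comment> \<open>At parameter 1 the factor \<open>mat lam\<close> of \<open>lax_I\<close> is the
    identity matrix.\<close>
  have \<theta>: "block_matrix 0 (- (A x ** C_mat i)) (C_mat i ** transpose (A x))
      (- (transpose (F_of b x) ** C_mat i) + C_mat i ** F_of b x) = lax_I (A x) (F_of b x) 1 i" for x i
    by (simp add: lax_I_def)
  show "let g = frame;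
            \<theta> = (\<lambda>x i. block_matrix
                       0 (- (A x ** C_mat i))
                       (C_mat i ** transpose (A x))
                       (- (transpose (F_of b x) ** C_mat i) + C_mat i ** F_of b x))
        in \<forall>x\<in>W. invertible (g x) \<and>
                 (\<forall>u. matrix_inv (g x) ** D g x u = (\<Sum>i\<in>UNIV. (u $ i) *\<^sub>R \<theta> x i)) \<and>
                 (\<forall>i. \<theta> x i = lax_I (A x) (F_of b x) 1 i)"
    unfolding Let_def \<theta> using invertible_frame frame_Lax by blast
next
  fix U :: "(real^'n) set" and X :: "real^'n \<Rightarrow> real^('m + 'n)" and e \<phi> W A b
  assume hyp: "immersion_on U X \<and> flat_induced_metric U X \<and> flat_normal_bundle U X \<and>
        parallel_normal_frame U X e \<and> nondegenerate_normal_bundle U X e"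
    and ac: "adapted_coords U X e \<phi> W A b \<and> connected W"
  interpret adapted_chart W "X \<circ> \<phi>" "\<lambda>j. e j \<circ> \<phi>" A b
    using adapted_coords_chart[of U X e \<phi> W A b] hyp ac by blast
  show "(\<exists>c. X ` \<phi> ` W \<subseteq> sphere c 1) \<longleftrightarrow> (\<exists>v :: real^'m. norm v = 1 \<and> (\<forall>x\<in>W. b x = v v* A x))"
    using spherical_iff ac by (simp add: image_comp)
next
  fix \<Omega> :: "(real^'n) set" and A :: "real^'n \<Rightarrow> real^'n^'m" and F b p
  assume hyp: "open \<Omega> \<and> G_system_I \<Omega> A F \<and> smooth_on \<Omega> b \<and>
        (\<forall>x\<in>\<Omega>. \<forall>i j. i \<noteq> j \<longrightarrow> partial (\<lambda>y. b y $ i) j x = F x $ i $ j * b x $ j)"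
    and p: "p \<in> \<Omega>" "\<forall>i. b p $ i \<noteq> 0"
  show "\<exists>V (Y :: real^'n \<Rightarrow> real^('m + 'n)) e.
              p \<in> V \<and> V \<subseteq> \<Omega> \<and> immersion_on V Y \<and> isometric_from_euclidean V Y \<and>
              parallel_normal_frame V Y e \<and> fundamental_forms V Y e A b"
  proof (rule immersion_from_G_system[of \<Omega> A F b p])
    show "b p $ i \<noteq> 0" for i using p(2) by simp
  qed (use hyp p(1) in auto)
qed

end
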